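(* Let $\Gamma$ be a $\mathbb{Z}^d$-periodic graph with fixed nonzero $\mathbb{Z}^d$-periodic edge weight $E$ and fundamental domain $W=\{u_1,\dots,u_N\}$, $N\ge 2$, without self-loops and with connected quotient graph, and let $D(z,V,\lambda)$ be its dispersion polynomial. Then $D(z,V,\lambda)$ is reducible in $R[\lambda]$ for every $V\in\mathbb{C}^N$ if and only if the following three conditions hold: (I) There exists a finite set $C\subset\mathbb{Z}^d$ such that $C_{ii}=C$ for every $i=1,\dots,N$; moreover, for any fixed $a\in C$, the edge weight $E((u_i,u_i+a))$ is independent of $i$. (II) For all distinct $i,j\in\{1,\dots,N\}$, $|C_{ij}|\le 1$. (III) (Given (II).) For any cycle $u_{i_1}\to u_{i_2}\to\cdots\to u_{i_m}\to u_{i_1}$ in the quotient graph, $\sum_{j=1}^m \alpha_{i_ji_{j+1}}=0$, where $\alpha_{i_ji_{j+1}}$ is the unique element of $C_{i_ji_{j+1}}$ and the indices $j$ are taken modulo $m$. If any of these conditions fails, then $D(z,V,\lambda)$ is irreducible in $R[\lambda]$ for generic $V\in\mathbb{C}^N$.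
   Context: Let $d\ge 1$, $R=\mathbb{C}[z_1^{\pm1},\dots,z_d^{\pm1}]$, and $z^a=z_1^{a_1}\cdots z_d^{a_d}$ for $a\in\mathbb{Z}^d$. Periodic graphs. A $\mathbb{Z}^d$-periodic graph is a locally finite (undirected) graph $\Gamma=(\mathcal V,\mathcal E)$ with an action of $\mathbb{Z}^d$ on $\mathcal V$, written $u\mapsto u+a$, such that no nonzero $a\in\mathbb{Z}^d$ fixes a vertex, $(u,v)\in\mathcal E$ implies $(u+a,v+a)\in\mathcal E$ for all $a$, and $\mathcal V/\mathbb{Z}^d$ is finite. A fundamental domain is a set $W=\{u_1,\dots,u_N\}$ containing exactly one vertex of each $\mathbb{Z}^d$-orbit. A $\mathbb{Z}^d$-periodic edge weight is a function $E:\mathcal E\to\mathbb{C}$ with $E((u,v))=E((v,u))=E((u+a,v+a))$; it is assumed nowhere zero. $\Gamma$ is assumed to have no self-loops. For $i,j\in\{1,\dots,N\}$ let $C_{ij}=\{a\in\mathbb{Z}^d : (u_i,u_j+a)\in\mathcal E\}$ (so $0\notin C_{ii}$). The quotient graph is the finite graph with vertex set $W$ in which, for $i\ne j$, $u_i$ and $u_j$ are adjacent iff $C_{ij}\neq\varnothing$. It is assumed connected, and $N\ge2$. Floquet matrix. Let $l_{ij}(z)=\sum_{a\in C_{ij}}E((u_i,u_j+a))z^a\in R$. For a periodic potential, identified with $V=(v_1,\dots,v_N)\in\mathbb{C}^N$ ($v_i$ the value on the orbit of $u_i$), let $L(z,V)$ be the $N\times N$ matrix with entries $L(z,V)_{ij}=\delta_{ij}v_i+l_{ij}(z)$.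 The dispersion polynomial is $D(z,V,\lambda)=\det(\lambda I-L(z,V))$; for each fixed $V$ it is an element of $R[\lambda]$. A property holds for generic $V\in\mathbb{C}^N$ if it holds for all $V$ in some nonempty Zariski open subset of $\mathbb{C}^N$. *)

theory Defs
  imports "HOL-Analysis.Analysis" "HOL-Library.Poly_Mapping"
    "HOL-Computational_Algebra.Computational_Algebra"
begin

section \<open>Periodic graphs\<close>

locale periodic_graph =
  fixes verts :: "'v set"
    and edges :: "('v \<times> 'v) set"
    and act :: "'v \<Rightarrow> int ^ 'd::finite \<Rightarrow> 'v"
  assumes edges_subset: "edges \<subseteq> verts \<times> verts"
    and undirected: "sym edges"
    and locally_finite: "x \<in> verts \<Longrightarrow> finite {y. (x, y) \<in> edges}"
    and act_closed: "x \<in> verts \<Longrightarrow> act x a \<in> verts"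
    and act_zero: "x \<in> verts \<Longrightarrow> act x 0 = x"
    and act_add: "x \<in> verts \<Longrightarrow> act (act x a) b = act x (a + b)"
    and act_free: "x \<in> verts \<Longrightarrow> a \<noteq> 0 \<Longrightarrow> act x a \<noteq> x"
    and edges_periodic: "(x, y) \<in> edges \<Longrightarrow> (act x a, act y a) \<in> edges"
    and finitely_many_orbits: "finite ((\<lambda>x. range (act x)) ` verts)"

definition fundamental_domain :: "'v set \<Rightarrow> ('v \<Rightarrow> int ^ 'd::finite \<Rightarrow> 'v) \<Rightarrow> 'v set \<Rightarrow> bool" where
  "fundamental_domain verts act W \<longleftrightarrow>
     W \<subseteq> verts \<and> (\<forall>x\<in>verts. \<exists>!y. y \<in> W \<and> y \<in> range (act x))"

text \<open>The values of \<open>w\<close> outside \<open>edges\<close> are irrelevant.\<close>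
definition periodic_edge_weight ::
    "('v \<times> 'v) set \<Rightarrow> ('v \<Rightarrow> int ^ 'd::finite \<Rightarrow> 'v) \<Rightarrow> ('v \<times> 'v \<Rightarrow> complex) \<Rightarrow> bool" where
  "periodic_edge_weight edges act w \<longleftrightarrow>
     (\<forall>(x, y)\<in>edges. w (x, y) = w (y, x) \<and> (\<forall>a. w (x, y) = w (act x a, act y a)) \<and> w (x, y) \<noteq> 0)"

definition shifts ::
    "('v \<times> 'v) set \<Rightarrow> ('v \<Rightarrow> int ^ 'd::finite \<Rightarrow> 'v) \<Rightarrow> ('n \<Rightarrow> 'v) \<Rightarrow> 'n \<Rightarrow> 'n \<Rightarrow> (int ^ 'd) set" where
  "shifts edges act u i j = {a. (u i, act (u j) a) \<in> edges}"

lemma (in periodic_graph) finite_shifts: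
  assumes "u i \<in> verts" "u j \<in> verts"
  shows "finite (shifts edges act u i j)"
proof -
  have "inj (act (u j))"
  proof (rule injI)
    fix a b assume "act (u j) a = act (u j) b"
    then have "act (u j) (a - b) = u j"
      using assms act_add[of "u j" a "- b"] act_add[of "u j" b "- b"] by (simp add: act_zero)
    then show "a = b"
      using act_free[OF assms(2), of "a - b"] by auto
  qed
  moreover have "shifts edges act u i j = act (u j) -` {y. (u i, y) \<in> edges}"
    by (auto simp: shifts_def)
  ultimately show ?thesis
    using finite_vimageI[OF locally_finite[OF assms(1)]] by simp
qed

text \<open>The vertex \<open>u i\<close> of the quotient graph is represented by its index \<open>i\<close>.\<close>
definition quotient_edges ::
    "('v \<times> 'v) set \<Rightarrow> ('v \<Rightarrow> int ^ 'd::finite \<Rightarrow> 'v) \<Rightarrow> ('n \<Rightarrow> 'v) \<Rightarrow> ('n \<times> 'n) set" where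
  "quotient_edges edges act u = {(i, j). i \<noteq> j \<and> shifts edges act u i j \<noteq> {}}"

definition graph_connected :: "('n \<times> 'n) set \<Rightarrow> bool" where
  "graph_connected G \<longleftrightarrow> (\<forall>i j. (i, j) \<in> G\<^sup>*)"

definition graph_cycle :: "('n \<times> 'n) set \<Rightarrow> 'n list \<Rightarrow> bool" where
  "graph_cycle G c \<longleftrightarrow> 3 \<le> length c \<and> distinct c \<and>
     (\<forall>k<length c. (c ! k, c ! (Suc k mod length c)) \<in> G)"


section \<open>Floquet matrix and dispersion polynomial\<close>

text \<open>The Laurent polynomial ring, as the group algebra of the exponent group: the monomial
  \<open>c z\<^sup>a\<close> is \<open>Poly_Mapping.single a c\<close>.\<close>
type_synonym 'd laurent = "(int, 'd) vec \<Rightarrow>\<^sub>0 complex"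

definition hop ::
    "('v \<times> 'v) set \<Rightarrow> ('v \<Rightarrow> int ^ 'd::finite \<Rightarrow> 'v) \<Rightarrow> ('v \<times> 'v \<Rightarrow> complex) \<Rightarrow> ('n \<Rightarrow> 'v)
      \<Rightarrow> 'n \<Rightarrow> 'n \<Rightarrow> 'd laurent" where
  "hop edges act w u i j =
     (\<Sum>a\<in>shifts edges act u i j. Poly_Mapping.single a (w (u i, act (u j) a)))"

definition floquet_matrix ::
    "('v \<times> 'v) set \<Rightarrow> ('v \<Rightarrow> int ^ 'd::finite \<Rightarrow> 'v) \<Rightarrow> ('v \<times> 'v \<Rightarrow> complex) \<Rightarrow> ('n::finite \<Rightarrow> 'v)
      \<Rightarrow> complex ^ 'n \<Rightarrow> 'd laurent ^ 'n ^ 'n" where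
  "floquet_matrix edges act w u V =
     (\<chi> i j. (if i = j then Poly_Mapping.single 0 (V $ i) else 0) + hop edges act w u i j)"

text \<open>The polynomial variable of the type \<open>'d laurent poly\<close> is the spectral parameter.\<close>
definition dispersion_poly ::
    "('v \<times> 'v) set \<Rightarrow> ('v \<Rightarrow> int ^ 'd::finite \<Rightarrow> 'v) \<Rightarrow> ('v \<times> 'v \<Rightarrow> complex) \<Rightarrow> ('n::finite \<Rightarrow> 'v)
      \<Rightarrow> complex ^ 'n \<Rightarrow> 'd laurent poly" where
  "dispersion_poly edges act w u V =
     det (mat [:0, 1:] - map_matrix (\<lambda>r. [:r:]) (floquet_matrix edges act w u V))"

definition reducible :: "'a::comm_semiring_1 \<Rightarrow> bool" where
  "reducible p \<longleftrightarrow> p \<noteq> 0 \<and> (\<exists>a b. p = a * b \<and> \<not> a dvd 1 \<and> \<not> b dvd 1)"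


section \<open>Generic potentials\<close>

text \<open>A polynomial in variables indexed by \<open>'n\<close> is a finitely supported map from exponent
  vectors \<open>'n \<Rightarrow>\<^sub>0 nat\<close> to coefficients.\<close>
definition mpoly_eval :: "(('n::finite \<Rightarrow>\<^sub>0 nat) \<Rightarrow>\<^sub>0 complex) \<Rightarrow> complex ^ 'n \<Rightarrow> complex" where
  "mpoly_eval p V =
     (\<Sum>m\<in>Poly_Mapping.keys p.
        Poly_Mapping.lookup p m * (\<Prod>i\<in>UNIV. (V $ i) ^ Poly_Mapping.lookup m i))"

definition zariski_closed :: "(complex ^ 'n::finite) set \<Rightarrow> bool" where
  "zariski_closed S \<longleftrightarrow> (\<exists>F. S = {V. \<forall>p\<in>F. mpoly_eval p V = 0})"

definition zariski_open :: "(complex ^ 'n::finite) set \<Rightarrow> bool" where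
  "zariski_open S \<longleftrightarrow> zariski_closed (- S)"

definition holds_generically :: "(complex ^ 'n::finite \<Rightarrow> bool) \<Rightarrow> bool" where
  "holds_generically P \<longleftrightarrow> (\<exists>U. zariski_open U \<and> U \<noteq> {} \<and> (\<forall>V\<in>U. P V))"


section \<open>The three conditions\<close>

definition cond_I ::
    "('v \<times> 'v) set \<Rightarrow> ('v \<Rightarrow> int ^ 'd::finite \<Rightarrow> 'v) \<Rightarrow> ('v \<times> 'v \<Rightarrow> complex) \<Rightarrow> ('n \<Rightarrow> 'v) \<Rightarrow> bool" where
  "cond_I edges act w u \<longleftrightarrow>
     (\<exists>C. finite C \<and> (\<forall>i. shifts edges act u i i = C) \<and>
        (\<forall>a\<in>C. \<forall>i j. w (u i, act (u i) a) = w (u j, act (u j) a)))"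

definition cond_II ::
    "('v \<times> 'v) set \<Rightarrow> ('v \<Rightarrow> int ^ 'd::finite \<Rightarrow> 'v) \<Rightarrow> ('n \<Rightarrow> 'v) \<Rightarrow> bool" where
  "cond_II edges act u \<longleftrightarrow> (\<forall>i j. i \<noteq> j \<longrightarrow> card (shifts edges act u i j) \<le> 1)"

text \<open>Meaningful only together with \<open>cond_II\<close>, which makes \<open>the_elem\<close> pick the unique
  element of the nonempty set \<open>shifts\<close> along each quotient edge.\<close>
definition cond_III ::
    "('v \<times> 'v) set \<Rightarrow> ('v \<Rightarrow> int ^ 'd::finite \<Rightarrow> 'v) \<Rightarrow> ('n \<Rightarrow> 'v) \<Rightarrow> bool" where
  "cond_III edges act u \<longleftrightarrow>
     (\<forall>c. graph_cycle (quotient_edges edges act u) c \<longrightarrow>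
        (\<Sum>k<length c. the_elem (shifts edges act u (c ! k) (c ! (Suc k mod length c)))) = 0)"

end

theory Submission
  imports Defs "Subresultants.Subresultant_Gcd" "HOL-Computational_Algebra.Field_as_Ring"
    "HOL-Combinatorics.Cycles"
begin

text \<open>Under the three conditions the matrix, up to adding a multiple of the identity, is conjugate
  to a constant one by a diagonal matrix of monomials, so after a shift of the spectral parameter
  the dispersion polynomial has constant coefficients and splits.

  Otherwise it suffices to find one irreducible potential, because reducibility is a closed
  condition: the roots of the two monic factors at finitely many points of the torus are integral
  over the parameters and can be eliminated by resultants. The potential is found by
  adding the vertices one at a time. As \<open>v \<rightarrow> \<infinity>\<close> at the new vertex, the factors of the pencil
  \<open>D0 - v D'\<close> converge to factors of the irreducible \<open>D'\<close>, so one of them is linear, and comparing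
  its roots for different \<open>v\<close> shows that this is impossible unless \<open>D'\<close> is linear and constant in
  \<open>z\<close>. The induction starts at an edge violating the first two conditions or, if there is none, at
  a chordless cycle violating the third.\<close>

hide_const (open) Measure_Space.additive Matrix.mat Determinant.det Matrix.vec Matrix.row
  Matrix.transpose_mat module.smult
hide_type (open) Matrix.vec
no_notation Matrix.vec_index (infixl "$" 100)
no_notation fps_nth (infixl "$" 75)

subsection \<open>Laurent polynomials form a domain\<close>

text \<open>Sorting permutations by whether they fix a vertex \<open>k\<close> writes the
  determinant as \<open>(x - v - l k k) * D' + Q'\<close>, affine in the potential \<open>v\<close>
  at \<open>k\<close>; this is the origin of the pencil. The determinant is monic in the spectral
  parameter, so its factors may be taken monic, and a monic factor has its exponents of z in a box
  fixed by the product. For all \<open>v\<close> the factors thus lie in one finite-dimensional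
  space, where bounded sequences have limits. The exceptional case, \<open>D'\<close> linear and all
  coefficients constant in z, really occurs for pairs of vertices, so the induction cannot start at
  a single vertex and needs an irreducible block of size at least 2. For one edge, the exceptional
  case says precisely that this edge violates neither of the first two conditions.\<close>

abbreviation mcoeff :: "('g \<Rightarrow>\<^sub>0 complex) poly \<Rightarrow> nat \<Rightarrow> 'g \<Rightarrow> complex" where
  "mcoeff P j a \<equiv> Poly_Mapping.lookup (coeff P j) a"

text \<open>The support of \<open>P\<close> in the joint exponents of z and of the spectral
  parameter; its convex hull is the Newton polytope.\<close>

definition mons :: "('g \<Rightarrow>\<^sub>0 complex) poly \<Rightarrow> ('g \<times> nat) set" where
  "mons P = {(a, j). mcoeff P j a \<noteq> 0}"

lemma lookup_times_sum:
  fixes p q :: "'g::ab_group_add \<Rightarrow>\<^sub>0 complex"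
  assumes "finite K" "Poly_Mapping.keys p \<subseteq> K"
  shows "Poly_Mapping.lookup (p * q) c
    = (\<Sum>a\<in>K. Poly_Mapping.lookup p a * Poly_Mapping.lookup q (c - a))"
proof -
  have inner: "(Sum_any (\<lambda>b. Poly_Mapping.lookup q b when c = a + b)) = Poly_Mapping.lookup q (c - a)" for a
  proof -
    have "(\<lambda>b. Poly_Mapping.lookup q b when c = a + b) = (\<lambda>b. Poly_Mapping.lookup q b when c - a = b)"
      by (auto simp: fun_eq_iff when_def algebra_simps)
    then show ?thesis by (simp only: Sum_any_when_equal')
  qed
  have "Poly_Mapping.lookup (p * q) c
      = Sum_any (\<lambda>a. Poly_Mapping.lookup p a * Poly_Mapping.lookup q (c - a))"
    by (simp add: lookup_mult inner)
  also have "\<dots> = (\<Sum>a\<in>K. Poly_Mapping.lookup p a * Poly_Mapping.lookup q (c - a))"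
    by (rule Sum_any.expand_superset) (use assms in \<open>auto simp: in_keys_iff\<close>)
  finally show ?thesis .
qed

text \<open>\<open>K\<close> bounds the support of \<open>A\<close> alone and can be shared by a
  whole sequence, so limits may be taken termwise.\<close>

lemma mcoeff_times:
  fixes A B :: "('g::ab_group_add \<Rightarrow>\<^sub>0 complex) poly"
  assumes "finite K" "\<And>i. i \<le> n \<Longrightarrow> Poly_Mapping.keys (coeff A i) \<subseteq> K"
  shows "mcoeff (A * B) n c = (\<Sum>i\<le>n. \<Sum>a\<in>K. mcoeff A i a * mcoeff B (n - i) (c - a))"
  unfolding coeff_mult lookup_sum
  by (intro sum.cong refl lookup_times_sum assms) auto

lemma poly_eqI_mcoeff:
  "(\<And>j a. mcoeff P j a = mcoeff Q j a) \<Longrightarrow> P = Q"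
  by (intro poly_eqI poly_mapping_eqI)

lemma finite_mons: "finite (mons P)"
proof -
  have "mons P \<subseteq> (\<Union>j\<le>degree P. Poly_Mapping.keys (coeff P j) \<times> {j})"
    by (auto simp: mons_def in_keys_iff intro!: le_degree)
  then show ?thesis by (rule finite_subset) auto
qed

lemma mons_empty_iff [simp]: "mons P = {} \<longleftrightarrow> P = 0"
  by (auto simp: mons_def intro!: poly_eqI_mcoeff)

text \<open>The weight is injective on each support, so each factor has a unique heaviest monomial,
  and only this pair of monomials contributes to the coefficient at the sum of their
  exponents.\<close>

lemma mcoeff_times_top:
  fixes A B :: "('g::ab_group_add \<Rightarrow>\<^sub>0 complex) poly" and \<phi> :: "'g \<Rightarrow> int"
  assumes add: "additive \<phi>"
    and inj: "inj_on (\<lambda>(a, j). \<phi> a + c * int j) (mons A)" "inj_on (\<lambda>(a, j). \<phi> a + c * int j) (mons B)"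
    and ne: "A \<noteq> 0" "B \<noteq> 0"
  obtains a i b j where "(a, i) \<in> mons A" "(b, j) \<in> mons B"
    "\<And>a' i'. (a', i') \<in> mons A \<Longrightarrow> \<phi> a' + c * int i' \<le> \<phi> a + c * int i"
    "\<And>b' j'. (b', j') \<in> mons B \<Longrightarrow> \<phi> b' + c * int j' \<le> \<phi> b + c * int j"
    "mcoeff (A * B) (i + j) (a + b) = mcoeff A i a * mcoeff B j b"
proof -
  define wt where "wt = (\<lambda>(a, j). \<phi> a + c * int j)"
  have ex: "\<exists>m\<in>mons P. \<forall>m'\<in>mons P. wt m' \<le> wt m" if "P \<noteq> 0" for P
  proof -
    have "Max (wt ` mons P) \<in> wt ` mons P"
      using finite_mons[of P] that by (intro Max_in) auto
    then obtain m where "m \<in> mons P" "wt m = Max (wt ` mons P)" by auto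
    then show ?thesis using finite_mons[of P] by (intro bexI[of _ m]) auto
  qed
  obtain a i where ai: "(a, i) \<in> mons A" "\<And>m. m \<in> mons A \<Longrightarrow> wt m \<le> wt (a, i)"
    using ex[OF ne(1)] by auto
  obtain b j where bj: "(b, j) \<in> mons B" "\<And>m. m \<in> mons B \<Longrightarrow> wt m \<le> wt (b, j)"
    using ex[OF ne(2)] by auto
  define K where "K = fst ` mons A"
  have K: "finite K" "\<And>i. Poly_Mapping.keys (coeff A i) \<subseteq> K"
    by (simp add: K_def finite_mons, force simp: K_def mons_def in_keys_iff)
  have zero: "mcoeff A k x * mcoeff B (i + j - k) (a + b - x) = 0"
    if "(x, k) \<noteq> (a, i)" "k \<le> i + j" for x k
  proof (rule ccontr)
    assume "\<not> ?thesis"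
    then have m: "(x, k) \<in> mons A" "(a + b - x, i + j - k) \<in> mons B"
      by (auto simp: mons_def)
    have "wt (x, k) + wt (a + b - x, i + j - k) = wt (a, i) + wt (b, j)"
      using that additive.add[OF add, of "a + b - x" x] additive.add[OF add, of a b]
      by (simp add: wt_def algebra_simps of_nat_diff)
    then have "wt (x, k) = wt (a, i)"
      using ai(2)[OF m(1)] bj(2)[OF m(2)] by linarith
    then show False
      using inj(1) m(1) ai(1) that(1) unfolding wt_def inj_on_def by blast
  qed
  have "mcoeff (A * B) (i + j) (a + b)
      = (\<Sum>k\<le>i + j. \<Sum>x\<in>K. mcoeff A k x * mcoeff B (i + j - k) (a + b - x))"
    using K by (intro mcoeff_times) auto
  also have "\<dots> = (\<Sum>(k, x)\<in>{..i + j} \<times> K. mcoeff A k x * mcoeff B (i + j - k) (a + b - x))"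
    by (rule sum.cartesian_product)
  also have "\<dots> = (\<Sum>(k, x)\<in>{(i, a)}. mcoeff A k x * mcoeff B (i + j - k) (a + b - x))"
    using zero K(1) ai(1) by (intro sum.mono_neutral_right) (force simp: K_def)+
  finally have "mcoeff (A * B) (i + j) (a + b) = mcoeff A i a * mcoeff B j b" by simp
  with ai bj show thesis
    by (intro that[of a i b j]) (auto simp: wt_def)
qed

text \<open>Evaluating the coordinates at powers of a non-root \<open>t\<close> of finitely many polynomials.\<close>
lemma ex_separating_functional:
  fixes S :: "(int ^ 'd::finite) set"
  assumes "finite S"
  obtains \<phi> :: "int ^ 'd \<Rightarrow> int" where "additive \<phi>" "inj_on \<phi> S"
proof -
  obtain e :: "'d \<Rightarrow> nat" where e: "inj e"
    using finite_imp_inj_to_nat_seg[of "UNIV :: 'd set"] by auto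
  define P where "P = (\<lambda>a b :: int ^ 'd. \<Sum>i\<in>UNIV. monom (a $ i - b $ i) (e i))"
  have Pnz: "P a b \<noteq> 0" if ab: "a \<noteq> b" for a b
  proof -
    obtain i where i: "a $ i \<noteq> b $ i" using ab
      by (auto simp: Finite_Cartesian_Product.vec_eq_iff)
    have "coeff (P a b) (e i) = (\<Sum>k\<in>UNIV. if k = i then a $ k - b $ k else 0)"
      unfolding P_def coeff_sum coeff_monom
        by (intro sum.cong refl) (use e in \<open>auto dest: injD\<close>)
    then have "coeff (P a b) (e i) = a $ i - b $ i" by simp
    with i show ?thesis by auto
  qed
  \<comment> \<open>\<open>X\<close> holds the integers \<open>t\<close> at which two distinct
    points of \<open>S\<close> would get the same value.\<close>
  define X where "X = (\<Union>(a, b)\<in>{(a, b) \<in> S \<times> S. a \<noteq> b}. {t. poly (P a b) t = 0})"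
  have "finite X"
    unfolding X_def using assms Pnz
    by (intro finite_UN_I) (auto intro!: poly_roots_finite intro: finite_subset[of _ "S \<times> S"])
  then obtain t where t: "t \<notin> X"
    using ex_new_if_finite[OF infinite_UNIV_int] by blast
  define \<phi> where "\<phi> = (\<lambda>a :: int ^ 'd. \<Sum>i\<in>UNIV. a $ i * t ^ e i)"
  have "\<phi> a - \<phi> b = poly (P a b) t" for a b
    by (simp add: \<phi>_def P_def poly_sum poly_monom algebra_simps sum_subtractf)
  then have "inj_on \<phi> S"
    using t unfolding X_def inj_on_def
      by (smt (verit, best) UN_I case_prod_conv mem_Collect_eq mem_Sigma_iff)
  moreover have "additive \<phi>"
    by unfold_locales (simp add: \<phi>_def algebra_simps sum.distrib)
  ultimately show thesis using that by blast
qed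

text \<open>The power of the spectral parameter becomes an extra coordinate, indexed by
  \<open>None\<close>. An additive functional is linear in that coordinate, with slope
  \<open>c\<close> its value at the unit vector.\<close>

lemma ex_separating_functional_pairs:
  fixes S :: "((int ^ 'd::finite) \<times> nat) set"
  assumes "finite S"
  obtains \<phi> :: "int ^ 'd \<Rightarrow> int" and c :: int where "additive \<phi>"
    "inj_on (\<lambda>(a, j). \<phi> a + c * int j) S"
proof -
  define ext :: "int ^ 'd \<Rightarrow> int \<Rightarrow> int ^ 'd option" where
    "ext = (\<lambda>a k. \<chi> i. case i of None \<Rightarrow> k | Some i \<Rightarrow> a $ i)"
  have ext_add: "ext (a + b) (k + l) = ext a k + ext b l" for a b k l
    by (auto simp: ext_def Finite_Cartesian_Product.vec_eq_iff split: option.splits)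
  have ext_inj: "ext a k = ext b l \<Longrightarrow> a = b \<and> k = l" for a b k l
    by (force simp: ext_def Finite_Cartesian_Product.vec_eq_iff split: option.splits)
  obtain \<psi> :: "int ^ 'd option \<Rightarrow> int" where \<psi>: "additive \<psi>" "inj_on \<psi> ((\<lambda>(a, j). ext a (int j)) ` S)"
    by (rule ex_separating_functional[OF finite_imageI[OF assms, of "\<lambda>(a, j). ext a (int j)"]])
  have \<psi>_ext: "\<psi> (ext a (int j)) = \<psi> (ext a 0) + \<psi> (ext 0 1) * int j" for a j
  proof (induction j)
    case (Suc j)
    have "ext a (int (Suc j)) = ext a (int j) + ext 0 1"
      using ext_add[of a 0 "int j" 1] by (simp add: add.commute)
    then show ?case using Suc by (simp add: additive.add[OF \<psi>(1)] algebra_simps)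
  qed auto
  have "inj_on (\<lambda>(a, j). ext a (int j)) S"
    by (auto simp: inj_on_def dest!: ext_inj)
  then have "inj_on (\<psi> \<circ> (\<lambda>(a, j). ext a (int j))) S"
    using \<psi>(2) by (rule comp_inj_on)
  moreover have "\<psi> \<circ> (\<lambda>(a, j). ext a (int j)) = (\<lambda>(a, j). \<psi> (ext a 0) + \<psi> (ext 0 1) * int j)"
    by (auto simp: \<psi>_ext)
  moreover have "additive (\<lambda>a. \<psi> (ext a 0))"
    using ext_add[of _ _ 0 0] by unfold_locales (simp add: additive.add[OF \<psi>(1), symmetric])
  ultimately show thesis using that[of "\<lambda>a. \<psi> (ext a 0)" "\<psi> (ext 0 1)"] by simp
qed

text \<open>The product of the two heaviest coefficients is a nonzero complex number.\<close>

lemma laurent_poly_mult_nonzero: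
  fixes A B :: "'d::finite laurent poly"
  assumes "A \<noteq> 0" "B \<noteq> 0"
  shows "A * B \<noteq> 0"
proof -
  obtain \<phi> :: "int ^ 'd \<Rightarrow> int" and c where add: "additive \<phi>"
    and inj: "inj_on (\<lambda>(a, j). \<phi> a + c * int j) (mons A \<union> mons B)"
    using ex_separating_functional_pairs[of "mons A \<union> mons B"] finite_mons by blast
  obtain a i b j where "(a, i) \<in> mons A" "(b, j) \<in> mons B"
    and "mcoeff (A * B) (i + j) (a + b) = mcoeff A i a * mcoeff B j b"
    using mcoeff_times_top[OF add inj_on_subset[OF inj Un_upper1] inj_on_subset[OF inj Un_upper2] assms]
    by metis
  then show ?thesis by (auto simp: mons_def)
qed

lemma laurent_mult_nonzero:
  fixes p q :: "'d::finite laurent"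
  assumes "p \<noteq> 0" "q \<noteq> 0"
  shows "p * q \<noteq> 0"
  using laurent_poly_mult_nonzero[of "[:p:]" "[:q:]"] assms by (auto simp: mult.commute)

lemma laurent_mult_eq_0_iff [simp]:
  fixes p q :: "'d::finite laurent" shows "p * q = 0 \<longleftrightarrow> p = 0 \<or> q = 0"
  using laurent_mult_nonzero[of p q] by auto

lemma laurent_poly_mult_eq_0_iff [simp]:
  fixes A B :: "'d::finite laurent poly" shows "A * B = 0 \<longleftrightarrow> A = 0 \<or> B = 0"
  using laurent_poly_mult_nonzero[of A B] by auto

lemma laurent_poly_mult_left_cancel:
  fixes A B C :: "'d::finite laurent poly"
  assumes "A * B = A * C" "A \<noteq> 0" shows "B = C"
  using laurent_poly_mult_eq_0_iff[of A "B - C"] assms by (simp add: algebra_simps)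

lemma laurent_poly_degree_mult:
  fixes A B :: "'d::finite laurent poly"
  assumes "A \<noteq> 0" "B \<noteq> 0"
  shows "degree (A * B) = degree A + degree B"
proof (rule antisym[OF degree_mult_le])
  show "degree A + degree B \<le> degree (A * B)"
    using assms by (intro le_degree) (simp add: coeff_mult_degree_sum)
qed

lemma laurent_poly_lead_coeff_mult:
  fixes A B :: "'d::finite laurent poly"
  shows "lead_coeff (A * B) = lead_coeff A * lead_coeff B"
  by (cases "A = 0 \<or> B = 0") (auto simp: laurent_poly_degree_mult coeff_mult_degree_sum)

text \<open>The Newton polytope of a monic factor lies in that of the product: its cofactor is monic
  too, hence contributes a nonnegative top degree in every direction.\<close>
lemma monic_factor_functional_le:
  fixes A B :: "'d::finite laurent poly" and \<psi> :: "int ^ 'd \<Rightarrow> int"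
  assumes \<psi>: "additive \<psi>"
    and monic: "lead_coeff A = 1" "lead_coeff B = 1"
    and le: "\<And>a j. (a, j) \<in> mons (A * B) \<Longrightarrow> \<psi> a \<le> s"
    and mem: "(x, k) \<in> mons A"
  shows "\<psi> x \<le> s"
proof -
  have ne: "A \<noteq> 0" "B \<noteq> 0" using monic by auto
  define M where "M = mons A \<union> mons B"
  have fM: "finite M" by (simp add: M_def finite_mons)
  obtain \<phi> :: "int ^ 'd \<Rightarrow> int" and c where \<phi>: "additive \<phi>"
    and inj: "inj_on (\<lambda>(a, j). \<phi> a + c * int j) M"
    using ex_separating_functional_pairs[OF fM] by blast
  \<comment> \<open>\<open>L\<close> exceeds twice every weight in absolute value, so
    \<open>L * \<psi>\<close> decides first and the separating weight only breaks ties.\<close>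
  define L where "L = 1 + 2 * (\<Sum>(a, j)\<in>M. \<bar>\<phi> a + c * int j\<bar>)"
  have bound: "2 * (\<phi> a + c * int j) < L" "- L < 2 * (\<phi> a + c * int j)" if "(a, j) \<in> M" for a j
  proof -
    have "\<bar>\<phi> a + c * int j\<bar> \<le> (\<Sum>(a, j)\<in>M. \<bar>\<phi> a + c * int j\<bar>)"
      using member_le_sum[OF that, of "\<lambda>(a, j). \<bar>\<phi> a + c * int j\<bar>"] fM
        by auto
    then have "\<bar>2 * (\<phi> a + c * int j)\<bar> < L" by (simp add: L_def abs_mult)
    then show "2 * (\<phi> a + c * int j) < L" "- L < 2 * (\<phi> a + c * int j)"
      unfolding abs_less_iff by auto
  qed
  have dom: "\<psi> a \<le> \<psi> b"
    if "(a, i) \<in> M" "(b, j) \<in> M" "L * \<psi> a + \<phi> a + c * int i \<le> L * \<psi> b + \<phi> b + c * int j" for a i b j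
  proof (rule ccontr)
    assume "\<not> \<psi> a \<le> \<psi> b"
    then have "\<psi> b + 1 \<le> \<psi> a" by simp
    moreover have "0 \<le> L" by (simp add: L_def sum_nonneg case_prod_unfold)
    ultimately have "L * (\<psi> b + 1) \<le> L * \<psi> a" by (rule mult_left_mono)
    then have "L * \<psi> b + L \<le> L * \<psi> a" by (simp add: algebra_simps)
    then show False using bound[OF that(1)] bound[OF that(2)] that(3) by (simp add: algebra_simps)
  qed
  have inj': "inj_on (\<lambda>(a, j). (L * \<psi> a + \<phi> a) + c * int j) M"
  proof (rule inj_onI, clarify)
    fix a i b j assume *: "(a, i) \<in> M" "(b, j) \<in> M"
      "L * \<psi> a + \<phi> a + c * int i = L * \<psi> b + \<phi> b + c * int j"
    then have "\<psi> a = \<psi> b" using dom[of a i b j] dom[of b j a i] by linarith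
    then show "a = b \<and> i = j" using * inj by (auto simp: inj_on_def)
  qed
  have \<kappa>: "additive (\<lambda>a. L * \<psi> a + \<phi> a)"
    by unfold_locales (simp add: additive.add[OF \<psi>] additive.add[OF \<phi>] algebra_simps)
  obtain a i b j where top: "(a, i) \<in> mons A" "(b, j) \<in> mons B"
    "\<And>a' i'. (a', i') \<in> mons A \<Longrightarrow> (L * \<psi> a' + \<phi> a') + c * int i' \<le> (L * \<psi> a + \<phi> a) + c * int i"
    "\<And>b' j'. (b', j') \<in> mons B \<Longrightarrow> (L * \<psi> b' + \<phi> b') + c * int j' \<le> (L * \<psi> b + \<phi> b) + c * int j"
    "mcoeff (A * B) (i + j) (a + b) = mcoeff A i a * mcoeff B j b"
    using mcoeff_times_top[OF \<kappa> inj_on_subset[OF inj'] inj_on_subset[OF inj'] ne]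
    unfolding M_def by (metis Un_upper1 Un_upper2)
  have "(a + b, i + j) \<in> mons (A * B)" using top by (auto simp: mons_def)
  then have 1: "\<psi> a + \<psi> b \<le> s" using le additive.add[OF \<psi>] by metis
  \<comment> \<open>The leading term of the monic \<open>B\<close> has exponent 0 in z, so the top
    of \<open>B\<close> has a \<psi>-value of at least 0.\<close>
  have "(0, degree B) \<in> mons B" using monic by (simp add: mons_def)
  then have "\<psi> 0 \<le> \<psi> b" using top(2) top(4) dom[of 0 "degree B" b j]
    by (auto simp: M_def)
  moreover have "\<psi> 0 = 0" by (rule additive.zero[OF \<psi>])
  moreover have "\<psi> x \<le> \<psi> a" using top(1,3) mem dom[of x k a i] by (auto simp: M_def)
  ultimately show ?thesis using 1 by linarith
qed

section \<open>Boxes of exponents and monic factorisations\<close>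

definition int_box :: "int \<Rightarrow> (int ^ 'd::finite) set" where
  "int_box s = {a. \<forall>i. \<bar>a $ i\<bar> \<le> s}"

lemma finite_box: "finite (int_box s :: (int ^ 'd::finite) set)"
proof -
  have "int_box s \<subseteq> (\<lambda>f. \<chi> i. f i) ` (PiE (UNIV :: 'd set) (\<lambda>_. {-s..s}))"
  proof
    fix a :: "int ^ 'd" assume "a \<in> int_box s"
    then have "(\<lambda>i. a $ i) \<in> PiE UNIV (\<lambda>_. {-s..s})"
      by (auto simp: int_box_def abs_le_iff minus_le_iff)
    then show "a \<in> (\<lambda>f. \<chi> i. f i) ` (PiE UNIV (\<lambda>_. {-s..s}))"
      by (intro image_eqI[of _ _ "\<lambda>i. a $ i"]) auto
  qed
  then show ?thesis by (rule finite_subset) (intro finite_imageI finite_PiE, auto)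
qed

lemma finite_subset_box:
  assumes "finite (K :: (int ^ 'd::finite) set)" obtains s where "K \<subseteq> int_box s"
proof
  have "\<bar>a $ i\<bar> \<le> (\<Sum>a\<in>K. \<Sum>i\<in>UNIV. \<bar>a $ i\<bar>)" if "a \<in> K" for a i
    using member_le_sum[of i UNIV "\<lambda>i. \<bar>a $ i\<bar>"] member_le_sum[OF that, of "\<lambda>a. \<Sum>i\<in>UNIV. \<bar>a $ i\<bar>"] assms
    by (force simp: sum_nonneg)
  then show "K \<subseteq> int_box (\<Sum>a\<in>K. \<Sum>i\<in>UNIV. \<bar>a $ i\<bar>)"
    by (auto simp: int_box_def)
qed

text \<open>Each coordinate and its negative is a functional to which
  \<open>monic_factor_functional_le\<close> applies. The box depends on the product only, so the
  monic factors of all members of a family with common support share one finite support.\<close>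

lemma monic_factor_in_box:
  fixes A B :: "'d::finite laurent poly"
  assumes monic: "lead_coeff A = 1" "lead_coeff B = 1"
    and le: "\<And>a j. (a, j) \<in> mons (A * B) \<Longrightarrow> a \<in> int_box s"
    and mem: "(x, k) \<in> mons A"
  shows "x \<in> int_box s"
proof -
  have "x $ i \<le> s \<and> - (x $ i) \<le> s" for i
  proof
    have "additive (\<lambda>a :: int ^ 'd. a $ i)" "additive (\<lambda>a :: int ^ 'd. - (a $ i))"
      by (unfold_locales; simp)+
    from this[THEN monic_factor_functional_le, OF monic _ mem]
    show "x $ i \<le> s" "- (x $ i) \<le> s" using le by (force simp: int_box_def abs_le_iff)+
  qed
  then show ?thesis by (auto simp: int_box_def abs_le_iff)
qed

lemma laurent_poly_dvd_1_degree:
  fixes A :: "'d::finite laurent poly"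
  assumes "A dvd 1" shows "degree A = 0"
proof -
  obtain B where B: "1 = A * B" using assms by (elim dvdE)
  then have "A \<noteq> 0" "B \<noteq> 0" by auto
  then have "degree A + degree B = 0" using laurent_poly_degree_mult[of A B] B by simp
  then show ?thesis by simp
qed

lemma laurent_smult_eq_0_iff [simp]:
  fixes P :: "'d::finite laurent poly" shows "smult p P = 0 \<longleftrightarrow> p = 0 \<or> P = 0"
  using laurent_poly_mult_eq_0_iff[of "[:p:]" P] by simp

lemma monic_degree_0: "lead_coeff A = 1 \<Longrightarrow> degree A = 0 \<Longrightarrow> A = 1"
  by (metis degree_eq_zeroE lead_coeff_pCons(2) one_pCons pCons_0_0 degree_pCons_0 coeff_pCons_0)

text \<open>The leading coefficients of the two factors are inverse units, and each factor is
  rescaled by the leading coefficient of the other. A factor of degree 0 would itself be a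
  unit.\<close>

lemma not_irreducible_monic_factors:
  fixes D :: "'d::finite laurent poly"
  assumes "lead_coeff D = 1" "1 \<le> degree D" "\<not> irreducible D"
  obtains A B where "D = A * B" "lead_coeff A = 1" "lead_coeff B = 1" "1 \<le> degree A" "1 \<le> degree B"
proof -
  have "D \<noteq> 0" "\<not> D dvd 1" using assms laurent_poly_dvd_1_degree[of D] by auto
  then obtain a b where ab: "D = a * b" "\<not> a dvd 1" "\<not> b dvd 1"
    using assms(3) unfolding irreducible_def by blast
  have lc: "lead_coeff a * lead_coeff b = 1"
    using assms(1) ab(1) laurent_poly_lead_coeff_mult by metis
  have deg: "1 \<le> degree a" if "\<not> a dvd 1" "lead_coeff a * c = 1" for a :: "'d laurent poly" and c
  proof (rule ccontr)
    assume "\<not> ?thesis"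
    then have "degree a = 0" by simp
    then obtain x where x: "a = [:x:]" by (rule degree_eq_zeroE)
    then have "x * c = 1" using that(2) by simp
    then have "1 = a * [:c:]" unfolding x by (simp add: mult.commute[of c])
    then have "a dvd 1" by (rule dvdI)
    then show False using that(1) by simp
  qed
  have unit_smult: "degree (smult c a) = degree a" "lead_coeff (smult c a) = c * lead_coeff a"
    if "c * d = 1" for c d :: "'d laurent" and a
  proof -
    show deg: "degree (smult c a) = degree a"
    proof (rule antisym[OF degree_smult_le])
      have "smult d (smult c a) = a" using that by (simp add: mult.commute)
      then show "degree a \<le> degree (smult c a)" by (metis degree_smult_le)
    qed
    show "lead_coeff (smult c a) = c * lead_coeff a" by (simp add: deg)
  qed
  show thesis
  proof (rule that[of "smult (lead_coeff b) a" "smult (lead_coeff a) b"])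
    show "D = smult (lead_coeff b) a * smult (lead_coeff a) b"
      using ab(1) lc by (simp add: mult.commute)
    show "lead_coeff (smult (lead_coeff b) a) = 1" "lead_coeff (smult (lead_coeff a) b) = 1"
      using lc unit_smult(2) by (metis mult.commute)+
    show "1 \<le> degree (smult (lead_coeff b) a)" "1 \<le> degree (smult (lead_coeff a) b)"
      using deg[OF ab(2) lc] deg[OF ab(3), of "lead_coeff a"] lc unit_smult(1)
        by (metis mult.commute)+
  qed
qed

lemma monic_mult_not_irreducible:
  fixes A B :: "'d::finite laurent poly"
  assumes "1 \<le> degree A" "1 \<le> degree B"
  shows "\<not> irreducible (A * B)" "reducible (A * B)"
proof -
  have "\<not> A dvd 1" "\<not> B dvd 1" "A \<noteq> 0" "B \<noteq> 0"
    using assms laurent_poly_dvd_1_degree by force+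
  then show "\<not> irreducible (A * B)" "reducible (A * B)"
    unfolding irreducible_def reducible_def by auto
qed

section \<open>Polynomials whose coefficients are constant in z\<close>

definition lconst :: "complex \<Rightarrow> 'd::finite laurent" where
  "lconst c = Poly_Mapping.single 0 c"

interpretation lconst: inj_comm_ring_hom lconst
proof unfold_locales
  show "c = 0" if "lconst c = 0" for c
    using that by (metis lconst_def lookup_single_eq lookup_zero)
qed (simp_all add: lconst_def single_add mult_single)

abbreviation cpoly :: "complex poly \<Rightarrow> 'd::finite laurent poly" where
  "cpoly \<equiv> map_poly lconst"

lemma lookup_lconst: "Poly_Mapping.lookup (lconst c) a = (if a = 0 then c else 0)"
  by (auto simp: lconst_def lookup_single when_def)

lemma lookup_lconst_mult: "Poly_Mapping.lookup (lconst c * p) a = c * Poly_Mapping.lookup p a"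
proof (cases "c = 0")
  case False
  then show ?thesis
    by (subst lookup_times_sum[of "{0}"]) (auto simp: lconst_def)
qed (simp add: lconst_def)

lemma mcoeff_smult_lconst: "mcoeff (smult (lconst c) P) j a = c * mcoeff P j a"
  by (simp add: lookup_lconst_mult)

lemma mcoeff_cpoly: "mcoeff (cpoly p) j a = (if a = 0 then coeff p j else 0)"
  by (simp add: coeff_map_poly lookup_lconst)

lemma cpoly_range_iff: "P \<in> range cpoly \<longleftrightarrow> (\<forall>j a. a \<noteq> 0 \<longrightarrow> mcoeff P j a = 0)"
proof
  assume *: "\<forall>j a. a \<noteq> 0 \<longrightarrow> mcoeff P j a = 0"
  define p where "p = Poly (map (\<lambda>j. mcoeff P j 0) [0..<Suc (degree P)])"
  have "coeff p j = mcoeff P j 0" for j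
    by (auto simp: p_def nth_default_def coeff_eq_0 simp del: upt_Suc)
  then have "P = cpoly p" using * by (intro poly_eqI_mcoeff) (auto simp: mcoeff_cpoly lookup_lconst)
  then show "P \<in> range cpoly" by blast
qed (auto simp: mcoeff_cpoly lookup_lconst)

text \<open>A box of size 0 contains only the exponent 0.\<close>

lemma monic_factor_cpoly:
  fixes A B :: "'d::finite laurent poly"
  assumes "lead_coeff A = 1" "lead_coeff B = 1" "A * B \<in> range cpoly"
  shows "A \<in> range cpoly"
proof -
  have int_box0: "a \<in> int_box 0 \<longleftrightarrow> a = 0" for a :: "int ^ 'd"
    by (auto simp: int_box_def Finite_Cartesian_Product.vec_eq_iff)
  have "a \<in> int_box 0" if "(a, j) \<in> mons (A * B)" for a j
    using assms(3) that unfolding cpoly_range_iff int_box0 mons_def by auto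
  then have "x \<in> int_box 0" if "(x, k) \<in> mons A" for x k
    using monic_factor_in_box[OF assms(1,2) _ that] by blast
  then show ?thesis unfolding cpoly_range_iff by (auto simp: int_box0 mons_def)
qed

section \<open>Coefficientwise limits\<close>

text \<open>For finite \<open>K\<close> these polynomials form a finite-dimensional space, on which
  \<open>poly_tendsto\<close> is convergence in norm.\<close>

definition supp_in :: "(int ^ 'd::finite) set \<Rightarrow> nat \<Rightarrow> 'd laurent poly \<Rightarrow> bool" where
  "supp_in K N P \<longleftrightarrow> mons P \<subseteq> K \<times> {..N}"

definition poly_tendsto :: "(nat \<Rightarrow> 'd::finite laurent poly) \<Rightarrow> 'd laurent poly \<Rightarrow> bool" where
  "poly_tendsto F P \<longleftrightarrow> (\<forall>j a. (\<lambda>n. mcoeff (F n) j a) \<longlonglongrightarrow> mcoeff P j a)"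

lemma supp_in_keys: "supp_in K N P \<Longrightarrow> Poly_Mapping.keys (coeff P j) \<subseteq> K"
  by (auto simp: supp_in_def mons_def in_keys_iff)

lemma supp_in_degree: "supp_in K N P \<Longrightarrow> degree P \<le> N"
  by (rule degree_le) (force simp: supp_in_def mons_def intro!: poly_mapping_eqI)

lemma supp_inI: "degree P \<le> N \<Longrightarrow> (\<And>a j. (a, j) \<in> mons P \<Longrightarrow> a \<in> K) \<Longrightarrow> supp_in K N P"
  by (auto simp: supp_in_def mons_def) (metis le_degree lookup_zero order_trans)

lemma poly_tendsto_subseq: "poly_tendsto F P \<Longrightarrow> strict_mono s \<Longrightarrow> poly_tendsto (\<lambda>n. F (s n)) P"
  unfolding poly_tendsto_def using LIMSEQ_subseq_LIMSEQ[unfolded o_def] by blast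

lemma poly_tendsto_supp_in:
  assumes "poly_tendsto F P" "\<And>n. supp_in K N (F n)" shows "supp_in K N P"
proof -
  have "mcoeff P j a = 0" if "(a, j) \<notin> K \<times> {..N}" for j a
  proof -
    have "mcoeff (F n) j a = 0" for n using assms(2)[of n] that by (auto simp: supp_in_def mons_def)
    then have "(\<lambda>n. mcoeff (F n) j a) \<longlonglongrightarrow> 0" by simp
    then show ?thesis using assms(1) unfolding poly_tendsto_def using LIMSEQ_unique by blast
  qed
  then show ?thesis by (auto simp: supp_in_def mons_def)
qed

text \<open>The common finite support of the \<open>F n\<close> turns each coefficient of the
  product into a sum over an index set that does not vary with \<open>n\<close>.\<close>

lemma poly_tendsto_times:
  assumes F: "poly_tendsto F P" "\<And>n. supp_in K N (F n)" "finite K" and G: "poly_tendsto G Q"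
  shows "poly_tendsto (\<lambda>n. F n * G n) (P * Q)"
  unfolding poly_tendsto_def
proof (intro allI)
  fix j c
  have 1: "mcoeff (F n * G n) j c = (\<Sum>i\<le>j. \<Sum>a\<in>K. mcoeff (F n) i a * mcoeff (G n) (j - i) (c - a))" for n
    by (intro mcoeff_times F supp_in_keys[OF F(2)])
  have 2: "mcoeff (P * Q) j c = (\<Sum>i\<le>j. \<Sum>a\<in>K. mcoeff P i a * mcoeff Q (j - i) (c - a))"
    by (intro mcoeff_times F supp_in_keys[OF poly_tendsto_supp_in[OF F(1,2)]])
  show "(\<lambda>n. mcoeff (F n * G n) j c) \<longlonglongrightarrow> mcoeff (P * Q) j c"
    unfolding 1 2 using F(1) G unfolding poly_tendsto_def
    by (intro tendsto_sum tendsto_mult) auto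
qed

text \<open>Bolzano-Weierstrass, passing to a further subsequence for each coordinate.\<close>

lemma bounded_family_convergent_subseq:
  fixes f :: "nat \<Rightarrow> 'j \<Rightarrow> complex"
  assumes "finite J" "\<And>n j. j \<in> J \<Longrightarrow> norm (f n j) \<le> B"
  obtains s g where "strict_mono (s :: nat \<Rightarrow> nat)" "\<And>j. j \<in> J \<Longrightarrow> (\<lambda>n. f (s n) j) \<longlonglongrightarrow> g j"
proof -
  have "\<exists>s g. strict_mono (s :: nat \<Rightarrow> nat) \<and> (\<forall>j\<in>J. (\<lambda>n. f (s n) j) \<longlonglongrightarrow> g j)"
    using assms
  proof (induction J)
    case empty
    then show ?case by (auto intro!: exI[of _ id] strict_mono_id)
  next
    case (insert i J)
    then obtain s g where sg: "strict_mono (s :: nat \<Rightarrow> nat)" "\<forall>j\<in>J. (\<lambda>n. f (s n) j) \<longlonglongrightarrow> g j"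
      by auto
    have "bounded (range (\<lambda>n. f (s n) i))"
      using insert.prems by (auto simp: bounded_iff)
    then obtain l r where lr: "strict_mono (r :: nat \<Rightarrow> nat)" "((\<lambda>n. f (s n) i) \<circ> r) \<longlonglongrightarrow> l"
      using bounded_imp_convergent_subsequence by blast
    have "(\<lambda>n. f ((s \<circ> r) n) j) \<longlonglongrightarrow> (g(i := l)) j" if "j \<in> insert i J" for j
    proof (cases "j = i")
      case False
      then have "(\<lambda>n. f (s n) j) \<longlonglongrightarrow> g j" using that sg(2) by auto
      from LIMSEQ_subseq_LIMSEQ[OF this lr(1)] show ?thesis using False by (simp add: o_def)
    qed (use lr in \<open>simp add: o_def\<close>)
    then show ?case using strict_mono_o[OF sg(1) lr(1)] by blast
  qed
  then show thesis using that by blast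
qed

lemma supp_in_convergent_subseq:
  fixes F :: "nat \<Rightarrow> 'd::finite laurent poly"
  assumes "finite K" "\<And>n. supp_in K N (F n)" "\<And>n j a. norm (mcoeff (F n) j a) \<le> B"
  obtains s P where "strict_mono (s :: nat \<Rightarrow> nat)" "poly_tendsto (\<lambda>n. F (s n)) P" "supp_in K N P"
proof -
  have "finite (K \<times> {..N})" using assms(1) by simp
  then obtain s g where s: "strict_mono (s :: nat \<Rightarrow> nat)"
    and g: "\<And>m. m \<in> K \<times> {..N} \<Longrightarrow> (\<lambda>n. (\<lambda>n (a, j). mcoeff (F n) j a) (s n) m) \<longlonglongrightarrow> g m"
    using bounded_family_convergent_subseq[of "K \<times> {..N}" "\<lambda>n (a, j). mcoeff (F n) j a" B] assms(3)
    by (auto simp: case_prod_unfold)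
  define P where "P = (\<Sum>(a, j)\<in>K \<times> {..N}. monom (Poly_Mapping.single a (g (a, j))) j)"
  have P: "mcoeff P j a = (if (a, j) \<in> K \<times> {..N} then g (a, j) else 0)" for j a
  proof -
    have "mcoeff P j a = (\<Sum>m\<in>K \<times> {..N}. if m = (a, j) then g m else 0)"
      unfolding P_def coeff_sum lookup_sum
        by (intro sum.cong) (auto simp: lookup_single when_def split: if_splits)
    then show ?thesis using assms(1) by (simp add: sum.delta)
  qed
  have "poly_tendsto (\<lambda>n. F (s n)) P"
    unfolding poly_tendsto_def
  proof (intro allI)
    fix j a
    show "(\<lambda>n. mcoeff (F (s n)) j a) \<longlonglongrightarrow> mcoeff P j a"
    proof (cases "(a, j) \<in> K \<times> {..N}")
      case True
      then show ?thesis using g[OF True] P by simp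
    next
      case False
      then have "mcoeff (F n) j a = 0" for n using assms(2)[of n]
        by (auto simp: supp_in_def mons_def)
      then show ?thesis using False P by auto
    qed
  qed
  then show thesis using that s poly_tendsto_supp_in[OF _ assms(2)] by blast
qed

text \<open>The l1 norm of the coefficients, a norm on the polynomials satisfying
  \<open>supp_in K N\<close>.\<close>

definition pnorm :: "(int ^ 'd::finite) set \<Rightarrow> nat \<Rightarrow> 'd laurent poly \<Rightarrow> real" where
  "pnorm K N P = (\<Sum>(a, j)\<in>K \<times> {..N}. norm (mcoeff P j a))"

lemma mcoeff_le_pnorm:
  assumes "finite K" "supp_in K N P" shows "norm (mcoeff P j a) \<le> pnorm K N P"
proof (cases "(a, j) \<in> K \<times> {..N}")
  case True
  then show ?thesis
    using member_le_sum[OF True, of "\<lambda>(a, j). norm (mcoeff P j a)"] assms(1)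
      by (auto simp: pnorm_def)
next
  case False
  then have "mcoeff P j a = 0" using assms(2) by (auto simp: supp_in_def mons_def)
  then show ?thesis by (auto simp: pnorm_def intro!: sum_nonneg)
qed

lemma pnorm_tendsto:
  "poly_tendsto F P \<Longrightarrow> (\<lambda>n. pnorm K N (F n)) \<longlonglongrightarrow> pnorm K N P"
  unfolding pnorm_def poly_tendsto_def
  by (intro tendsto_sum) (auto intro!: tendsto_norm)

lemma pnorm_smult: "pnorm K N (smult (lconst c) P) = norm c * pnorm K N P"
  by (simp add: pnorm_def sum_distrib_left case_prod_unfold lookup_lconst_mult norm_mult)

lemma monic_pnorm_ge_1:
  assumes "finite K" "supp_in K N P" "lead_coeff P = 1" shows "1 \<le> pnorm K N P"
  using mcoeff_le_pnorm[OF assms(1,2), of "degree P" 0] assms(3) by simp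


lemma const_subseq:
  fixes f :: "nat \<Rightarrow> 'a"
  assumes "finite (range f)"
  obtains s c where "strict_mono (s :: nat \<Rightarrow> nat)" "\<And>n. f (s n) = c"
proof -
  obtain n0 where "infinite {n \<in> UNIV. f n = f n0}"
    using pigeonhole_infinite[of UNIV f] assms by auto
  then obtain s where "strict_mono (s :: nat \<Rightarrow> nat)" "\<And>n. s n \<in> {n \<in> UNIV. f n = f n0}"
    using infinite_enumerate by blast
  then show thesis using that[of s "f n0"] by auto
qed

text \<open>The coefficient of degree \<open>q\<close> in \<open>B n\<close> is 1, so after
  normalisation it is the reciprocal of the norm, and it tends to the coefficient \<beta> of
  \<open>Bh\<close>. As \<open>Bh\<close> keeps the degree \<open>q\<close>, \<beta> is nonzero;
  hence the norms converge to \<open>1 / \<beta>\<close> and the normalisation can be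
  undone.\<close>

lemma monic_limit_of_normalized:
  fixes A B :: "nat \<Rightarrow> 'd::finite laurent poly"
  assumes K: "finite K" "\<And>n. supp_in K N (B n)"
    and B: "\<And>n. lead_coeff (B n) = 1" "\<And>n. degree (B n) = q"
    and lim: "poly_tendsto (\<lambda>n. smult (lconst (1 / of_real (pnorm K N (B n)))) (B n)) Bh"
    and prod: "Ah * Bh = smult (lconst t) D'" "t \<noteq> 0" "lead_coeff D' = 1" "degree Bh = q"
  obtains C G where "poly_tendsto B C" "lead_coeff C = 1" "degree C = q" "lead_coeff G = 1" "C * G = D'"
proof -
  define b where "b = (\<lambda>n. complex_of_real (pnorm K N (B n)))"
  have bnz: "b n \<noteq> 0" for n
    using monic_pnorm_ge_1[OF K B(1), of n] by (auto simp: b_def)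
  have lim': "(\<lambda>n. mcoeff (B n) j a / b n) \<longlonglongrightarrow> mcoeff Bh j a" for j a
    using lim unfolding poly_tendsto_def mcoeff_smult_lconst b_def by simp
  define \<beta> where "\<beta> = mcoeff Bh q 0"
  have top: "coeff (B n) q = 1" for n using B[of n] by simp
  have "mcoeff Bh q a = 0" if "a \<noteq> 0" for a
    using lim'[of q a] that top by (simp add: lookup_one LIMSEQ_const_iff)
  then have Bq: "coeff Bh q = lconst \<beta>"
    by (intro poly_mapping_eqI) (auto simp: lookup_lconst \<beta>_def)
  have "D' \<noteq> 0" using prod(3) by auto
  then have "Bh \<noteq> 0" using prod(1,2) by auto
  then have \<beta>: "\<beta> \<noteq> 0" using Bq prod(4) by auto
  have "(\<lambda>n. 1 / b n) \<longlonglongrightarrow> \<beta>" using lim'[of q 0] top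
    by (simp add: \<beta>_def)
  then have b_lim: "b \<longlonglongrightarrow> 1 / \<beta>"
    using tendsto_divide[OF tendsto_const[of 1], of "\<lambda>n. 1 / b n" \<beta>] \<beta> by simp
  define C where "C = smult (lconst (1 / \<beta>)) Bh"
  \<comment> \<open>The scalars cancel the factor \<open>t\<close>, so that the product of
    \<open>C\<close> and \<open>G\<close> is exactly \<open>D'\<close>.\<close>
  define G where "G = smult (lconst (\<beta> / t)) Ah"
  have CG: "C * G = D'"
  proof -
    have "C * G = smult (lconst (1 / \<beta>) * lconst (\<beta> / t) * lconst t) D'"
      using prod(1) by (simp add: C_def G_def mult.commute mult.left_commute)
    also have "lconst (1 / \<beta>) * lconst (\<beta> / t) * lconst t = (1 :: 'd laurent)"
      unfolding lconst.hom_mult[symmetric] using \<beta> prod(2) by simp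
    finally show ?thesis by simp
  qed
  have "degree C = q"
  proof (rule antisym)
    show "degree C \<le> q" unfolding C_def using degree_smult_le prod(4) by metis
    show "q \<le> degree C"
      by (rule le_degree) (use \<beta> in \<open>simp add: C_def Bq lconst.hom_mult[symmetric]\<close>)
  qed
  moreover have lC: "lead_coeff C = 1"
    unfolding \<open>degree C = q\<close> using \<beta>
      by (simp add: C_def Bq lconst.hom_mult[symmetric])
  moreover have "lead_coeff G = 1"
    using laurent_poly_lead_coeff_mult[of C G] CG lC prod(3) by simp
  moreover have "poly_tendsto B C"
    unfolding poly_tendsto_def
  proof (intro allI)
    fix j a
    have "(\<lambda>n. b n * (mcoeff (B n) j a / b n)) \<longlonglongrightarrow> 1 / \<beta> * mcoeff Bh j a"
      by (intro tendsto_mult b_lim lim')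
    then show "(\<lambda>n. mcoeff (B n) j a) \<longlonglongrightarrow> mcoeff C j a"
      using bnz by (simp add: C_def lookup_lconst_mult)
  qed
  ultimately show thesis using that CG by blast
qed

text \<open>Normalised to unit norm, the two factors of \<open>D0 - v D'\<close> converge along a subsequence to a
  factorisation of a multiple of \<open>D'\<close>. Only one degree is lost in the limit, so one of the two
  factors keeps its degree and converges even without normalisation.\<close>
lemma monic_pencil_limit:
  fixes D0 D' :: "'d::finite laurent poly" and v :: "nat \<Rightarrow> complex"
  assumes D0: "lead_coeff D0 = 1" and D': "lead_coeff D' = 1" and deg: "degree D0 = Suc (degree D')"
    and v: "filterlim v at_infinity sequentially"
    and red: "\<And>n. \<not> irreducible (D0 - smult (lconst (v n)) D')"
  obtains K s q C B C0 G where "finite K" "strict_mono (s :: nat \<Rightarrow> nat)" "1 \<le> q" "q \<le> degree D'"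
    "\<And>n. C n * B n = D0 - smult (lconst (v (s n))) D'"
    "\<And>n. lead_coeff (C n) = 1" "\<And>n. degree (C n) = q" "\<And>n. supp_in K q (C n)"
    "\<And>n. lead_coeff (B n) = 1" "\<And>n. degree (B n) = Suc (degree D') - q" "\<And>n. supp_in K (Suc (degree D')) (B n)"
    "poly_tendsto C C0" "lead_coeff C0 = 1" "degree C0 = q" "lead_coeff G = 1" "C0 * G = D'"
proof -
  define m where "m = degree D'"
  define D where "D = (\<lambda>n. D0 - smult (lconst (v n)) D')"
  have degD: "degree (D n) = Suc m" for n
  proof (rule antisym)
    show "degree (D n) \<le> Suc m" unfolding D_def m_def
      by (intro degree_diff_le order_trans[OF degree_smult_le]) (use deg in auto)
    show "Suc m \<le> degree (D n)"
      by (rule le_degree) (use D0 deg in \<open>simp add: D_def m_def coeff_eq_0\<close>)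
  qed
  have monD: "lead_coeff (D n) = 1" for n
    using D0 deg unfolding degD by (simp add: D_def m_def coeff_eq_0)
  have "\<forall>n. \<exists>A B. D n = A * B \<and> lead_coeff A = 1 \<and> lead_coeff B = 1 \<and> 1 \<le> degree A \<and> 1 \<le> degree B"
  proof
    fix n
    have "\<not> irreducible (D n)" "1 \<le> degree (D n)" using red degD by (simp_all add: D_def)
    then show "\<exists>A B. D n = A * B \<and> lead_coeff A = 1 \<and> lead_coeff B = 1 \<and> 1 \<le> degree A \<and> 1 \<le> degree B"
      using not_irreducible_monic_factors[OF monD] by metis
  qed
  then obtain A B where AB: "\<And>n. D n = A n * B n" "\<And>n. lead_coeff (A n) = 1" "\<And>n. lead_coeff (B n) = 1"
    "\<And>n. 1 \<le> degree (A n)" "\<And>n. 1 \<le> degree (B n)" by metis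
  have degAB: "degree (A n) + degree (B n) = Suc m" for n
  proof -
    have "A n \<noteq> 0" "B n \<noteq> 0" using AB(2,3)[of n] by auto
    from laurent_poly_degree_mult[OF this] show ?thesis using AB(1)[of n] degD[of n] by simp
  qed
  \<comment> \<open>The box is drawn around the supports of \<open>D0\<close> and \<open>D'\<close>,
    so it contains the support of every \<open>D n\<close> and of all monic factors of
    these.\<close>
  obtain s0 where s0: "fst ` (mons D0 \<union> mons D') \<subseteq> int_box s0"
    using finite_subset_box[of "fst ` (mons D0 \<union> mons D')"] finite_mons by blast
  define K where "K = (int_box s0 :: (int ^ 'd) set)"
  have K: "finite K" by (simp add: K_def finite_box)
  have Dbox: "a \<in> int_box s0" if "(a, j) \<in> mons (D n)" for a j n
  proof -
    have "(a, j) \<in> mons D0 \<union> mons D'"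
      using that by (auto simp: D_def mons_def lookup_minus lookup_lconst_mult)
    then show ?thesis using s0 by force
  qed
  have suppA: "supp_in K N (A n)" if "degree (A n) \<le> N" for n N
    using monic_factor_in_box[OF AB(2,3), of n n] Dbox that unfolding AB(1)[symmetric] K_def
    by (intro supp_inI) auto
  have suppB: "supp_in K N (B n)" if "degree (B n) \<le> N" for n N
    using monic_factor_in_box[OF AB(3,2), of n n] Dbox that
    unfolding AB(1)[symmetric] mult.commute[of "B n"] K_def
    by (intro supp_inI) auto
  have suppA': "supp_in K (Suc m) (A n)" and suppB': "supp_in K (Suc m) (B n)" for n
    using suppA[of n "Suc m"] suppB[of n "Suc m"] degAB[of n] by auto
  define nm where "nm = (\<lambda>P :: 'd laurent poly. smult (lconst (1 / of_real (pnorm K (Suc m) P))) P)"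
  have nm_supp: "supp_in K (Suc m) (nm P)" if "supp_in K (Suc m) P" for P
    using that by (force simp: supp_in_def mons_def nm_def lookup_lconst_mult)
  have nm1: "pnorm K (Suc m) (nm P) = 1" if "supp_in K (Suc m) P" "lead_coeff P = 1" for P
    using monic_pnorm_ge_1[OF K that] by (simp add: nm_def pnorm_smult norm_divide)
  have nm_bd: "norm (mcoeff (nm P) j a) \<le> 1" if "supp_in K (Suc m) P" "lead_coeff P = 1" for P j a
    using mcoeff_le_pnorm[OF K nm_supp[OF that(1)]] nm1[OF that] by simp
  have "degree (A n) \<le> Suc m" for n using degAB[of n] by linarith
  then have "finite (range (\<lambda>n. degree (A n)))"
    by (auto intro: finite_subset[of _ "{..Suc m}"])
  then obtain s1 r where s1: "strict_mono (s1 :: nat \<Rightarrow> nat)" "\<And>n. degree (A (s1 n)) = r"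
    using const_subseq by metis
  obtain s2 Ah where s2: "strict_mono (s2 :: nat \<Rightarrow> nat)" "poly_tendsto (\<lambda>n. nm (A (s1 (s2 n)))) Ah"
    by (rule supp_in_convergent_subseq[OF K nm_supp[OF suppA'] nm_bd[OF suppA' AB(2)], of "\<lambda>n. s1 n"])
  obtain s3 Bh where s3: "strict_mono (s3 :: nat \<Rightarrow> nat)" "poly_tendsto (\<lambda>n. nm (B (s1 (s2 (s3 n))))) Bh"
    by (rule supp_in_convergent_subseq[OF K nm_supp[OF suppB'] nm_bd[OF suppB' AB(3)], of "\<lambda>n. s1 (s2 n)"])
  define s where "s = s1 \<circ> s2 \<circ> s3"
  have s: "strict_mono s" unfolding s_def using s1(1) s2(1) s3(1) by (intro strict_mono_o)
  have Alim: "poly_tendsto (\<lambda>n. nm (A (s n))) Ah" and Blim: "poly_tendsto (\<lambda>n. nm (B (s n))) Bh"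
    using poly_tendsto_subseq[OF s2(2) s3(1)] s3(2) by (simp_all add: s_def)
  have degA: "degree (A (s n)) = r" and degB: "degree (B (s n)) = Suc m - r" for n
    using s1(2) degAB[of "s n"] by (simp_all add: s_def)
  have r: "1 \<le> r" "r \<le> m" using AB(4,5)[of "s 0"] degAB[of "s 0"] degA[of 0] by auto
  have limne: "P \<noteq> 0" if "poly_tendsto (\<lambda>n. nm (F n)) P" "\<And>n. supp_in K (Suc m) (F n)" "\<And>n. lead_coeff (F n) = 1" for F P
  proof
    assume "P = 0"
    then have "pnorm K (Suc m) P = 0" by (simp add: pnorm_def)
    moreover have "(\<lambda>n. pnorm K (Suc m) (nm (F n))) \<longlonglongrightarrow> pnorm K (Suc m) P" by (rule pnorm_tendsto[OF that(1)])
    ultimately show False using nm1[OF that(2,3)] by (simp add: LIMSEQ_const_iff)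
  qed
  have Ahne: "Ah \<noteq> 0" and Bhne: "Bh \<noteq> 0"
    using limne[OF Alim suppA' AB(2)] limne[OF Blim suppB' AB(3)] by auto
  define c where "c = (\<lambda>n. 1 / of_real (pnorm K (Suc m) (A (s n))) * (1 / of_real (pnorm K (Suc m) (B (s n)))) :: complex)"
  have ABlim: "poly_tendsto (\<lambda>n. smult (lconst (c n)) (D (s n))) (Ah * Bh)"
    using poly_tendsto_times[OF Alim nm_supp[OF suppA'] K Blim]
    by (simp add: AB(1) nm_def c_def lconst.hom_mult[symmetric] mult.commute del: lconst.hom_mult)
  have vs: "filterlim (\<lambda>n. v (s n)) at_infinity sequentially"
    using filterlim_compose[OF v filterlim_subseq[OF s]] .
  have v0: "(\<lambda>n. x / v (s n)) \<longlonglongrightarrow> 0" for x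
    by (rule tendsto_divide_0[OF tendsto_const vs])
  have vne: "\<forall>\<^sub>F n in sequentially. v (s n) \<noteq> 0"
    using vs by (auto simp: filterlim_at_infinity[OF order_refl] elim!: allE[of _ 1] eventually_mono)
  define p0 where "p0 = mcoeff (Ah * Bh) m 0"
  have ABc: "(\<lambda>n. c n * (mcoeff D0 j a - v (s n) * mcoeff D' j a)) \<longlonglongrightarrow> mcoeff (Ah * Bh) j a" for j a
    using ABlim unfolding poly_tendsto_def mcoeff_smult_lconst
    by (simp add: D_def lookup_minus lookup_lconst_mult)
  have D'm: "mcoeff D' m 0 = 1" using D' by (simp add: m_def)
  \<comment> \<open>Read off at the top coefficient of \<open>D'\<close>, which is 1: the
    normalising scalar \<open>c n\<close> compensates the growth of \<open>v\<close>.\<close>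
  have t: "(\<lambda>n. c n * v (s n)) \<longlonglongrightarrow> - p0"
  proof -
    let ?x = "mcoeff D0 m 0"
    have den: "(\<lambda>n. ?x / v (s n) - 1) \<longlonglongrightarrow> 0 - 1"
      by (intro tendsto_diff v0 tendsto_const)
    have "\<forall>\<^sub>F n in sequentially. ?x / v (s n) - 1 \<noteq> 0"
      using tendsto_imp_eventually_ne[OF den, of 0] by simp
    then have "\<forall>\<^sub>F n in sequentially. c n * (?x - v (s n) * mcoeff D' m 0) / (?x / v (s n) - 1) = c n * v (s n)"
      using vne by eventually_elim (auto simp: D'm field_simps)
    moreover have "(\<lambda>n. c n * (?x - v (s n) * mcoeff D' m 0) / (?x / v (s n) - 1)) \<longlonglongrightarrow> p0 / (0 - 1)"
      unfolding p0_def by (intro tendsto_divide ABc den) auto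
    ultimately have "(\<lambda>n. c n * v (s n)) \<longlonglongrightarrow> p0 / (0 - 1)"
      by (rule Lim_transform_eventually[rotated])
    then show ?thesis by simp
  qed
  \<comment> \<open>Divided by \<open>v\<close>, the contribution of \<open>D0\<close> disappears in
    the limit.\<close>
  have prod: "Ah * Bh = smult (lconst p0) D'"
  proof (rule poly_eqI_mcoeff)
    fix j a
    have "(\<lambda>n. c n * v (s n) * (mcoeff D0 j a / v (s n) - mcoeff D' j a)) \<longlonglongrightarrow> - p0 * (0 - mcoeff D' j a)"
      by (intro tendsto_mult t tendsto_diff v0 tendsto_const)
    moreover have "\<forall>\<^sub>F n in sequentially. c n * v (s n) * (mcoeff D0 j a / v (s n) - mcoeff D' j a)
        = c n * (mcoeff D0 j a - v (s n) * mcoeff D' j a)"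
      using vne by eventually_elim (auto simp: field_simps)
    ultimately have "(\<lambda>n. c n * (mcoeff D0 j a - v (s n) * mcoeff D' j a)) \<longlonglongrightarrow> - p0 * (0 - mcoeff D' j a)"
      by (rule Lim_transform_eventually)
    from LIMSEQ_unique[OF ABc this] show "mcoeff (Ah * Bh) j a = mcoeff (smult (lconst p0) D') j a"
      by (simp add: lookup_lconst_mult)
  qed
  have p0: "p0 \<noteq> 0" using prod Ahne Bhne by auto
  have D'ne: "D' \<noteq> 0" using D' by auto
  have lcAB: "coeff (A (s n)) r = 1" "coeff (B (s n)) (Suc m - r) = 1" for n
    using AB(2,3)[of "s n"] degA[of n] degB[of n] by simp_all
  have "degree Ah + degree Bh = m"
    using laurent_poly_degree_mult[OF Ahne Bhne] p0 laurent_poly_degree_mult[of "[:lconst p0:]" D'] D'ne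
    by (simp add: prod m_def)
  moreover have "degree Ah \<le> r" "degree Bh \<le> Suc m - r"
  proof -
    have "supp_in K r (nm (A (s n)))" "supp_in K (Suc m - r) (nm (B (s n)))" for n
      using suppA[of "s n" r] suppB[of "s n" "Suc m - r"] degA degB
      by (force simp: supp_in_def mons_def nm_def lookup_lconst_mult)+
    then show "degree Ah \<le> r" "degree Bh \<le> Suc m - r"
      using poly_tendsto_supp_in[OF Alim] poly_tendsto_supp_in[OF Blim] supp_in_degree by blast+
  qed
  \<comment> \<open>The degrees add up to \<open>m\<close> while their bounds add up to
    \<open>m + 1\<close>, so one bound is attained.\<close>
  ultimately consider "degree Ah = r" | "degree Bh = Suc m - r" using r by linarith
  then show thesis
  proof cases
    case 1
    obtain C0 G where "poly_tendsto (\<lambda>n. A (s n)) C0" "lead_coeff C0 = 1" "degree C0 = r" "lead_coeff G = 1" "C0 * G = D'"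
      using monic_limit_of_normalized[OF K suppA' AB(2) degA Alim[unfolded nm_def], of Bh p0 D'] prod p0 D' 1
      by (metis mult.commute)
    then show thesis
      using that[of K s r "\<lambda>n. A (s n)" "\<lambda>n. B (s n)" C0 G] K s r AB lcAB degA degB suppA suppB' degAB
      by (simp add: m_def D_def)
  next
    case 2
    obtain C0 G where "poly_tendsto (\<lambda>n. B (s n)) C0" "lead_coeff C0 = 1" "degree C0 = Suc m - r" "lead_coeff G = 1" "C0 * G = D'"
      using monic_limit_of_normalized[OF K suppB' AB(3) degB Blim[unfolded nm_def], of Ah p0 D'] prod p0 D' 2
      by metis
    then show thesis
      using that[of K s "Suc m - r" "\<lambda>n. B (s n)" "\<lambda>n. A (s n)" C0 G] K s r AB lcAB degA degB suppB suppA' degAB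
      by (simp add: m_def D_def mult.commute)
  qed
qed

interpretation cpoly: map_poly_inj_comm_ring_hom lconst ..

subsection \<open>Characters\<close>

text \<open>A point of the torus is encoded as a character \<theta> of the exponent group, which
  gives the value of each monomial there.\<close>

definition char_eval :: "('g \<Rightarrow> complex) \<Rightarrow> ('g \<Rightarrow>\<^sub>0 complex) \<Rightarrow> complex" where
  "char_eval \<theta> p = (\<Sum>a\<in>Poly_Mapping.keys p. Poly_Mapping.lookup p a * \<theta> a)"

lemma char_eval_superset:
  "finite K \<Longrightarrow> Poly_Mapping.keys p \<subseteq> K \<Longrightarrow> char_eval \<theta> p = (\<Sum>a\<in>K. Poly_Mapping.lookup p a * \<theta> a)"
  unfolding char_eval_def by (rule sum.mono_neutral_left) (auto simp: in_keys_iff)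

lemma char_eval_add: "char_eval \<theta> (p + q) = char_eval \<theta> p + char_eval \<theta> q"
proof -
  let ?K = "Poly_Mapping.keys p \<union> Poly_Mapping.keys q"
  have "Poly_Mapping.keys (p + q) \<subseteq> ?K" by (rule keys_add)
  then show ?thesis
    by (simp add: char_eval_superset[of ?K] lookup_add algebra_simps sum.distrib)
qed

lemma char_eval_mult:
  fixes p q :: "'g::ab_group_add \<Rightarrow>\<^sub>0 complex"
  assumes "\<And>a b. \<theta> (a + b) = \<theta> a * \<theta> b"
  shows "char_eval \<theta> (p * q) = char_eval \<theta> p * char_eval \<theta> q"
proof -
  let ?K = "Poly_Mapping.keys p" and ?L = "Poly_Mapping.keys q"
  define M where "M = (\<lambda>(a, b). a + b) ` (?K \<times> ?L)"
  have M: "finite M" by (simp add: M_def)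
  have "Poly_Mapping.keys (p * q) \<subseteq> M" using keys_mult[of p q] by (auto simp: M_def)
  then have "char_eval \<theta> (p * q) = (\<Sum>c\<in>M. Poly_Mapping.lookup (p * q) c * \<theta> c)"
    by (rule char_eval_superset[OF M])
  also have "\<dots> = (\<Sum>c\<in>M. \<Sum>a\<in>?K. Poly_Mapping.lookup p a * Poly_Mapping.lookup q (c - a) * \<theta> c)"
    by (simp add: lookup_times_sum[of ?K p] sum_distrib_right)
  also have "\<dots> = (\<Sum>a\<in>?K. \<Sum>c\<in>M. Poly_Mapping.lookup p a * Poly_Mapping.lookup q (c - a) * \<theta> c)"
    by (rule sum.swap)
  also have "\<dots> = (\<Sum>a\<in>?K. Poly_Mapping.lookup p a * \<theta> a * char_eval \<theta> q)"
  proof (rule sum.cong[OF refl])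
    fix a assume a: "a \<in> ?K"
    have "char_eval \<theta> q = (\<Sum>b\<in>(\<lambda>c. c - a) ` M. Poly_Mapping.lookup q b * \<theta> b)"
      using M a by (intro char_eval_superset) (force simp: M_def image_iff)+
    also have "\<dots> = (\<Sum>c\<in>M. Poly_Mapping.lookup q (c - a) * \<theta> (c - a))"
      by (subst sum.reindex) (auto simp: inj_on_def)
    finally have "Poly_Mapping.lookup p a * \<theta> a * char_eval \<theta> q
        = (\<Sum>c\<in>M. Poly_Mapping.lookup p a * Poly_Mapping.lookup q (c - a) * (\<theta> a * \<theta> (c - a)))"
      by (simp add: sum_distrib_left mult_ac)
    also have "\<dots> = (\<Sum>c\<in>M. Poly_Mapping.lookup p a * Poly_Mapping.lookup q (c - a) * \<theta> c)"
      unfolding assms[symmetric] by simp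
    finally show "(\<Sum>c\<in>M. Poly_Mapping.lookup p a * Poly_Mapping.lookup q (c - a) * \<theta> c)
        = Poly_Mapping.lookup p a * \<theta> a * char_eval \<theta> q" by simp
  qed
  finally show ?thesis by (simp add: char_eval_def sum_distrib_right)
qed

lemma char_eval_hom:
  fixes \<theta> :: "'g::ab_group_add \<Rightarrow> complex"
  assumes "\<theta> 0 = 1" "\<And>a b. \<theta> (a + b) = \<theta> a * \<theta> b"
  shows "comm_ring_hom (char_eval \<theta>)"
proof unfold_locales
  show "char_eval \<theta> 1 = 1" using assms(1) by (simp add: char_eval_def)
  show "char_eval \<theta> 0 = 0" by (simp add: char_eval_def)
qed (simp_all add: char_eval_add char_eval_mult assms)

lemma char_eval_lconst: "\<theta> 0 = 1 \<Longrightarrow> char_eval \<theta> (lconst c) = c"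
  by (subst char_eval_superset[of "{0}"]) (auto simp: lconst_def)

text \<open>The point with parameter \<open>x\<close> on the one-parameter subgroup of the torus
  defined by \<phi>; along this curve a Laurent polynomial has a single variable.\<close>

definition powi_char :: "('g \<Rightarrow> int) \<Rightarrow> complex \<Rightarrow> 'g \<Rightarrow> complex" where
  "powi_char \<phi> x a = x powi \<phi> a"

lemma powi_char:
  assumes "additive \<phi>" "x \<noteq> 0"
  shows "powi_char \<phi> x 0 = 1" "powi_char \<phi> x (a + b) = powi_char \<phi> x a * powi_char \<phi> x b"
  using assms by (simp_all add: powi_char_def additive.zero additive.add power_int_add)

text \<open>As \<phi> is injective on the support, no monomials merge along the curve. Dividing by
  the lowest power \<open>x powi m\<close> leaves an ordinary polynomial with nonzero constant term,
  which is constant only if there is a single monomial.\<close>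

lemma powi_char_eval_poly:
  fixes p :: "'g \<Rightarrow>\<^sub>0 complex"
  assumes "inj_on \<phi> (Poly_Mapping.keys p)" "p \<noteq> 0"
  shows "\<exists>q m. (\<forall>x. x \<noteq> 0 \<longrightarrow> char_eval (powi_char \<phi> x) p = x powi m * poly q x) \<and>
    poly q 0 \<noteq> 0 \<and> (degree q = 0 \<longrightarrow> (\<exists>a c. p = Poly_Mapping.single a c))"
proof -
  let ?K = "Poly_Mapping.keys p"
  define m where "m = Min (\<phi> ` ?K)"
  have K: "finite ?K" "?K \<noteq> {}" using assms(2) by simp_all
  then have m_le: "m \<le> \<phi> a" if "a \<in> ?K" for a using that by (simp add: m_def)
  have "m \<in> \<phi> ` ?K" unfolding m_def by (rule Min_in) (use K in auto)
  then obtain a0 where a0: "a0 \<in> ?K" "\<phi> a0 = m" by auto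
  define q where "q = (\<Sum>a\<in>?K. monom (Poly_Mapping.lookup p a) (nat (\<phi> a - m)))"
  have coeff_q: "coeff q (nat (\<phi> a - m)) = Poly_Mapping.lookup p a" if "a \<in> ?K" for a
  proof -
    have "coeff q (nat (\<phi> a - m)) = (\<Sum>b\<in>?K. if b = a then Poly_Mapping.lookup p b else 0)"
      unfolding q_def coeff_sum coeff_monom
    proof (intro sum.cong refl)
      fix b assume "b \<in> ?K"
      then have "nat (\<phi> b - m) = nat (\<phi> a - m) \<longleftrightarrow> b = a"
        using m_le[of a] m_le[of b] that assms(1) by (auto simp: nat_eq_iff2 dest: inj_onD)
      then show "(if nat (\<phi> b - m) = nat (\<phi> a - m) then Poly_Mapping.lookup p b else 0)
          = (if b = a then Poly_Mapping.lookup p b else 0)" by simp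
    qed
    then show ?thesis using that K by simp
  qed
  show ?thesis
  proof (rule exI[of _ q], rule exI[of _ m], intro conjI allI impI)
    fix x :: complex assume x: "x \<noteq> 0"
    have "x powi m * poly q x = (\<Sum>a\<in>?K. Poly_Mapping.lookup p a * (x powi m * x ^ nat (\<phi> a - m)))"
      by (simp add: q_def poly_sum poly_monom sum_distrib_left mult_ac)
    also have "\<dots> = (\<Sum>a\<in>?K. Poly_Mapping.lookup p a * x powi \<phi> a)"
    proof (intro sum.cong refl arg_cong2[of _ _ _ _ "(*)"])
      fix a assume "a \<in> ?K"
      then show "x powi m * x ^ nat (\<phi> a - m) = x powi \<phi> a"
        using m_le[of a] power_int_add[of x m "\<phi> a - m"] x by (simp add: power_int_def)
    qed
    finally show "char_eval (powi_char \<phi> x) p = x powi m * poly q x"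
      by (simp add: char_eval_def powi_char_def)
  next
    show "poly q 0 \<noteq> 0" using coeff_q[OF a0(1)] a0 by (simp add: poly_0_coeff_0 in_keys_iff)
  next
    assume "degree q = 0"
    have "\<phi> a = m" if "a \<in> ?K" for a
    proof (rule ccontr)
      assume "\<phi> a \<noteq> m"
      then have "nat (\<phi> a - m) > degree q" using m_le[OF that] \<open>degree q = 0\<close>
        by simp
      then show False using coeff_q[OF that] that by (simp add: coeff_eq_0 in_keys_iff)
    qed
    then have "?K = {a0}" using assms(1) a0 by (auto dest: inj_onD)
    then have "p = Poly_Mapping.single a0 (Poly_Mapping.lookup p a0)"
      by (intro poly_mapping_eqI) (metis in_keys_iff lookup_single_eq lookup_single_not_eq singletonD)
    then show "\<exists>a c. p = Poly_Mapping.single a c" by blast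
  qed
qed

lemma finite_powi_char_zeros:
  fixes p :: "'g \<Rightarrow>\<^sub>0 complex"
  assumes "inj_on \<phi> (Poly_Mapping.keys p)" "p \<noteq> 0"
  shows "finite {x. x \<noteq> 0 \<and> char_eval (powi_char \<phi> x) p = 0}"
proof -
  obtain q and m :: int where *: "\<forall>x. x \<noteq> 0 \<longrightarrow> char_eval (powi_char \<phi> x) p = x powi m * poly q x" "poly q 0 \<noteq> 0"
    using powi_char_eval_poly[OF assms] by (elim exE conjE)
  note q = *(1)[rule_format] *(2)
  have "{x. x \<noteq> 0 \<and> char_eval (powi_char \<phi> x) p = 0} \<subseteq> {x. poly q x = 0}"
    using q(1) by (auto simp: power_int_eq_0_iff)
  moreover have "q \<noteq> 0" using q(2) by auto
  ultimately show ?thesis using poly_roots_finite finite_subset by blast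
qed

text \<open>A nonconstant \<open>q\<close> has a complex root, and this root is nonzero since
  \<open>poly q 0\<close> is.\<close>

lemma no_powi_char_zeros_imp_single:
  fixes p :: "'g \<Rightarrow>\<^sub>0 complex"
  assumes "inj_on \<phi> (Poly_Mapping.keys p)" "p \<noteq> 0"
    and nz: "\<And>x. x \<noteq> 0 \<Longrightarrow> char_eval (powi_char \<phi> x) p \<noteq> 0"
  shows "\<exists>a c. p = Poly_Mapping.single a c"
proof -
  obtain q and m :: int where *: "\<forall>x. x \<noteq> 0 \<longrightarrow> char_eval (powi_char \<phi> x) p = x powi m * poly q x" "poly q 0 \<noteq> 0"
    "degree q = 0 \<longrightarrow> (\<exists>a c. p = Poly_Mapping.single a c)"
    using powi_char_eval_poly[OF assms(1,2)] by (elim exE conjE)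
  note q = *(1)[rule_format] *(2) *(3)[rule_format]
  have "degree q = 0"
  proof (rule ccontr)
    assume "degree q \<noteq> 0"
    then obtain x where "poly q x = 0"
      using fundamental_theorem_of_algebra[of q] by (auto simp: constant_degree)
    moreover from this have "x \<noteq> 0" using q(2) by auto
    ultimately show False using q(1) nz by auto
  qed
  then show ?thesis by (rule q(3))
qed

text \<open>Division with remainder up to a scalar: a nonzero element of least degree in the ideal
  generated by \<open>P\<close> and \<open>Q\<close> divides both.\<close>
lemma laurent_poly_scaled_bezout:
  fixes P Q :: "'d::finite laurent poly"
  assumes "P \<noteq> 0"
  obtains g P1 Q1 s t \<alpha> where "\<alpha> \<noteq> 0" "smult \<alpha> P = g * P1" "smult \<alpha> Q = g * Q1" "s * P1 + t * Q1 = [:\<alpha>:]"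
proof -
  define I where "I = {g. g \<noteq> 0 \<and> (\<exists>s t. g = s * P + t * Q)}"
  have "P = 1 * P + 0 * Q" by simp
  then have "P \<in> I" using assms unfolding I_def by blast
  then obtain g where g: "g \<in> I" "\<And>h. h \<in> I \<Longrightarrow> degree g \<le> degree h"
    using ex_has_least_nat[of "\<lambda>g. g \<in> I" P degree] by blast
  obtain s t where st: "g = s * P + t * Q" and gne: "g \<noteq> 0" using g(1) by (auto simp: I_def)
  have div: "\<exists>\<beta> F1. \<beta> \<noteq> 0 \<and> smult \<beta> F = g * F1" if "\<exists>s t. F = s * P + t * Q" for F
  proof -
    obtain q r where qr: "pseudo_divmod F g = (q, r)" by fastforce
    \<comment> \<open>The power of the leading coefficient by which pseudo-division multiplies the
      dividend.\<close>
    define \<beta> where "\<beta> = lead_coeff g ^ (Suc (degree F) - degree g)"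
    have \<beta>: "\<beta> \<noteq> 0"
    proof -
      have "lead_coeff g ^ k \<noteq> 0" for k
        by (induction k) (use gne in auto)
      then show ?thesis by (simp add: \<beta>_def)
    qed
    have eq: "smult \<beta> F = g * q + r" and r: "r = 0 \<or> degree r < degree g"
      using pseudo_divmod[OF gne qr] by (auto simp: \<beta>_def)
    have "r = 0"
    proof (rule ccontr)
      assume "r \<noteq> 0"
      obtain s' t' where F: "F = s' * P + t' * Q"
        using \<open>\<exists>s t. F = s * P + t * Q\<close> by blast
      have "r = smult \<beta> F - g * q" using eq by simp
      also have "\<dots> = ([:\<beta>:] * s' - s * q) * P + ([:\<beta>:] * t' - t * q) * Q"
        unfolding F st by (simp add: algebra_simps smult_add_right)
      finally have "r \<in> I" using \<open>r \<noteq> 0\<close> unfolding I_def by blast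
      then show False using g(2) r \<open>r \<noteq> 0\<close> by fastforce
    qed
    then show ?thesis using \<beta> eq by auto
  qed
  have "P = 1 * P + 0 * Q" "Q = 0 * P + 1 * Q" by simp_all
  then obtain \<beta> P1 \<gamma> Q1 where "\<beta> \<noteq> 0" "smult \<beta> P = g * P1" "\<gamma> \<noteq> 0" "smult \<gamma> Q = g * Q1"
    using div[of P] div[of Q] by blast
  define \<alpha> where "\<alpha> = \<beta> * \<gamma>"
  have "smult \<alpha> P = smult \<gamma> (smult \<beta> P)" "smult \<alpha> Q = smult \<beta> (smult \<gamma> Q)"
    by (simp_all add: \<alpha>_def mult.commute)
  then have 1: "smult \<alpha> P = g * smult \<gamma> P1" "smult \<alpha> Q = g * smult \<beta> Q1" "\<alpha> \<noteq> 0"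
    using \<open>smult \<beta> P = g * P1\<close> \<open>smult \<gamma> Q = g * Q1\<close> \<open>\<beta> \<noteq> 0\<close> \<open>\<gamma> \<noteq> 0\<close>
    by (simp_all add: \<alpha>_def)
  \<comment> \<open>Cancelling \<open>g\<close> turns its representation by \<open>P\<close> and
    \<open>Q\<close> into a Bezout identity whose right-hand side is free of the spectral
    parameter.\<close>
  have "g * (s * smult \<gamma> P1 + t * smult \<beta> Q1) = s * (g * smult \<gamma> P1) + t * (g * smult \<beta> Q1)"
    by (simp add: algebra_simps smult_add_right)
  also have "\<dots> = s * smult \<alpha> P + t * smult \<alpha> Q" using 1 by simp
  also have "\<dots> = smult \<alpha> g" unfolding st by (simp add: smult_add_right)
  finally have "g * (s * smult \<gamma> P1 + t * smult \<beta> Q1) = g * [:\<alpha>:]" by simp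
  then have "s * smult \<gamma> P1 + t * smult \<beta> Q1 = [:\<alpha>:]"
    using gne laurent_poly_mult_left_cancel by blast
  then show thesis using that 1 by blast
qed

text \<open>The coefficient of the monomial with exponent \<open>a\<close> when \<open>P\<close> is
  read as a Laurent polynomial over the complex polynomials in the spectral parameter.\<close>

definition slice :: "('g \<Rightarrow>\<^sub>0 complex) poly \<Rightarrow> 'g \<Rightarrow> complex poly" where
  "slice P a = map_poly (\<lambda>r. Poly_Mapping.lookup r a) P"

lemma coeff_slice: "coeff (slice P a) j = mcoeff P j a"
  by (simp add: slice_def coeff_map_poly)

lemma lookup_poly_lconst:
  fixes P :: "'d::finite laurent poly"
  shows "Poly_Mapping.lookup (poly P (lconst y)) a = poly (slice P a) y"
proof -
  have "Poly_Mapping.lookup (poly P (lconst y)) a = (\<Sum>j\<le>degree P. mcoeff P j a * y ^ j)"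
    unfolding poly_altdef lookup_sum lconst.hom_power[symmetric] mult.commute[of _ "lconst _"] lookup_lconst_mult
    by (simp add: mult.commute)
  also have "\<dots> = (\<Sum>j\<le>degree (slice P a). coeff (slice P a) j * y ^ j)"
    unfolding coeff_slice[symmetric]
    by (rule sum.mono_neutral_right) (auto simp: slice_def map_poly_degree_leq coeff_eq_0)
  finally show ?thesis by (simp add: poly_altdef)
qed

lemma mcoeff_cpoly_mult:
  fixes P :: "'d::finite laurent poly"
  shows "mcoeff (cpoly p * P) j a = coeff (p * slice P a) j"
  by (simp add: coeff_mult lookup_sum coeff_slice coeff_map_poly lookup_lconst_mult)


lemma cpoly_not_irreducible:
  fixes p :: "complex poly"
  assumes "2 \<le> degree p"
  shows "\<not> irreducible (cpoly p :: 'd::finite laurent poly)" "reducible (cpoly p :: 'd::finite laurent poly)"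
proof -
  obtain x where "poly p x = 0"
    using fundamental_theorem_of_algebra[of p] assms by (auto simp: constant_degree)
  then obtain r where r: "p = [:- x, 1:] * r" by (auto simp: poly_eq_0_iff_dvd elim: dvdE)
  then have "r \<noteq> 0" using assms by auto
  then have "degree p = 1 + degree r" unfolding r by (subst degree_mult_eq) auto
  then have "1 \<le> degree (cpoly [:- x, 1:] :: 'd laurent poly)" "1 \<le> degree (cpoly r :: 'd laurent poly)"
    using assms by simp_all
  from monic_mult_not_irreducible[OF this]
  show "\<not> irreducible (cpoly p :: 'd laurent poly)" "reducible (cpoly p :: 'd laurent poly)"
    unfolding r cpoly.hom_mult by simp_all
qed

text \<open>The limit makes one factor linear, \<open>x - X i\<close> with \<open>X i = v i + \<eta> i\<close> and \<open>\<eta> i \<rightarrow> 0\<close>. Two such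
  sections \<open>X i\<close>, \<open>X k\<close> can only agree at a base point of the pencil, i.e. at a zero of the fixed \<open>\<alpha>\<close>
  below, and not even there once \<open>v k\<close> is large. So \<open>X i - X k\<close> has no zeros on the torus and is
  a constant.\<close>
theorem irreducible_pencil:
  fixes D' Q :: "'d::finite laurent poly" and v :: "nat \<Rightarrow> complex"
  assumes irr: "irreducible D'" and D': "lead_coeff D' = 1"
    and Q: "Q \<noteq> 0" "degree Q < degree D'"
    and v: "filterlim v at_infinity sequentially"
    and red: "\<And>i. \<not> irreducible (pCons 0 D' - Q - smult (lconst (v i)) D')"
  shows "degree D' = 1 \<and> D' \<in> range cpoly \<and> Q \<in> range cpoly"
proof -
  define n where "n = degree D'"
  have n: "1 \<le> n" using Q by (simp add: n_def)
  have D'ne: "D' \<noteq> 0" using D' by auto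
  define D0 where "D0 = pCons 0 D' - Q"
  have degD0: "degree D0 = Suc n"
  proof (rule antisym)
    show "degree D0 \<le> Suc n" unfolding D0_def n_def
      by (intro degree_diff_le) (use Q D'ne in auto)
    show "Suc n \<le> degree D0"
      by (rule le_degree) (use Q D' in \<open>simp add: D0_def n_def coeff_eq_0\<close>)
  qed
  have lcD0: "lead_coeff D0 = 1"
    unfolding degD0 using Q D' by (simp add: D0_def n_def coeff_eq_0)
  obtain K s q C B C0 G where K: "finite K" and s: "strict_mono (s :: nat \<Rightarrow> nat)" and q: "1 \<le> q" "q \<le> degree D'"
    and CB: "\<And>i. C i * B i = D0 - smult (lconst (v (s i))) D'"
    and C: "\<And>i. lead_coeff (C i) = 1" "\<And>i. degree (C i) = q" "\<And>i. supp_in K q (C i)"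
    and B: "\<And>i. lead_coeff (B i) = 1" "\<And>i. degree (B i) = Suc (degree D') - q" "\<And>i. supp_in K (Suc (degree D')) (B i)"
    and lim: "poly_tendsto C C0" "lead_coeff C0 = 1" "degree C0 = q" "lead_coeff G = 1" "C0 * G = D'"
    using monic_pencil_limit[OF lcD0 D' _ v] degD0 red unfolding D0_def n_def by blast
  \<comment> \<open>\<open>C0\<close> has positive degree, so irreducibility of \<open>D'\<close>
    forces \<open>G = 1\<close>. Hence \<open>C i\<close> has the full degree \<open>n\<close> and
    \<open>B i\<close> is linear.\<close>
  have "C0 dvd 1 \<or> G dvd 1" using irr lim(5) unfolding irreducible_def by metis
  moreover have "\<not> C0 dvd 1" using laurent_poly_dvd_1_degree[of C0] lim(3) q by auto
  ultimately have "G = 1" using laurent_poly_dvd_1_degree monic_degree_0 lim(4) by blast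
  then have C0: "C0 = D'" using lim(5) by simp
  then have qn: "q = n" using lim(3) by (simp add: n_def)
  define w where "w = (\<lambda>i. v (s i))"
  have w: "filterlim w at_infinity sequentially"
    unfolding w_def using filterlim_compose[OF v filterlim_subseq[OF s]] .
  define X where "X = (\<lambda>i. - coeff (B i) 0)"
  have BX: "B i = [:- X i, 1:]" for i
  proof -
    have "degree (B i) = 1" using B(2) qn by (simp add: n_def)
    moreover from this have "coeff (B i) 1 = 1" using B(1)[of i] by simp
    ultimately show ?thesis
      by (auto simp: X_def poly_eq_iff coeff_pCons coeff_eq_0 split: nat.splits)
  qed
  define \<eta> where "\<eta> = (\<lambda>i. X i - lconst (w i))"
  have eq: "C i * [:- X i, 1:] = pCons 0 D' - Q - smult (lconst (w i)) D'" for i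
    using CB[of i] by (simp add: BX D0_def w_def)
  \<comment> \<open>Comparison of the coefficients of degree \<open>n\<close> in \<open>eq\<close>;
    as \<open>C i\<close> tends to \<open>D'\<close>, this gives \<eta> the limit 0.\<close>
  have eta: "\<eta> i = coeff (C i) (n - 1) - coeff D' (n - 1)" for i
  proof -
    obtain k where k: "n = Suc k" using n by (cases n) auto
    have "coeff (C i * [:- X i, 1:]) n = coeff (C i) (n - 1) - X i * coeff (C i) n"
      by (simp add: k algebra_simps)
    moreover have "coeff (C i) n = 1" using C(1,2)[of i] qn by simp
    moreover have "coeff (pCons 0 D' - Q - smult (lconst (w i)) D') n = coeff D' (n - 1) - lconst (w i)"
      using Q D' by (simp add: k n_def[symmetric] coeff_eq_0)
    ultimately have "coeff (C i) (n - 1) - X i = coeff D' (n - 1) - lconst (w i)"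
      unfolding eq[of i] by simp
    then show ?thesis by (simp add: \<eta>_def algebra_simps)
  qed
  have eta_lim: "(\<lambda>i. Poly_Mapping.lookup (\<eta> i) a) \<longlonglongrightarrow> 0" for a
  proof -
    have "(\<lambda>i. mcoeff (C i) (n - 1) a - mcoeff D' (n - 1) a) \<longlonglongrightarrow> mcoeff D' (n - 1) a - mcoeff D' (n - 1) a"
      using lim(1) C0 unfolding poly_tendsto_def by (intro tendsto_diff tendsto_const) auto
    then show ?thesis by (simp add: eta lookup_minus)
  qed
  \<comment> \<open>The exponent 0 is adjoined because \<eta> differs from \<open>X\<close> by a
    constant.\<close>
  define K0 where "K0 = insert 0 K"
  have K0: "finite K0" using K by (simp add: K0_def)
  have keysX: "Poly_Mapping.keys (X i) \<subseteq> K" for i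
    unfolding X_def keys_minus by (rule supp_in_keys[OF B(3)])
  have keys_eta: "Poly_Mapping.keys (\<eta> i) \<subseteq> K0" for i
    using keysX[of i] keys_diff[of "X i" "lconst (w i)"]
      by (auto simp: \<eta>_def K0_def lconst_def split: if_splits)
  have root: "\<eta> i * poly D' (X i) = poly Q (X i)" for i
    using arg_cong[OF eq[of i], of "\<lambda>p. poly p (X i)"]
      by (simp add: \<eta>_def algebra_simps)
  \<comment> \<open>Otherwise \<open>X i\<close> would be a root of the irreducible
    \<open>D'\<close>, so \<open>D'\<close> would be linear and \<open>Q\<close> a constant, which
    \<open>root\<close> would force to be 0.\<close>
  have D'X: "poly D' (X i) \<noteq> 0" for i
  proof
    assume 0: "poly D' (X i) = 0"
    then obtain E where E: "D' = [:- X i, 1:] * E" by (auto simp: poly_eq_0_iff_dvd elim: dvdE)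
    then have "E \<noteq> 0" using D'ne by auto
    have d: "degree D' = 1 + degree E"
      using laurent_poly_degree_mult[of "[:- X i, 1:]" E] \<open>E \<noteq> 0\<close> E by simp
    have "degree E = 0"
    proof (rule ccontr)
      assume "degree E \<noteq> 0"
      then have "\<not> irreducible ([:- X i, 1:] * E)" by (intro monic_mult_not_irreducible) auto
      then show False using irr E by simp
    qed
    then have "degree Q = 0" using d Q(2) by simp
    then obtain c where "Q = [:c:]" by (rule degree_eq_zeroE)
    then show False using root[of i] 0 Q(1) by simp
  qed
  \<comment> \<open>A substitute for dividing by a gcd: \<open>P1\<close> and \<open>Q1\<close> have
    no common zero except over the zeros of \<alpha>.\<close>
  obtain g P1 Q1 S T \<alpha> where \<alpha>: "\<alpha> \<noteq> 0" and gP: "smult \<alpha> D' = g * P1" and gQ: "smult \<alpha> Q = g * Q1"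
    and bez: "S * P1 + T * Q1 = [:\<alpha>:]"
    by (rule laurent_poly_scaled_bezout[OF D'ne])
  \<comment> \<open>\<open>poly g (X i)\<close> divides the nonzero
    \<open>\<alpha> * poly D' (X i)\<close>, so it cancels from \<open>root\<close>.\<close>
  have root1: "\<eta> i * poly P1 (X i) = poly Q1 (X i)" for i
  proof -
    have gp: "\<alpha> * poly D' (X i) = poly g (X i) * poly P1 (X i)"
      using arg_cong[OF gP, of "\<lambda>p. poly p (X i)"] by simp
    have gq: "\<alpha> * poly Q (X i) = poly g (X i) * poly Q1 (X i)"
      using arg_cong[OF gQ, of "\<lambda>p. poly p (X i)"] by simp
    have "poly g (X i) * (\<eta> i * poly P1 (X i) - poly Q1 (X i)) = \<eta> i * (\<alpha> * poly D' (X i)) - \<alpha> * poly Q (X i)"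
      unfolding gp gq by (simp add: algebra_simps)
    also have "\<dots> = 0" unfolding root[symmetric] by (simp add: algebra_simps)
    finally have "poly g (X i) = 0 \<or> \<eta> i * poly P1 (X i) - poly Q1 (X i) = 0" by simp
    moreover have "poly g (X i) \<noteq> 0"
    proof
      assume "poly g (X i) = 0"
      then have "\<alpha> * poly D' (X i) = 0" unfolding gp by simp
      then show False using \<alpha> D'X by simp
    qed
    ultimately show ?thesis by simp
  qed
  \<comment> \<open>The exponents of \<alpha> are separated too, so that \<alpha> has only finitely
    many zeros on the curve.\<close>
  obtain \<phi> :: "int ^ 'd \<Rightarrow> int" where \<phi>: "additive \<phi>" "inj_on \<phi> (K0 \<union> Poly_Mapping.keys \<alpha>)"
    using ex_separating_functional[of "K0 \<union> Poly_Mapping.keys \<alpha>"] K0 by auto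
  define Z where "Z = {x. x \<noteq> 0 \<and> char_eval (powi_char \<phi> x) \<alpha> = 0}"
  have finZ: "finite Z"
    unfolding Z_def
      by (rule finite_powi_char_zeros) (use \<phi>(2) \<alpha> in \<open>auto simp: inj_on_Un\<close>)
  \<comment> \<open>If two sections take the same value \<open>y\<close>, subtracting their
    equations \<open>(y - w) * P1 = Q1\<close> gives \<open>P1 = 0\<close>, then
    \<open>Q1 = 0\<close>, and the Bezout identity makes \<alpha> vanish at
    \<open>x\<close>.\<close>
  have zeros: "x \<in> Z"
    if x: "x \<noteq> 0" "char_eval (powi_char \<phi> x) (X i) = char_eval (powi_char \<phi> x) (X k)" and ne: "w i \<noteq> w k" for x i k
  proof -
    interpret E: comm_ring_hom "char_eval (powi_char \<phi> x)"
      by (intro char_eval_hom powi_char \<phi>(1) x(1))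
    let ?E = "char_eval (powi_char \<phi> x)"
    define y where "y = ?E (X i)"
    have e: "?E (\<eta> j) = ?E (X j) - w j" for j
      using powi_char(1)[OF \<phi>(1) x(1)] by (simp add: \<eta>_def E.hom_minus char_eval_lconst)
    have ev: "?E (poly F (X j)) = poly (map_poly ?E F) (?E (X j))" for F j
      by (simp add: E.poly_map_poly)
    have 1: "(y - w j) * poly (map_poly ?E P1) y = poly (map_poly ?E Q1) y" if "?E (X j) = y" for j
      using arg_cong[OF root1[of j], of ?E] by (simp only: E.hom_mult e ev that)
    have "(w i - w k) * poly (map_poly ?E P1) y = 0"
      using 1[of i] 1[of k] x(2) by (simp add: y_def algebra_simps)
    then have P0: "poly (map_poly ?E P1) y = 0" using ne by simp
    then have Q0: "poly (map_poly ?E Q1) y = 0" using 1[of i] by (simp add: y_def)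
    have "?E (poly (S * P1 + T * Q1) (X i)) = 0"
      by (simp only: poly_add poly_mult E.hom_add E.hom_mult ev y_def[symmetric] P0 Q0) simp
    then show ?thesis using x(1) by (simp add: bez Z_def)
  qed
  have weta: "\<forall>\<^sub>F k in sequentially. c \<noteq> w k + f k" if "f \<longlonglongrightarrow> (0 :: complex)" for c f
  proof -
    have "\<forall>\<^sub>F k in sequentially. norm (w k) \<ge> norm c + 1"
      using w by (simp add: filterlim_at_infinity[OF order_refl] add_pos_nonneg add_nonneg_pos)
    moreover have "\<forall>\<^sub>F k in sequentially. norm (f k) < 1"
      using that by (auto simp: tendsto_iff dist_norm)
    ultimately show ?thesis
    proof eventually_elim
      case (elim k)
      show ?case
      proof
        assume "c = w k + f k"
        then have "norm (w k) \<le> norm c + norm (f k)"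
          by (metis add_diff_cancel_right' norm_triangle_ineq4)
        then show False using elim by simp
      qed
    qed
  qed
  \<comment> \<open>Over each of the finitely many exceptional \<open>x\<close> the value of
    \<open>X k\<close> runs off to infinity, so eventually it differs from that of
    \<open>X 0\<close>.\<close>
  have ev1: "\<forall>\<^sub>F k in sequentially. \<forall>x\<in>Z. char_eval (powi_char \<phi> x) (X 0) \<noteq> char_eval (powi_char \<phi> x) (X k)"
    unfolding eventually_ball_finite_distrib[OF finZ]
  proof
    fix x assume "x \<in> Z"
    then have x: "x \<noteq> 0" by (simp add: Z_def)
    have "(\<lambda>k. \<Sum>a\<in>K0. Poly_Mapping.lookup (\<eta> k) a * powi_char \<phi> x a) \<longlonglongrightarrow> (\<Sum>a\<in>K0. 0 * powi_char \<phi> x a)"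
      by (intro tendsto_intros eta_lim)
    then have "(\<lambda>k. char_eval (powi_char \<phi> x) (\<eta> k)) \<longlonglongrightarrow> 0"
      using char_eval_superset[OF K0 keys_eta] by simp
    from weta[OF this, of "char_eval (powi_char \<phi> x) (X 0)"]
    show "\<forall>\<^sub>F k in sequentially. char_eval (powi_char \<phi> x) (X 0) \<noteq> char_eval (powi_char \<phi> x) (X k)"
    proof eventually_elim
      case (elim k)
      have "X k = lconst (w k) + \<eta> k" by (simp add: \<eta>_def)
      then show ?case using elim powi_char(1)[OF \<phi>(1) x]
        by (simp add: char_eval_add char_eval_lconst)
    qed
  qed
  have ev2: "\<forall>\<^sub>F k in sequentially. w 0 \<noteq> w k"
    using weta[of "\<lambda>_. 0" "w 0"] by simp
  have ev3: "\<forall>\<^sub>F k in sequentially. Poly_Mapping.lookup (X 0) 0 \<noteq> Poly_Mapping.lookup (X k) 0"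
    using weta[OF eta_lim[of 0], of "Poly_Mapping.lookup (X 0) 0"]
      by (simp add: \<eta>_def lookup_minus lookup_lconst)
  \<comment> \<open>Without zeros on the curve the difference is a single monomial; its coefficient
    at exponent 0 is nonzero, so it is a constant.\<close>
  have const: "\<forall>\<^sub>F k in sequentially. \<forall>a. a \<noteq> 0 \<longrightarrow> Poly_Mapping.lookup (X k) a = Poly_Mapping.lookup (X 0) a"
    using ev1 ev2 ev3
  proof eventually_elim
    case (elim k)
    let ?p = "X 0 - X k"
    have "Poly_Mapping.keys ?p \<subseteq> K0" using keys_diff[of "X 0" "X k"] keysX
      by (auto simp: K0_def)
    then have "inj_on \<phi> (Poly_Mapping.keys ?p)" using \<phi>(2)
      by (meson inj_on_subset Un_upper1 order_trans)
    moreover have p0: "Poly_Mapping.lookup ?p 0 \<noteq> 0" using elim by (simp add: lookup_minus)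
    moreover have "char_eval (powi_char \<phi> x) ?p \<noteq> 0" if x: "x \<noteq> 0" for x
    proof -
      interpret E: comm_ring_hom "char_eval (powi_char \<phi> x)"
        by (intro char_eval_hom powi_char \<phi>(1) x)
      show ?thesis using zeros[OF x] elim by (auto simp: E.hom_minus)
    qed
    ultimately obtain b c where "?p = Poly_Mapping.single b c"
      using no_powi_char_zeros_imp_single[of \<phi> ?p] by fastforce
    then have "Poly_Mapping.lookup ?p a = 0" if "a \<noteq> 0" for a
      using p0 that by (auto simp: lookup_single when_def split: if_splits)
    then show ?case by (simp add: lookup_minus)
  qed
  \<comment> \<open>Away from exponent 0 the coefficients of \<open>X k\<close> are those of \<eta>,
    which tend to 0, and eventually they agree with those of \<open>X 0\<close>.\<close>
  have X0: "Poly_Mapping.lookup (X 0) a = 0" if "a \<noteq> 0" for a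
  proof -
    have "\<forall>\<^sub>F k in sequentially. Poly_Mapping.lookup (\<eta> k) a = Poly_Mapping.lookup (X 0) a"
      using const that by (auto simp: \<eta>_def lookup_minus lookup_lconst elim: eventually_mono)
    from Lim_transform_eventually[OF eta_lim this] show ?thesis by (simp add: LIMSEQ_const_iff)
  qed
  define y where "y = (\<lambda>k. Poly_Mapping.lookup (X k) 0)"
  have "\<forall>\<^sub>F k in sequentially. X k = lconst (y k)"
    using const by eventually_elim (auto intro!: poly_mapping_eqI simp: lookup_lconst y_def X0)
  then obtain k0 where k0: "\<And>k. k \<ge> k0 \<Longrightarrow> X k = lconst (y k)"
    by (auto simp: eventually_sequentially)
  have rel: "(y k - w k) * poly (slice D' a) (y k) = poly (slice Q a) (y k)" if "k \<ge> k0" for k a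
  proof -
    have "\<eta> k = lconst (y k - w k)" by (simp add: \<eta>_def k0[OF that] lconst.hom_minus)
    then show ?thesis
      using arg_cong[OF root[of k], of "\<lambda>p. Poly_Mapping.lookup p a"]
      by (simp add: k0[OF that] lookup_poly_lconst lookup_lconst_mult del: lconst.hom_minus)
  qed
  have inf: "infinite (y ` {k0..})"
  proof
    assume fin: "finite (y ` {k0..})"
    have "\<forall>\<^sub>F k in sequentially. \<forall>c\<in>y ` {k0..}. c \<noteq> w k + Poly_Mapping.lookup (\<eta> k) 0"
      unfolding eventually_ball_finite_distrib[OF fin] by (intro ballI weta eta_lim)
    then have "\<forall>\<^sub>F k in sequentially. \<forall>c\<in>y ` {k0..}. c \<noteq> y k"
      by (simp add: \<eta>_def y_def lookup_minus lookup_lconst)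
    then have "\<forall>\<^sub>F k in sequentially. False"
      using eventually_ge_at_top[of k0] by eventually_elim auto
    then show False by simp
  qed
  \<comment> \<open>At \<open>y k\<close> all slices of \<open>Q\<close> are the same multiple
    \<open>y k - w k\<close> of the slices of \<open>D'\<close>, and there are infinitely many
    values \<open>y k\<close>.\<close>
  have cross: "slice Q a * slice D' b = slice Q b * slice D' a" for a b
  proof -
    have "y ` {k0..} \<subseteq> {z. poly (slice Q a * slice D' b - slice Q b * slice D' a) z = 0}"
      using rel by (auto simp: algebra_simps simp flip: rel)
    then have "slice Q a * slice D' b - slice Q b * slice D' a = 0"
      using inf poly_roots_finite finite_subset by blast
    then show ?thesis by simp
  qed
  define d0 q0 where "d0 = slice D' 0" and "q0 = slice Q 0"
  have d0: "degree d0 = n" "lead_coeff d0 = 1"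
  proof -
    show *: "degree d0 = n"
    proof (rule antisym)
      show "degree d0 \<le> n" by (simp add: d0_def n_def slice_def map_poly_degree_leq)
      show "n \<le> degree d0" using D' by (intro le_degree) (simp add: d0_def n_def coeff_slice)
    qed
    show "lead_coeff d0 = 1" unfolding * using D' by (simp add: d0_def coeff_slice n_def)
  qed
  have d0ne: "d0 \<noteq> 0" using d0 by auto
  have eq0: "cpoly q0 * D' = cpoly d0 * Q"
    unfolding d0_def q0_def
    by (rule poly_eqI_mcoeff) (simp only: mcoeff_cpoly_mult cross[of 0] mult.commute[of "slice D' 0"])
  have q0ne: "q0 \<noteq> 0"
  proof
    assume "q0 = 0"
    then have "cpoly d0 * Q = 0" using eq0 by simp
    then show False using d0ne Q(1) by simp
  qed
  define u where "u = gcd d0 q0"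
  have une: "u \<noteq> 0" using d0ne by (simp add: u_def)
  define d1 q1 where "d1 = d0 div u" and "q1 = q0 div u"
  have fac: "d0 = u * d1" "q0 = u * q1" by (simp_all add: u_def d1_def q1_def)
  have "coprime d1 q1" unfolding d1_def q1_def u_def by (rule div_gcd_coprime) (use d0ne in auto)
  then obtain \<sigma> \<tau> where st: "\<sigma> * d1 + \<tau> * q1 = 1"
    using bezout_coefficients_fst_snd[of d1 q1] by (auto simp: coprime_iff_gcd_eq_1)
  have "cpoly u * (cpoly q1 * D') = cpoly u * (cpoly d1 * Q)"
    using eq0 unfolding fac by (simp add: cpoly.hom_mult mult.assoc)
  then have eq1: "cpoly q1 * D' = cpoly d1 * Q"
    by (rule laurent_poly_mult_left_cancel) (use une in simp)
  \<comment> \<open>Bezout for the coprime \<open>d1\<close> and \<open>q1\<close> exhibits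
    \<open>d1\<close>, which is free of z, as a factor of \<open>D'\<close>.\<close>
  define F where "F = cpoly \<sigma> * D' + cpoly \<tau> * Q"
  have "D' = cpoly (\<sigma> * d1 + \<tau> * q1) * D'" using st by simp
  also have "\<dots> = cpoly d1 * (cpoly \<sigma> * D') + cpoly \<tau> * (cpoly q1 * D')"
    by (simp only: cpoly.hom_mult cpoly.hom_add) (simp add: algebra_simps)
  also have "\<dots> = cpoly d1 * F" unfolding eq1 F_def by (simp add: algebra_simps)
  finally have DF: "D' = cpoly d1 * F" .
  \<comment> \<open>Otherwise the gcd \<open>u\<close> would have degree \<open>n\<close>, too large
    to divide the slice \<open>q0\<close> of \<open>Q\<close>.\<close>
  have "1 \<le> degree d1"
  proof (rule ccontr)
    assume "\<not> ?thesis"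
    then have "degree d1 = 0" by simp
    moreover have "d1 \<noteq> 0" "q1 \<noteq> 0" using d0ne q0ne fac by auto
    ultimately have "degree u = n" "degree u \<le> degree q0"
      using d0(1) une by (simp_all add: fac degree_mult_eq)
    moreover have "degree q0 \<le> degree Q" by (simp add: q0_def slice_def map_poly_degree_leq)
    ultimately show False using Q(2) by (simp add: n_def)
  qed
  then have "\<not> (cpoly d1 :: 'd laurent poly) dvd 1"
    using laurent_poly_dvd_1_degree[of "cpoly d1 :: 'd laurent poly"] by auto
  then have "F dvd 1" using irr DF unfolding irreducible_def by metis
  then obtain f where f: "F = [:f:]" using laurent_poly_dvd_1_degree degree_eq_zeroE by metis
  have "lead_coeff (cpoly d1) * lead_coeff F = 1"
    using laurent_poly_lead_coeff_mult[of "cpoly d1" F] D' unfolding DF[symmetric] by metis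
  then have "lconst (lead_coeff d1) * f = 1" by (simp add: f)
  then have lf: "lead_coeff d1 * Poly_Mapping.lookup f a = (if a = 0 then 1 else 0)" for a
    using lookup_lconst_mult[of "lead_coeff d1" f a] by (simp add: lookup_one when_def)
  then have "f = lconst (Poly_Mapping.lookup f 0)"
    by (intro poly_mapping_eqI) (auto simp: lookup_lconst, metis lf mult_eq_0_iff zero_neq_one)
  then obtain c where "f = lconst c" by blast
  then have "F = cpoly [:c:]"
    unfolding f by (intro poly_eqI) (simp add: coeff_map_poly coeff_pCons split: nat.split)
  then have "D' = cpoly (d1 * [:c:])"
    unfolding cpoly.hom_mult using DF by simp
  then have D'c: "D' \<in> range cpoly" by blast
  then obtain p where p: "D' = cpoly p" by blast
  have "\<not> 2 \<le> degree p" using cpoly_not_irreducible(1) irr p by blast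
  then have "degree D' = 1" using n p by (simp add: n_def)
  moreover have "Q \<in> range cpoly"
    unfolding cpoly_range_iff
  proof (intro allI impI)
    fix j and a :: "int ^ 'd" assume a: "a \<noteq> 0"
    have "slice D' a = 0" using a by (intro poly_eqI) (simp add: coeff_slice p lookup_lconst)
    then have "slice Q a = 0" using cross[of a 0] d0ne by (simp add: d0_def)
    then show "mcoeff Q j a = 0" by (metis coeff_0 coeff_slice)
  qed
  ultimately show ?thesis using D'c by blast
qed

subsection \<open>Reducibility is a closed condition\<close>

text \<open>Kept as functions over an arbitrary index type, because elimination adjoins further
  unknowns to the parameters; substitution is then plain composition.\<close>

inductive_set polyfun :: "(('x \<Rightarrow> complex) \<Rightarrow> complex) set" where
  polyfun_const: "(\<lambda>_. c) \<in> polyfun"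
| polyfun_var: "(\<lambda>e. e x) \<in> polyfun"
| polyfun_add: "f \<in> polyfun \<Longrightarrow> g \<in> polyfun \<Longrightarrow> (\<lambda>e. f e + g e) \<in> polyfun"
| polyfun_mult: "f \<in> polyfun \<Longrightarrow> g \<in> polyfun \<Longrightarrow> (\<lambda>e. f e * g e) \<in> polyfun"

lemma polyfun_cmult: "f \<in> polyfun \<Longrightarrow> (\<lambda>e. c * f e) \<in> polyfun"
  by (intro polyfun_mult polyfun_const)

lemma polyfun_sum: "(\<And>i. i \<in> I \<Longrightarrow> f i \<in> polyfun) \<Longrightarrow> (\<lambda>e. \<Sum>i\<in>I. f i e) \<in> polyfun"
  by (induction I rule: infinite_finite_induct) (auto intro: polyfun_const polyfun_add)

lemma polyfun_prod: "(\<And>i. i \<in> I \<Longrightarrow> f i \<in> polyfun) \<Longrightarrow> (\<lambda>e. \<Prod>i\<in>I. f i e) \<in> polyfun"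
  by (induction I rule: infinite_finite_induct) (auto intro: polyfun_const polyfun_mult)

lemma polyfun_subst:
  assumes "f \<in> polyfun" "\<And>x. (\<lambda>e. s e x) \<in> polyfun"
  shows "(\<lambda>e. f (s e)) \<in> polyfun"
  using assms(1) by induction (auto intro: polyfun.intros assms(2))

text \<open>The bound \<open>m\<close> is uniform in \<open>e\<close>; it later fixes the size of a
  Sylvester matrix.\<close>

lemma polyfun_expand:
  assumes "f \<in> polyfun"
  shows "\<exists>F m. (\<forall>e. degree (F e) \<le> m) \<and> (\<forall>j. (\<lambda>e. coeff (F e) j) \<in> polyfun) \<and>
    (\<forall>e t. f (e(x := t)) = poly (F e) t)"
  using assms
proof induction
  case (polyfun_const c)
  then show ?case
    by (intro exI[of _ "\<lambda>_. [:c:]"] exI[of _ 0]) (auto intro: polyfun.intros)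
next
  case (polyfun_var y)
  show ?case
  proof (cases "y = x")
    case True
    then show ?thesis
      by (intro exI[of _ "\<lambda>_. [:0, 1:]"] exI[of _ 1]) (auto intro: polyfun.intros)
  next
    case False
    have "(\<lambda>e. coeff [:e y:] j) \<in> polyfun" for j
      by (cases j) (auto intro: polyfun.intros)
    then show ?thesis using False
      by (intro exI[of _ "\<lambda>e. [:e y:]"] exI[of _ 0]) auto
  qed
next
  case (polyfun_add f g)
  then obtain F m G n where
    "\<forall>e. degree (F e) \<le> m" "\<forall>j. (\<lambda>e. coeff (F e) j) \<in> polyfun" "\<forall>e t. f (e(x := t)) = poly (F e) t"
    "\<forall>e. degree (G e) \<le> n" "\<forall>j. (\<lambda>e. coeff (G e) j) \<in> polyfun" "\<forall>e t. g (e(x := t)) = poly (G e) t"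
    by blast
  moreover from this have "degree (F e + G e) \<le> max m n" for e
    by (intro degree_add_le) (auto intro: max.coboundedI1 max.coboundedI2)
  moreover from calculation have "(\<lambda>e. coeff (F e + G e) j) \<in> polyfun" for j
    unfolding coeff_add by (intro polyfun.polyfun_add) auto
  ultimately show ?case
    by (intro exI[of _ "\<lambda>e. F e + G e"] exI[of _ "max m n"]) (simp del: fun_upd_apply)
next
  case (polyfun_mult f g)
  then obtain F m G n where *:
    "\<forall>e. degree (F e) \<le> m" "\<forall>j. (\<lambda>e. coeff (F e) j) \<in> polyfun" "\<forall>e t. f (e(x := t)) = poly (F e) t"
    "\<forall>e. degree (G e) \<le> n" "\<forall>j. (\<lambda>e. coeff (G e) j) \<in> polyfun" "\<forall>e t. g (e(x := t)) = poly (G e) t"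
    by blast
  have "degree (F e * G e) \<le> m + n" for e
    using degree_mult_le[of "F e" "G e"] * by (meson add_mono order_trans)
  moreover have "(\<lambda>e. coeff (F e * G e) j) \<in> polyfun" for j
    unfolding coeff_mult using * by (intro polyfun_sum polyfun.polyfun_mult) auto
  ultimately show ?case using *
    by (intro exI[of _ "\<lambda>e. F e * G e"] exI[of _ "m + n"]) (simp del: fun_upd_apply)
qed

text \<open>With degrees independent of \<open>e\<close> the Sylvester matrix has a fixed size, and
  its determinant is a polynomial in its entries.\<close>

lemma polyfun_resultant:
  assumes "\<And>e. degree (p e) = m" "\<And>e. degree (q e) = n"
    and pc: "\<And>j. (\<lambda>e. coeff (p e) j) \<in> polyfun" and qc: "\<And>j. (\<lambda>e. coeff (q e) j) \<in> polyfun"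
  shows "(\<lambda>e. resultant (p e) (q e)) \<in> polyfun"
proof -
  have entry: "(\<lambda>e. sylvester_mat_sub m n (p e) (q e) $$ (i, j)) \<in> polyfun" if "i < m + n" "j < m + n" for i j
    unfolding sylvester_mat_sub_index[OF that]
      by (cases "i < n"; cases "i \<le> j"; cases "j - i \<le> m"; cases "i - n \<le> j"; cases "j \<le> i")
      (simp_all add: pc qc polyfun_const)
  have "(\<lambda>e. \<Sum>\<pi> | \<pi> permutes {0..<m + n}. signof \<pi> *
      (\<Prod>i = 0..<m + n. sylvester_mat_sub m n (p e) (q e) $$ (i, \<pi> i))) \<in> polyfun"
    by (intro polyfun_sum polyfun_cmult polyfun_prod entry) (auto dest: permutes_in_image[THEN iffD2, of _ "{0..<m + n}"])
  then show ?thesis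
    by (simp add: resultant_sub resultant_sub_def assms Determinant.det_def)
qed

lemma resultant_0_iff_common_root:
  fixes p q :: "complex poly"
  assumes "p \<noteq> 0"
  shows "resultant p q = 0 \<longleftrightarrow> (\<exists>t. poly p t = 0 \<and> poly q t = 0)"
proof -
  have gne: "gcd p q \<noteq> 0" using assms by simp
  have "degree (gcd p q) \<noteq> 0 \<longleftrightarrow> (\<exists>t. poly (gcd p q) t = 0)"
  proof
    assume "degree (gcd p q) \<noteq> 0"
    then show "\<exists>t. poly (gcd p q) t = 0"
      using fundamental_theorem_of_algebra[of "gcd p q"] by (auto simp: constant_degree)
  next
    assume "\<exists>t. poly (gcd p q) t = 0"
    then show "degree (gcd p q) \<noteq> 0" using gne by (auto elim!: degree_eq_zeroE)
  qed
  also have "\<dots> \<longleftrightarrow> (\<exists>t. poly p t = 0 \<and> poly q t = 0)"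
    by (simp add: poly_eq_0_iff_dvd)
  finally show ?thesis by (simp add: resultant_0_gcd)
qed

text \<open>When a multiple \<open>c * g\<close> is added to repair one more point, each point rules
  out at most one \<open>c\<close>, and there are infinitely many complex numbers.\<close>

lemma nonvanishing_combination:
  fixes L :: "('b \<Rightarrow> complex) set"
  assumes "finite X" "(\<lambda>_. 0) \<in> L" "\<And>f g c. f \<in> L \<Longrightarrow> g \<in> L \<Longrightarrow> (\<lambda>x. f x + c * g x) \<in> L"
    and "\<And>x. x \<in> X \<Longrightarrow> \<exists>g\<in>L. g x \<noteq> 0"
  shows "\<exists>h\<in>L. \<forall>x\<in>X. h x \<noteq> 0"
  using assms(1,4)
proof (induction X)
  case empty
  then show ?case using assms(2) by auto
next
  case (insert x X)
  then obtain h where h: "h \<in> L" "\<And>y. y \<in> X \<Longrightarrow> h y \<noteq> 0" by auto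
  obtain g where g: "g \<in> L" "g x \<noteq> 0" using insert.prems[of x] by auto
  \<comment> \<open>Where \<open>g y = 0\<close> the quotient is 0 by convention, which only
    excludes one further \<open>c\<close>.\<close>
  obtain c where c: "c \<notin> (\<lambda>y. - h y / g y) ` insert x X"
    using ex_new_if_finite[of "(\<lambda>y. - h y / g y) ` insert x X"] insert.hyps(1) infinite_UNIV_char_0 by auto
  have "h y + c * g y \<noteq> 0" if y: "y \<in> insert x X" for y
  proof (cases "g y = 0")
    case True
    then show ?thesis using y g h(2) by auto
  next
    case False
    have "c \<noteq> - h y / g y" using c y by auto
    show ?thesis
    proof
      assume "h y + c * g y = 0"
      then have "c * g y = - h y" by (simp add: add_eq_0_iff)
      then show False using False \<open>c \<noteq> - h y / g y\<close>
        by (metis nonzero_eq_divide_eq)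
    qed
  qed
  then show ?case by (intro bexI[OF _ assms(3)[OF h(1) g(1), of c]]) auto
qed

text \<open>The resultants range over all polynomial functions vanishing on the zero set of \<open>G\<close>, so a
  single one of them can avoid all roots of \<open>p e\<close> at once; adding a monic multiple of \<open>p e\<close> fixes
  the degree.\<close>
lemma eliminate_monic_variable:
  fixes p :: "('x \<Rightarrow> complex) \<Rightarrow> complex poly"
  assumes p: "\<And>e. degree (p e) = n" "\<And>e. lead_coeff (p e) = 1" "\<And>j. (\<lambda>e. coeff (p e) j) \<in> polyfun"
    and G: "G \<subseteq> polyfun"
  shows "\<exists>G'\<subseteq>polyfun. \<forall>e. (\<forall>g\<in>G'. g e = 0) \<longleftrightarrow> (\<exists>t. poly (p e) t = 0 \<and> (\<forall>g\<in>G. g (e(x := t)) = 0))"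
proof -
  \<comment> \<open>All polynomial functions vanishing on the zero set of \<open>G\<close>: the zero
    set is the same, but \<open>L\<close> is a linear space, as
    \<open>nonvanishing_combination\<close> requires.\<close>
  define L where "L = {h \<in> polyfun. \<forall>e. (\<forall>g\<in>G. g e = 0) \<longrightarrow> h e = 0}"
  define R where "R = {(H, m) | H m. (\<forall>e. degree (H e) \<le> m) \<and> (\<forall>j. (\<lambda>e. coeff (H e) j) \<in> polyfun) \<and>
    (\<exists>h\<in>L. \<forall>e t. h (e(x := t)) = poly (H e) t)}"
  \<comment> \<open>The added multiple of \<open>p e\<close> has degree exactly
    \<open>Suc m + n\<close>, above that of \<open>H e\<close>, and does not change the values at
    the roots of \<open>p e\<close>.\<close>
  define q where "q = (\<lambda>(H :: ('x \<Rightarrow> complex) \<Rightarrow> complex poly, m) e. H e + monom 1 (Suc m) * p e)"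
  define G' where "G' = (\<lambda>r e. resultant (p e) (q r e)) ` R"
  have pne: "p e \<noteq> 0" for e using p(2)[of e] by auto
  have degq: "degree (q (H, m) e) = Suc m + n" if "\<And>e. degree (H e) \<le> m" for H m e
  proof -
    have "degree (monom 1 (Suc m) * p e) = Suc m + n"
      using pne[of e] by (subst degree_mult_eq) (auto simp: degree_monom_eq p monom_eq_0_iff)
    then show ?thesis using that[of e] by (simp add: q_def degree_add_eq_right)
  qed
  have "G' \<subseteq> polyfun"
  proof
    fix f assume "f \<in> G'"
    then obtain H m where f: "f = (\<lambda>e. resultant (p e) (q (H, m) e))"
      and H: "\<And>e. degree (H e) \<le> m" "\<And>j. (\<lambda>e. coeff (H e) j) \<in> polyfun"
      by (auto simp: G'_def R_def)
    have "(\<lambda>e. coeff (q (H, m) e) j) \<in> polyfun" for j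
      unfolding q_def prod.case coeff_add coeff_mult
      by (intro polyfun_add H polyfun_sum polyfun_mult p polyfun_const)
    then show "f \<in> polyfun" unfolding f
      by (rule polyfun_resultant[OF p(1) degq[OF H(1)] p(3)])
  qed
  moreover have "(\<forall>g\<in>G'. g e = 0) \<longleftrightarrow> (\<exists>t. poly (p e) t = 0 \<and> (\<forall>g\<in>G. g (e(x := t)) = 0))" for e
  proof
    assume "\<exists>t. poly (p e) t = 0 \<and> (\<forall>g\<in>G. g (e(x := t)) = 0)"
    then obtain t where t: "poly (p e) t = 0" "\<forall>g\<in>G. g (e(x := t)) = 0" by blast
    have "resultant (p e) (q (H, m) e) = 0" if HmR: "(H, m) \<in> R" for H m
    proof -
      obtain h where "h \<in> L" "\<forall>e t. h (e(x := t)) = poly (H e) t"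
        using HmR unfolding R_def by blast
      moreover from this have "h (e(x := t)) = 0" using t(2) unfolding L_def by blast
      ultimately have "poly (H e) t = 0" by metis
      then have "poly (q (H, m) e) t = 0" using t(1) by (simp add: q_def)
      then show ?thesis using t(1) pne by (subst resultant_0_iff_common_root) auto
    qed
    then show "\<forall>g\<in>G'. g e = 0" by (auto simp: G'_def)
  next
    assume G'0: "\<forall>g\<in>G'. g e = 0"
    show "\<exists>t. poly (p e) t = 0 \<and> (\<forall>g\<in>G. g (e(x := t)) = 0)"
    proof (rule ccontr)
      assume none: "\<not> ?thesis"
      define X where "X = (\<lambda>t. e(x := t)) ` {t. poly (p e) t = 0}"
      have "\<exists>h\<in>L. \<forall>y\<in>X. h y \<noteq> 0"
      proof (rule nonvanishing_combination)
        show "finite X" unfolding X_def using pne poly_roots_finite by blast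
        show "(\<lambda>_. 0) \<in> L" by (auto simp: L_def intro: polyfun_const)
        show "(\<lambda>x. f x + c * g x) \<in> L" if "f \<in> L" "g \<in> L" for f g c
          using that by (auto simp: L_def intro: polyfun_add polyfun_cmult)
        show "\<exists>g\<in>L. g y \<noteq> 0" if yX: "y \<in> X" for y
        proof -
          obtain g where "g \<in> G" "g y \<noteq> 0" using yX none by (auto simp: X_def)
          moreover have "g \<in> L" using \<open>g \<in> G\<close> G by (auto simp: L_def)
          ultimately show ?thesis by blast
        qed
      qed
      then obtain h where h: "h \<in> L" "\<And>t. poly (p e) t = 0 \<Longrightarrow> h (e(x := t)) \<noteq> 0"
        by (auto simp: X_def)
      have "h \<in> polyfun" using h(1) by (simp add: L_def)
      from polyfun_expand[OF this, of x]
      obtain H m where H: "\<forall>e. degree (H e) \<le> m" "\<forall>j. (\<lambda>e. coeff (H e) j) \<in> polyfun"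
        "\<forall>e t. h (e(x := t)) = poly (H e) t" by (elim exE conjE)
      then have "(H, m) \<in> R" using h(1) unfolding R_def by blast
      then have "resultant (p e) (q (H, m) e) = 0" using G'0 by (auto simp: G'_def)
      then obtain t where t: "poly (p e) t = 0" "poly (q (H, m) e) t = 0"
        using resultant_0_iff_common_root[OF pne] by blast
      then have "poly (H e) t = 0" by (simp add: q_def)
      then show False using h(2)[OF t(1)] H(3) by simp
    qed
  qed
  ultimately show ?thesis by blast
qed

text \<open>The variables are eliminated one by one; by \<open>indep\<close> the equation for one of
  them does not involve the others, so it survives their elimination.\<close>

lemma eliminate_monic_variables:
  fixes p :: "'x \<Rightarrow> ('x \<Rightarrow> complex) \<Rightarrow> complex poly"
  assumes Y: "finite Y"
    and p: "\<And>y e. y \<in> Y \<Longrightarrow> degree (p y e) = n" "\<And>y e. y \<in> Y \<Longrightarrow> lead_coeff (p y e) = 1"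
      "\<And>y j. y \<in> Y \<Longrightarrow> (\<lambda>e. coeff (p y e) j) \<in> polyfun"
    and indep: "\<And>y y' e t. y \<in> Y \<Longrightarrow> y' \<in> Y \<Longrightarrow> p y (e(y' := t)) = p y e"
    and G: "G \<subseteq> polyfun"
  shows "\<exists>G'\<subseteq>polyfun. \<forall>e. (\<forall>g\<in>G'. g e = 0) \<longleftrightarrow>
    (\<exists>t. (\<forall>y\<in>Y. poly (p y e) (t y) = 0) \<and> (\<forall>g\<in>G. g (\<lambda>z. if z \<in> Y then t z else e z) = 0))"
proof -
  have "\<exists>G'\<subseteq>polyfun. \<forall>e. (\<forall>g\<in>G'. g e = 0) \<longleftrightarrow>
      (\<exists>t. (\<forall>y\<in>Z. poly (p y e) (t y) = 0) \<and> (\<forall>g\<in>G. g (\<lambda>z. if z \<in> Z then t z else e z) = 0))"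
    if "Z \<subseteq> Y" for Z
    using finite_subset[OF that Y] that
  proof (induction Z)
    case empty
    then show ?case using G by auto
  next
    case (insert y Z)
    then obtain G1 where G1: "G1 \<subseteq> polyfun" "\<And>e. (\<forall>g\<in>G1. g e = 0) \<longleftrightarrow>
      (\<exists>t. (\<forall>y\<in>Z. poly (p y e) (t y) = 0) \<and> (\<forall>g\<in>G. g (\<lambda>z. if z \<in> Z then t z else e z) = 0))"
    proof -
      from insert.prems have "Z \<subseteq> Y" by simp
      from insert.IH[OF this] show thesis using that by (elim exE conjE) simp
    qed
    have y: "y \<in> Y" using insert by simp
    obtain G2 where G2: "G2 \<subseteq> polyfun" "\<And>e. (\<forall>g\<in>G2. g e = 0) \<longleftrightarrow>
        (\<exists>s. poly (p y e) s = 0 \<and> (\<forall>g\<in>G1. g (e(y := s)) = 0))"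
    proof -
      from eliminate_monic_variable[of "p y" n G1 y, OF p[OF y] G1(1)]
      show thesis using that by (elim exE conjE) simp
    qed
    have pZ: "p z (e(y := s)) = p z e" if "z \<in> Z" for z e s
      using indep[of z y] that insert.prems y by blast
    have "(\<forall>g\<in>G2. g e = 0) \<longleftrightarrow> (\<exists>t. (\<forall>z\<in>insert y Z. poly (p z e) (t z) = 0) \<and>
        (\<forall>g\<in>G. g (\<lambda>z. if z \<in> insert y Z then t z else e z) = 0))" (is "_ \<longleftrightarrow> (\<exists>t. ?R t)") for e
    proof
      assume "\<forall>g\<in>G2. g e = 0"
      then obtain s t where s: "poly (p y e) s = 0" "\<forall>z\<in>Z. poly (p z e) (t z) = 0"
        "\<forall>g\<in>G. g (\<lambda>z. if z \<in> Z then t z else (e(y := s)) z) = 0"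
        unfolding G2(2) G1(2) using pZ by auto
      have "(\<lambda>z. if z \<in> insert y Z then (t(y := s)) z else e z) = (\<lambda>z. if z \<in> Z then t z else (e(y := s)) z)"
        using insert.hyps(2) by auto
      then have "?R (t(y := s))" using s insert.hyps(2) by auto
      then show "\<exists>t. ?R t" by blast
    next
      assume "\<exists>t. ?R t"
      then obtain t where t: "?R t" by blast
      have eq: "(\<lambda>z. if z \<in> insert y Z then t z else e z) = (\<lambda>z. if z \<in> Z then t z else (e(y := t y)) z)"
        by auto
      show "\<forall>g\<in>G2. g e = 0"
        unfolding G2(2) G1(2) using t unfolding eq
          by (intro exI[of _ "t y"] conjI exI[of _ t]) (auto simp: pZ)
    qed
    then show ?case using G2(1) by blast
  qed
  then show ?thesis by blast
qed

section \<open>Laurent polynomials depending polynomially on parameters\<close>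

text \<open>Finite sums of fixed polynomials with polynomial functions as scalars; the fixed
  polynomials bound the support uniformly in the parameters.\<close>

inductive_set polyfam :: "(('x \<Rightarrow> complex) \<Rightarrow> 'd::finite laurent poly) set" where
  polyfam_base: "f \<in> polyfun \<Longrightarrow> (\<lambda>e. smult (lconst (f e)) M) \<in> polyfam"
| polyfam_add: "X \<in> polyfam \<Longrightarrow> Y \<in> polyfam \<Longrightarrow> (\<lambda>e. X e + Y e) \<in> polyfam"

lemma polyfam_const: "(\<lambda>_. M) \<in> polyfam"
  using polyfam_base[OF polyfun_const[of 1], of M] by simp

lemma polyfam_lconst: "f \<in> polyfun \<Longrightarrow> (\<lambda>e. [:lconst (f e):]) \<in> polyfam"
  using polyfam_base[of f 1] by simp

lemma polyfam_mult: "X \<in> polyfam \<Longrightarrow> Y \<in> polyfam \<Longrightarrow> (\<lambda>e. X e * Y e) \<in> polyfam"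
proof (induction rule: polyfam.induct)
  case (polyfam_base f M)
  from polyfam_base(2) show ?case
  proof induction
    case (polyfam_base g N)
    have "(\<lambda>e. smult (lconst (f e * g e)) (M * N)) \<in> polyfam"
      by (intro polyfam.intros polyfun_mult \<open>f \<in> polyfun\<close> polyfam_base)
    then show ?case by (simp add: lconst.hom_mult mult.commute)
  qed (auto simp: algebra_simps smult_add_right intro: polyfam.intros)
qed (auto simp: algebra_simps intro: polyfam.intros)

lemma polyfam_uminus: "X \<in> polyfam \<Longrightarrow> (\<lambda>e. - X e) \<in> polyfam"
  using polyfam_mult[OF polyfam_const[of "-1"], of X] by simp

lemma polyfam_diff: "X \<in> polyfam \<Longrightarrow> Y \<in> polyfam \<Longrightarrow> (\<lambda>e. X e - Y e) \<in> polyfam"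
  using polyfam_add[OF _ polyfam_uminus, of X Y] by simp

lemma polyfam_sum: "(\<And>i. i \<in> I \<Longrightarrow> X i \<in> polyfam) \<Longrightarrow> (\<lambda>e. \<Sum>i\<in>I. X i e) \<in> polyfam"
  by (induction I rule: infinite_finite_induct) (auto intro: polyfam_const polyfam_add)

lemma polyfam_prod: "(\<And>i. i \<in> I \<Longrightarrow> X i \<in> polyfam) \<Longrightarrow> (\<lambda>e. \<Prod>i\<in>I. X i e) \<in> polyfam"
  by (induction I rule: infinite_finite_induct) (auto intro: polyfam_const polyfam_mult)

lemma polyfam_subst:
  assumes "X \<in> polyfam" "\<And>x. (\<lambda>e. s e x) \<in> polyfun"
  shows "(\<lambda>e. X (s e)) \<in> polyfam"
  using assms(1)
proof induction
  case (polyfam_base f M)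
  then show ?case by (rule polyfam.polyfam_base[OF polyfun_subst[OF _ assms(2)]])
qed (auto intro: polyfam.polyfam_add)

lemma polyfam_mcoeff: "X \<in> polyfam \<Longrightarrow> (\<lambda>e. mcoeff (X e) j a) \<in> polyfun"
  by (induction rule: polyfam.induct)
    (auto simp: lookup_lconst_mult lookup_add intro: polyfun_mult polyfun_add polyfun_const)

lemma polyfam_char_eval:
  assumes "X \<in> polyfam" "\<theta> 0 = 1" "\<And>a b. \<theta> (a + b) = \<theta> a * \<theta> b"
  shows "(\<lambda>e. char_eval \<theta> (coeff (X e) j)) \<in> polyfun"
proof -
  interpret E: comm_ring_hom "char_eval \<theta>" using char_eval_hom assms(2,3) by blast
  show ?thesis using assms(1)
    by induction (auto simp: E.hom_mult E.hom_add char_eval_lconst assms(2)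
        intro: polyfun_mult polyfun_add polyfun_const)
qed

lemma polyfam_mons_finite:
  assumes "X \<in> polyfam" obtains M where "finite M" "\<And>e. mons (X e) \<subseteq> M"
proof -
  have "\<exists>M. finite M \<and> (\<forall>e. mons (X e) \<subseteq> M)" using assms
  proof induction
    case (polyfam_base f M)
    have "mons (smult (lconst (f e)) M) \<subseteq> mons M" for e
      by (auto simp: mons_def lookup_lconst_mult)
    then show ?case using finite_mons by blast
  next
    case (polyfam_add X Y)
    then obtain M N where "finite M" "\<forall>e. mons (X e) \<subseteq> M" "finite N" "\<forall>e. mons (Y e) \<subseteq> N" by blast
    moreover have "mons (X e + Y e) \<subseteq> mons (X e) \<union> mons (Y e)" for e
      by (auto simp: mons_def lookup_add)
    ultimately show ?case by (intro exI[of _ "M \<union> N"]) blast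
  qed
  then show thesis using that by blast
qed

section \<open>Interpolation by characters and recovery of factors from their roots\<close>

text \<open>Geometric sum of an n-th root of unity; the bound on \<open>k\<close> excludes the
  nonzero multiples of \<open>n\<close>.\<close>

lemma cis_frac_sum:
  fixes k :: int
  assumes "\<bar>k\<bar> < int n"
  shows "(\<Sum>r<n. cis (2 * pi * real r * of_int k / real n)) = (if k = 0 then of_nat n else 0)"
proof (cases "k = 0")
  case False
  define \<zeta> where "\<zeta> = cis (2 * pi * of_int k / real n)"
  have n: "n > 0" using assms by (cases n) auto
  have "\<zeta> \<noteq> 1"
  proof
    assume "\<zeta> = 1"
    then have "cos (2 * pi * of_int k / real n) = 1" by (simp add: \<zeta>_def complex_eq_iff)
    then obtain m :: int where "2 * pi * of_int k / real n = of_int m * 2 * pi"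
      using cos_one_2pi_int by auto
    then have "real_of_int k = of_int m * real n" using n by (simp add: field_simps)
    then have "k = m * int n" by (metis of_int_eq_iff of_int_mult of_int_of_nat_eq)
    then show False using assms False by (simp add: abs_mult)
  qed
  moreover have "\<zeta> ^ n = 1"
  proof -
    have "\<zeta> ^ n = cis (real n * (2 * pi * of_int k / real n))" unfolding \<zeta>_def
      by (rule Complex.DeMoivre)
    also have "real n * (2 * pi * of_int k / real n) = 2 * pi * of_int k" using n by simp
    finally have "\<zeta> ^ n = cis (2 * pi * of_int k)" .
    then show ?thesis by (simp add: complex_eq_iff)
  qed
  moreover have "cis (2 * pi * real r * of_int k / real n) = \<zeta> ^ r" for r
    unfolding \<zeta>_def by (subst Complex.DeMoivre) (simp add: algebra_simps)
  ultimately show ?thesis using False geometric_sum[of \<zeta> n] by simp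
qed simp

text \<open>Discrete Fourier inversion along a functional that separates \<open>K\<close>.\<close>
lemma ex_char_interpolation:
  fixes K :: "(int ^ 'd::finite) set"
  assumes "finite K"
  obtains n :: nat and \<theta> :: "nat \<Rightarrow> int ^ 'd \<Rightarrow> complex" and q :: "nat \<Rightarrow> 'd laurent"
  where "\<forall>r. \<theta> r 0 = 1" "\<forall>r a b. \<theta> r (a + b) = \<theta> r a * \<theta> r b"
    "\<forall>p. Poly_Mapping.keys p \<subseteq> K \<longrightarrow> (\<Sum>r<n. q r * lconst (char_eval (\<theta> r) p)) = p"
proof -
  obtain \<phi> :: "int ^ 'd \<Rightarrow> int" where \<phi>: "additive \<phi>" "inj_on \<phi> K"
    using ex_separating_functional[OF assms] by blast
  \<comment> \<open>Larger than all differences of \<phi>-values on \<open>K\<close>, so that these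
    values stay distinct modulo \<open>n\<close>.\<close>
  define n where "n = Suc (nat (\<Sum>a\<in>K. \<Sum>b\<in>K. \<bar>\<phi> a - \<phi> b\<bar>))"
  have n: "\<bar>\<phi> a - \<phi> b\<bar> < int n" if "a \<in> K" "b \<in> K" for a b
  proof -
    have "\<bar>\<phi> a - \<phi> b\<bar> \<le> (\<Sum>b\<in>K. \<bar>\<phi> a - \<phi> b\<bar>)"
      by (rule member_le_sum) (use assms that in auto)
    also have "\<dots> \<le> (\<Sum>a\<in>K. \<Sum>b\<in>K. \<bar>\<phi> a - \<phi> b\<bar>)"
      using member_le_sum[OF that(1), of "\<lambda>a. \<Sum>b\<in>K. \<bar>\<phi> a - \<phi> b\<bar>"] assms by (simp add: sum_nonneg)
    finally have "\<bar>\<phi> a - \<phi> b\<bar> \<le> (\<Sum>a\<in>K. \<Sum>b\<in>K. \<bar>\<phi> a - \<phi> b\<bar>)" .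
    then show ?thesis using abs_ge_zero[of "\<phi> a - \<phi> b"] unfolding n_def by linarith
  qed
  define \<theta> where "\<theta> = (\<lambda>(r :: nat) a. cis (2 * pi * real r * of_int (\<phi> a) / real n))"
  define q where "q = (\<lambda>r. \<Sum>b\<in>K. Poly_Mapping.single b (\<theta> r (- b) / of_nat n))"
  have \<theta>0: "\<theta> r 0 = 1" for r by (simp add: \<theta>_def additive.zero[OF \<phi>(1)])
  have \<theta>_add: "\<theta> r (a + b) = \<theta> r a * \<theta> r b" for r a b
    by (simp add: \<theta>_def additive.add[OF \<phi>(1)] cis_mult algebra_simps add_divide_distrib)
  have orth: "(\<Sum>r<n. \<theta> r (- b) * \<theta> r a) / of_nat n = (if a = b then 1 else 0)" if "a \<in> K" "b \<in> K" for a b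
  proof -
    have "(\<Sum>r<n. \<theta> r (- b) * \<theta> r a) = (\<Sum>r<n. cis (2 * pi * real r * of_int (\<phi> a - \<phi> b) / real n))"
      unfolding \<theta>_add[symmetric] by (simp add: \<theta>_def additive.diff[OF \<phi>(1)])
    also have "\<dots> = (if \<phi> a - \<phi> b = 0 then of_nat n else 0)"
      by (rule cis_frac_sum[OF n[OF that]])
    finally show ?thesis using \<phi>(2) that
      by (auto simp: n_def dest: inj_onD simp del: of_nat_Suc)
  qed
  show thesis
  proof (rule that[of \<theta> q n], goal_cases)
    case 3
    show ?case
    proof (intro allI impI)
      fix p :: "'d laurent" assume p: "Poly_Mapping.keys p \<subseteq> K"
      show "(\<Sum>r<n. q r * lconst (char_eval (\<theta> r) p)) = p"
      proof (rule poly_mapping_eqI)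
        fix c
        have lq: "Poly_Mapping.lookup (q r) c = (if c \<in> K then \<theta> r (- c) / of_nat n else 0)" for r
          unfolding q_def lookup_sum lookup_single when_def using assms by (simp add: sum.delta)
        show "Poly_Mapping.lookup (\<Sum>r<n. q r * lconst (char_eval (\<theta> r) p)) c = Poly_Mapping.lookup p c"
        proof (cases "c \<in> K")
          case False
          then show ?thesis using p
            by (auto simp: lookup_sum mult.commute[of "q _"] lookup_lconst_mult lq in_keys_iff)
        next
          case True
          have "Poly_Mapping.lookup (\<Sum>r<n. q r * lconst (char_eval (\<theta> r) p)) c
              = (\<Sum>r<n. (\<Sum>a\<in>K. Poly_Mapping.lookup p a * \<theta> r a) * (\<theta> r (- c) / of_nat n))"
            using True
              by (simp add: lookup_sum mult.commute[of "q _"] lookup_lconst_mult lq char_eval_superset[OF assms p])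
          also have "\<dots> = (\<Sum>r<n. \<Sum>a\<in>K. Poly_Mapping.lookup p a * (\<theta> r (- c) * \<theta> r a / of_nat n))"
            by (simp add: sum_distrib_right sum_distrib_left mult_ac)
          also have "\<dots> = (\<Sum>a\<in>K. Poly_Mapping.lookup p a * ((\<Sum>r<n. \<theta> r (- c) * \<theta> r a) / of_nat n))"
            by (subst sum.swap) (simp add: sum_distrib_left sum_divide_distrib)
          also have "\<dots> = (\<Sum>a\<in>K. if a = c then Poly_Mapping.lookup p a else 0)"
            by (intro sum.cong refl) (use orth[OF _ True] in auto)
          finally show ?thesis using assms True by simp
        qed
      qed
    qed
  qed (use \<theta>0 \<theta>_add in auto)
qed

lemma degree_prod_linear:
  fixes t :: "nat \<Rightarrow> complex"
  shows "finite I \<Longrightarrow> degree (\<Prod>i\<in>I. [:- t i, 1:]) = card I" "finite I \<Longrightarrow> lead_coeff (\<Prod>i\<in>I. [:- t i, 1:]) = 1"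
proof -
  show "finite I \<Longrightarrow> degree (\<Prod>i\<in>I. [:- t i, 1:]) = card I"
    by (subst degree_prod_eq_sum_degree) auto
  show "finite I \<Longrightarrow> lead_coeff (\<Prod>i\<in>I. [:- t i, 1:]) = 1"
    by (simp add: lead_coeff_prod)
qed

lemma monic_complex_poly_roots:
  fixes p :: "complex poly"
  assumes "lead_coeff p = 1" obtains t :: "nat \<Rightarrow> complex" where "p = (\<Prod>i<degree p. [:- t i, 1:])"
  using complex_poly_decompose'[of p] assms by (metis smult_1_left)

lemma cpoly_linear: "[:0, 1:] - [:lconst t:] = cpoly [:- t, 1:]"
  by (intro poly_eqI) (simp add: coeff_map_poly coeff_pCons lconst.hom_uminus split: nat.split)

text \<open>The unknowns are the roots of the two factors at finitely many interpolation points of the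
  torus: they are integral over the parameters, and the factors can be recovered from them.\<close>
theorem factor_degrees_closed:
  fixes D :: "('n \<Rightarrow> complex) \<Rightarrow> 'd::finite laurent poly"
  assumes D: "D \<in> polyfam" and deg: "\<And>e. degree (D e) = m" and monic: "\<And>e. lead_coeff (D e) = 1"
    and r: "r \<le> m"
  shows "\<exists>G\<subseteq>polyfun. \<forall>e. (\<forall>g\<in>G. g e = 0) \<longleftrightarrow>
    (\<exists>A B. lead_coeff A = 1 \<and> lead_coeff B = 1 \<and> degree A = r \<and> degree B = m - r \<and> A * B = D e)"
proof -
  obtain M where M: "finite M" "\<And>e. mons (D e) \<subseteq> M" using polyfam_mons_finite[OF D]
    by blast
  \<comment> \<open>With 0 in the box the interpolation formula also applies to the constant 1;
    hence the weights \<open>q k\<close> sum to 1 and rebuilt polynomials are monic.\<close>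
  obtain s where s: "insert 0 (fst ` M) \<subseteq> int_box s"
    using finite_subset_box[of "insert 0 (fst ` M)"] M(1) by blast
  define K where "K = (int_box s :: (int ^ 'd) set)"
  have K: "finite K" "0 \<in> K" using finite_box s by (auto simp: K_def)
  obtain n and \<theta> :: "nat \<Rightarrow> int ^ 'd \<Rightarrow> complex" and q :: "nat \<Rightarrow> 'd laurent"
    where *: "\<forall>k. \<theta> k 0 = 1" "\<forall>k a b. \<theta> k (a + b) = \<theta> k a * \<theta> k b"
      "\<forall>p. Poly_Mapping.keys p \<subseteq> K \<longrightarrow> (\<Sum>k<n. q k * lconst (char_eval (\<theta> k) p)) = p"
    by (rule ex_char_interpolation[OF K(1)])
  note \<theta>0 = *(1)[rule_format] and \<theta>_add = *(2)[rule_format] and interp = *(3)[rule_format]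
  have hom: "comm_ring_hom (char_eval (\<theta> k))" for k
    by (intro char_eval_hom \<theta>0 \<theta>_add)
  define E where "E = (\<lambda>k. map_poly (char_eval (\<theta> k)))"
  have E_mult: "E k (P * Q) = E k P * E k Q" for k P Q
  proof -
    interpret H: comm_ring_hom "char_eval (\<theta> k)" by (rule hom)
    interpret HP: map_poly_comm_ring_hom "char_eval (\<theta> k)" ..
    show ?thesis unfolding E_def by (rule HP.hom_mult)
  qed
  have E_coeff: "coeff (E k P) j = char_eval (\<theta> k) (coeff P j)" for k P j
    by (simp add: E_def coeff_map_poly char_eval_def)
  have E_one: "char_eval (\<theta> k) 1 = 1" for k
    using comm_ring_hom.axioms(1)[OF hom] \<theta>0 by (simp add: char_eval_def)
  have E_monic: "degree (E k P) = degree P" "lead_coeff (E k P) = 1" if "lead_coeff P = 1" for k P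
  proof -
    have "degree (E k P) \<le> degree P" unfolding E_def by (rule degree_map_poly_le)
    moreover have "degree P \<le> degree (E k P)" using that
      by (intro le_degree) (simp add: E_coeff E_one)
    ultimately show "degree (E k P) = degree P" by simp
    then show "lead_coeff (E k P) = 1" using that by (simp add: E_coeff E_one)
  qed
  have recover: "(\<Sum>k<n. [:q k:] * cpoly (E k P)) = P" if "\<And>j. Poly_Mapping.keys (coeff P j) \<subseteq> K" for P
  proof (rule poly_eqI)
    fix j
    show "coeff (\<Sum>k<n. [:q k:] * cpoly (E k P)) j = coeff P j"
      using interp[OF that] by (simp add: coeff_sum coeff_map_poly E_coeff)
  qed
  have sumq: "(\<Sum>k<n. q k) = 1" using interp[of 1] K(2) E_one by simp
  have rebuilt_monic: "degree (\<Sum>k<n. [:q k:] * cpoly (f k)) = d \<and> lead_coeff (\<Sum>k<n. [:q k:] * cpoly (f k)) = 1"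
    if f: "\<And>k. degree (f k) = d" "\<And>k. lead_coeff (f k) = 1" for f d
  proof -
    let ?P = "\<Sum>k<n. [:q k:] * cpoly (f k)"
    have c: "coeff ?P d = 1" using f sumq by (simp add: coeff_sum coeff_map_poly)
    have "degree ?P \<le> d"
      using f by (intro degree_sum_le) (auto intro!: order_trans[OF degree_smult_le])
    moreover have "d \<le> degree ?P" by (rule le_degree) (simp only: c, simp)
    ultimately show ?thesis using c by simp
  qed
  \<comment> \<open>The unknown \<open>Inr (k, i)\<close> stands for the root number
    \<open>i\<close> at the interpolation point number \<open>k\<close>.\<close>
  define Dh where "Dh = (\<lambda>e :: 'n + nat \<times> nat \<Rightarrow> complex. D (\<lambda>x. e (Inl x)))"
  have Dh: "Dh \<in> polyfam" unfolding Dh_def by (rule polyfam_subst[OF D polyfun_var])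
  \<comment> \<open>The monic equation for the unknown \<open>y\<close>: the value of
    \<open>D\<close> at its interpolation point. Only unknowns of the form \<open>Inr\<close> are
    eliminated, so \<open>projr\<close> is meaningful.\<close>
  define p where "p = (\<lambda>(y :: 'n + nat \<times> nat) e. E (fst (projr y)) (Dh e))"
  define Y where "Y = (Inr :: nat \<times> nat \<Rightarrow> 'n + nat \<times> nat) ` ({..<n} \<times> {..<m})"
  \<comment> \<open>The candidate factor interpolated from the roots with numbers in
    \<open>I\<close>; for finite \<open>I\<close> it is monic of degree \<open>card I\<close>
    whatever the values of the unknowns.\<close>
  define F where "F = (\<lambda>I (e :: 'n + nat \<times> nat \<Rightarrow> complex). \<Sum>k<n. [:q k:] * (\<Prod>i\<in>I. [:0, 1:] - [:lconst (e (Inr (k, i))):]))"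
  have F_polyfam: "F I \<in> polyfam" for I
    unfolding F_def
      by (intro polyfam_sum polyfam_mult polyfam_prod polyfam_diff polyfam_const polyfam_lconst polyfun_var)
  have F_eq: "F I e = (\<Sum>k<n. [:q k:] * cpoly (\<Prod>i\<in>I. [:- e (Inr (k, i)), 1:]))" for I e
    unfolding F_def cpoly_linear by (simp add: cpoly.hom_prod)
  have F_monic: "degree (F I e) = card I \<and> lead_coeff (F I e) = 1" if "finite I" for I e
    unfolding F_eq using degree_prod_linear[OF that] by (intro rebuilt_monic) auto
  define G where "G = {\<lambda>e. mcoeff (F {..<r} e * F {r..<m} e - Dh e) j a | j a. True}"
  have G: "G \<subseteq> polyfun"
  proof -
    have "(\<lambda>e. F {..<r} e * F {r..<m} e - Dh e) \<in> polyfam"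
      by (intro polyfam_diff polyfam_mult F_polyfam Dh)
    from polyfam_mcoeff[OF this] show ?thesis unfolding G_def by blast
  qed
  have G_iff: "(\<forall>g\<in>G. g e = 0) \<longleftrightarrow> F {..<r} e * F {r..<m} e = Dh e" for e
  proof
    assume *: "\<forall>g\<in>G. g e = 0"
    have "mcoeff (F {..<r} e * F {r..<m} e - Dh e) j a = mcoeff 0 j a" for j a
      using bspec[OF *, of "\<lambda>e. mcoeff (F {..<r} e * F {r..<m} e - Dh e) j a"]
        by (auto simp: G_def)
    then have "F {..<r} e * F {r..<m} e - Dh e = 0" by (rule poly_eqI_mcoeff)
    then show "F {..<r} e * F {r..<m} e = Dh e" by simp
  qed (auto simp: G_def)
  have p_monic: "degree (p y e) = m" "lead_coeff (p y e) = 1" for y e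
    using E_monic[OF monic] deg by (auto simp: p_def Dh_def)
  have "\<exists>G'\<subseteq>polyfun. \<forall>e. (\<forall>g\<in>G'. g e = 0) \<longleftrightarrow>
    (\<exists>t. (\<forall>y\<in>Y. poly (p y e) (t y) = 0) \<and> (\<forall>g\<in>G. g (\<lambda>z. if z \<in> Y then t z else e z) = 0))"
  proof (rule eliminate_monic_variables)
    show "finite Y" by (simp add: Y_def)
    show "(\<lambda>e. coeff (p y e) j) \<in> polyfun" for y j
      unfolding p_def E_coeff by (rule polyfam_char_eval[OF Dh]) (rule \<theta>0 \<theta>_add)+
    show "p y (e(y' := t)) = p y e" if "y' \<in> Y" for y y' e t
      using that by (auto simp: p_def Dh_def Y_def)
  qed (use p_monic G in auto)
  then obtain G' where G': "G' \<subseteq> polyfun" "\<And>e. (\<forall>g\<in>G'. g e = 0) \<longleftrightarrow>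
    (\<exists>t. (\<forall>y\<in>Y. poly (p y e) (t y) = 0) \<and> (\<forall>g\<in>G. g (\<lambda>z. if z \<in> Y then t z else e z) = 0))"
    by (elim exE conjE) simp
  \<comment> \<open>The values 0 at the unknowns are placeholders, overwritten by \<open>t\<close>
    on \<open>Y\<close>.\<close>
  define ex where "ex = (\<lambda>(e :: 'n \<Rightarrow> complex) (y :: 'n + nat \<times> nat). case y of Inl x \<Rightarrow> e x | Inr _ \<Rightarrow> 0)"
  have ex_polyfun: "(\<lambda>e. ex e y) \<in> polyfun" for y
    by (cases y) (auto simp: ex_def intro: polyfun.intros)
  have Dh_ex: "Dh (\<lambda>z. if z \<in> Y then t z else ex e z) = D e" for t e
  proof -
    have "(\<lambda>x. if Inl x \<in> Y then t (Inl x) else ex e (Inl x)) = e"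
      by (auto simp: Y_def ex_def)
    then show ?thesis by (simp add: Dh_def)
  qed
  define G2 where "G2 = (\<lambda>g e. g (ex e)) ` G'"
  have "G2 \<subseteq> polyfun"
    unfolding G2_def
  proof (intro image_subsetI)
    fix g assume "g \<in> G'"
    then have "g \<in> polyfun" using G'(1) by blast
    then show "(\<lambda>e. g (ex e)) \<in> polyfun" by (rule polyfun_subst[OF _ ex_polyfun])
  qed
  moreover have "(\<forall>g\<in>G2. g e = 0) \<longleftrightarrow>
      (\<exists>A B. lead_coeff A = 1 \<and> lead_coeff B = 1 \<and> degree A = r \<and> degree B = m - r \<and> A * B = D e)" for e
  proof
    assume "\<forall>g\<in>G2. g e = 0"
    then have "\<forall>g\<in>G'. g (ex e) = 0" by (simp add: G2_def)
    then have "\<exists>t. \<forall>g\<in>G. g (\<lambda>z. if z \<in> Y then t z else ex e z) = 0"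
      unfolding G'(2) by (elim exE conjE) (rule exI)
    then obtain t where "\<forall>g\<in>G. g (\<lambda>z. if z \<in> Y then t z else ex e z) = 0"
      by (elim exE)
    then have "F {..<r} (\<lambda>z. if z \<in> Y then t z else ex e z) * F {r..<m} (\<lambda>z. if z \<in> Y then t z else ex e z) = D e"
      unfolding G_iff Dh_ex by simp
    then show "\<exists>A B. lead_coeff A = 1 \<and> lead_coeff B = 1 \<and> degree A = r \<and> degree B = m - r \<and> A * B = D e"
      using conjunct2[OF F_monic[of "{..<r}"]] conjunct2[OF F_monic[of "{r..<m}"]]
        conjunct1[OF F_monic[of "{..<r}"]] conjunct1[OF F_monic[of "{r..<m}"]]
      by (intro exI conjI; (assumption | simp))
  next
    assume "\<exists>A B. lead_coeff A = 1 \<and> lead_coeff B = 1 \<and> degree A = r \<and> degree B = m - r \<and> A * B = D e"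
    then obtain A B where AB: "lead_coeff A = 1" "lead_coeff B = 1" "degree A = r" "degree B = m - r" "A * B = D e"
      by blast
    have int_box: "a \<in> int_box s" if "(a, j) \<in> mons (A * B)" for a j
      using that s M(2)[of e] unfolding AB(5) by force
    have "x \<in> int_box s" if "(x, k) \<in> mons A" for x k
      using monic_factor_in_box[OF AB(1,2) _ that] int_box by blast
    moreover have "x \<in> int_box s" if "(x, k) \<in> mons B" for x k
      using monic_factor_in_box[OF AB(2,1) _ that] int_box unfolding mult.commute[of B] by blast
    ultimately have keys: "Poly_Mapping.keys (coeff A j) \<subseteq> K" "Poly_Mapping.keys (coeff B j) \<subseteq> K" for j
      by (auto simp: K_def mons_def in_keys_iff)
    have "\<forall>k. \<exists>t. E k A = (\<Prod>i<r. [:- t i, 1:])"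
      using monic_complex_poly_roots[OF E_monic(2)[OF AB(1)]] E_monic(1)[OF AB(1)] AB(3) by metis
    then obtain tA where tA: "\<And>k. E k A = (\<Prod>i<r. [:- tA k i, 1:])" by metis
    have "\<forall>k. \<exists>t. E k B = (\<Prod>i<m - r. [:- t i, 1:])"
      using monic_complex_poly_roots[OF E_monic(2)[OF AB(2)]] E_monic(1)[OF AB(2)] AB(4) by metis
    then obtain tB where tB: "\<And>k. E k B = (\<Prod>i<m - r. [:- tB k i, 1:])" by metis
    \<comment> \<open>The roots of \<open>A\<close> get the numbers below \<open>r\<close>, those of
      \<open>B\<close> the numbers from \<open>r\<close> on.\<close>
    define t where "t = (\<lambda>y :: 'n + nat \<times> nat. case projr y of (k, i) \<Rightarrow> if i < r then tA k i else tB k (i - r))"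
    have EA: "E k A = (\<Prod>i<r. [:- t (Inr (k, i)), 1:])" for k
      by (simp add: tA t_def)
    have EB: "E k B = (\<Prod>i\<in>{r..<m}. [:- t (Inr (k, i)), 1:])" for k
      unfolding tB
        by (rule prod.reindex_bij_witness[of _ "\<lambda>i. i - r" "\<lambda>i. i + r"]) (use r in \<open>auto simp: t_def\<close>)
    have roots: "poly (p y (ex e)) (t y) = 0" if yY: "y \<in> Y" for y
    proof -
      obtain k i where y: "y = Inr (k, i)" "i < m" using yY by (auto simp: Y_def)
      have "p y (ex e) = E k A * E k B"
        using AB(5) by (simp add: p_def y Dh_def ex_def E_mult[symmetric])
      then show ?thesis
        using y by (cases "i < r") (auto simp: EA EB poly_prod)
    qed
    define e' where "e' = (\<lambda>z. if z \<in> Y then t z else ex e z)"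
    have e': "e' (Inr (k, i)) = t (Inr (k, i))" if "k < n" "i < m" for k i
      using that by (auto simp: e'_def Y_def)
    have "F {..<r} e' = (\<Sum>k<n. [:q k:] * cpoly (E k A))"
      unfolding F_eq EA using r
        by (intro sum.cong refl arg_cong2[of _ _ _ _ "(*)"] arg_cong[of _ _ cpoly] prod.cong) (auto simp: e')
    then have FA: "F {..<r} e' = A" using recover keys by simp
    have "F {r..<m} e' = (\<Sum>k<n. [:q k:] * cpoly (E k B))"
      unfolding F_eq EB
        by (intro sum.cong refl arg_cong2[of _ _ _ _ "(*)"] arg_cong[of _ _ cpoly] prod.cong) (auto simp: e')
    then have FB: "F {r..<m} e' = B" using recover keys by simp
    have "Dh e' = D e" unfolding e'_def by (rule Dh_ex)
    then have "\<forall>g\<in>G. g e' = 0" unfolding G_iff FA FB by (simp add: AB(5))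
    then have "\<forall>g\<in>G'. g (ex e) = 0" unfolding G'(2) using roots
      by (intro exI[of _ t]) (simp add: e'_def)
    then show "\<forall>g\<in>G2. g e = 0" by (simp add: G2_def)
  qed
  ultimately show ?thesis by blast
qed

text \<open>For each degree \<open>r\<close> of a possible factor some polynomial function excludes
  that splitting and is nonzero at \<open>e0\<close>; the product of these functions excludes all
  splittings.\<close>

theorem irreducible_open:
  fixes D :: "('n \<Rightarrow> complex) \<Rightarrow> 'd::finite laurent poly"
  assumes D: "D \<in> polyfam" and deg: "\<And>e. degree (D e) = m" and monic: "\<And>e. lead_coeff (D e) = 1"
    and m: "1 \<le> m" and irr: "irreducible (D e0)"
  obtains g where "g \<in> polyfun" "g e0 \<noteq> 0" "\<forall>e. g e \<noteq> 0 \<longrightarrow> irreducible (D e)"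
proof -
  have "\<exists>g\<in>polyfun. g e0 \<noteq> 0 \<and> (\<forall>e. g e \<noteq> 0 \<longrightarrow> \<not> (\<exists>A B. lead_coeff A = 1 \<and> lead_coeff B = 1 \<and>
      degree A = r \<and> degree B = m - r \<and> A * B = D e))" if r: "r \<in> {1..<m}" for r
  proof -
    obtain G where G: "G \<subseteq> polyfun" "\<And>e. (\<forall>g\<in>G. g e = 0) \<longleftrightarrow>
      (\<exists>A B. lead_coeff A = 1 \<and> lead_coeff B = 1 \<and> degree A = r \<and> degree B = m - r \<and> A * B = D e)"
    proof -
      have "r \<le> m" using r by simp
      from factor_degrees_closed[OF D deg monic this] show thesis using that
        by (elim exE conjE) simp
    qed
    have "\<not> (\<exists>A B. lead_coeff A = 1 \<and> lead_coeff B = 1 \<and> degree A = r \<and> degree B = m - r \<and> A * B = D e0)"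
    proof
      assume "\<exists>A B. lead_coeff A = 1 \<and> lead_coeff B = 1 \<and> degree A = r \<and> degree B = m - r \<and> A * B = D e0"
      then obtain A B where AB: "degree A = r" "degree B = m - r" "A * B = D e0" by blast
      then have "1 \<le> degree A" "1 \<le> degree B" using r by auto
      then show False using monic_mult_not_irreducible(1)[of A B] AB(3) irr by simp
    qed
    then obtain g where "g \<in> G" "g e0 \<noteq> 0" using G(2)[of e0] by blast
    then show ?thesis using G by blast
  qed
  then obtain g where g: "\<And>r. r \<in> {1..<m} \<Longrightarrow> g r \<in> polyfun \<and> g r e0 \<noteq> 0 \<and>
      (\<forall>e. g r e \<noteq> 0 \<longrightarrow> \<not> (\<exists>A B. lead_coeff A = 1 \<and> lead_coeff B = 1 \<and>
      degree A = r \<and> degree B = m - r \<and> A * B = D e))" by metis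
  show thesis
  proof (rule that[of "\<lambda>e. \<Prod>r\<in>{1..<m}. g r e"])
    show "(\<lambda>e. \<Prod>r\<in>{1..<m}. g r e) \<in> polyfun" using g
      by (intro polyfun_prod) blast
    show "(\<Prod>r\<in>{1..<m}. g r e0) \<noteq> 0" using g by simp
    have "irreducible (D e)" if nz: "(\<Prod>r\<in>{1..<m}. g r e) \<noteq> 0" for e
    proof (rule ccontr)
      assume red: "\<not> irreducible (D e)"
      have "1 \<le> degree (D e)" using deg m by simp
      then obtain A B where AB: "D e = A * B" "lead_coeff A = 1" "lead_coeff B = 1" "1 \<le> degree A" "1 \<le> degree B"
        by (rule not_irreducible_monic_factors[OF monic _ red])
      have "A \<noteq> 0" "B \<noteq> 0" using AB by auto
      then have "degree A + degree B = m" using laurent_poly_degree_mult[of A B] AB(1) deg[of e]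
        by simp
      then have "degree A \<in> {1..<m}" "degree B = m - degree A" using AB by auto
      moreover from this have "g (degree A) e \<noteq> 0" using nz by simp
      ultimately show False using g AB by metis
    qed
    then show "\<forall>e. (\<Prod>r\<in>{1..<m}. g r e) \<noteq> 0 \<longrightarrow> irreducible (D e)" by blast
  qed
qed

section \<open>Zariski open sets\<close>

lemma polyfun_line:
  assumes "f \<in> polyfun"
  shows "\<exists>P. \<forall>t. f (\<lambda>x. a x + t * b x) = poly P t"
  using assms
proof induction
  case (polyfun_const c)
  show ?case by (intro exI[of _ "[:c:]"]) simp
  next
  case (polyfun_var x)
  show ?case by (intro exI[of _ "[:a x, b x:]"]) simp
  next
  case (polyfun_add f g)
  then obtain P Q where "\<forall>t. f (\<lambda>x. a x + t * b x) = poly P t" "\<forall>t. g (\<lambda>x. a x + t * b x) = poly Q t" by blast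
  then show ?case by (intro exI[of _ "P + Q"]) simp
  next
  case (polyfun_mult f g)
  then obtain P Q where "\<forall>t. f (\<lambda>x. a x + t * b x) = poly P t" "\<forall>t. g (\<lambda>x. a x + t * b x) = poly Q t" by blast
  then show ?case by (intro exI[of _ "P * Q"]) simp
qed

text \<open>On the line through \<open>e1\<close> and \<open>e2\<close> both functions are nonzero
  polynomials in one variable, and so is their product.\<close>

lemma polyfun_common_nonzero:
  assumes "f \<in> polyfun" "g \<in> polyfun" "f e1 \<noteq> 0" "g e2 \<noteq> 0"
  obtains e where "f e \<noteq> 0" "g e \<noteq> 0"
proof -
  obtain P where P: "\<And>t. f (\<lambda>x. e1 x + t * (e2 x - e1 x)) = poly P t" 
    using polyfun_line[OF assms(1), of e1 "\<lambda>x. e2 x - e1 x"] by (elim exE) simp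
  obtain Q where Q: "\<And>t. g (\<lambda>x. e1 x + t * (e2 x - e1 x)) = poly Q t" 
    using polyfun_line[OF assms(2), of e1 "\<lambda>x. e2 x - e1 x"] by (elim exE) simp
  have "poly P 0 \<noteq> 0" "poly Q 1 \<noteq> 0" using P[of 0] Q[of 1] assms by auto
  then have "P * Q \<noteq> 0" by auto
  then obtain t where "poly (P * Q) t \<noteq> 0" by (metis poly_all_0_iff_0)
  then show thesis using that[of "\<lambda>x. e1 x + t * (e2 x - e1 x)"] P Q by simp
qed

lemma mpoly_eval_superset:
  assumes "finite S" "Poly_Mapping.keys p \<subseteq> S"
  shows "mpoly_eval p V = (\<Sum>m\<in>S. Poly_Mapping.lookup p m * (\<Prod>i\<in>UNIV. (V $ i) ^ Poly_Mapping.lookup m i))"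
  unfolding mpoly_eval_def
    by (rule sum.mono_neutral_left) (use assms in \<open>auto simp: in_keys_iff\<close>)

lemma mpoly_eval_add: "mpoly_eval (p + q) V = mpoly_eval p V + mpoly_eval q V"
proof -
  let ?S = "Poly_Mapping.keys p \<union> Poly_Mapping.keys q"
  have "Poly_Mapping.keys (p + q) \<subseteq> ?S" by (rule keys_add)
  then show ?thesis
    by (simp add: mpoly_eval_superset[of ?S] lookup_add algebra_simps sum.distrib)
qed

lemma mpoly_eval_single:
  "mpoly_eval (Poly_Mapping.single m c) V = c * (\<Prod>i\<in>UNIV. (V $ i) ^ Poly_Mapping.lookup m i)"
  by (subst mpoly_eval_superset[of "{m}"]) auto

lemma mpoly_eval_single_mult:
  "mpoly_eval (Poly_Mapping.single m c * q) V = mpoly_eval (Poly_Mapping.single m c) V * mpoly_eval q V"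
proof (induction q rule: Poly_Mapping.update_induct)
  case const
  then show ?case by (simp add: mpoly_eval_def)
next
  case (update q k v)
  have "Poly_Mapping.update k v q = q + Poly_Mapping.single k v"
    using update
      by (intro poly_mapping_eqI) (auto simp: lookup_update lookup_add lookup_single when_def in_keys_iff)
  then show ?case using update
    by (simp add: distrib_left mpoly_eval_add mult_single mpoly_eval_single lookup_add power_add prod.distrib)
qed

lemma mpoly_eval_mult: "mpoly_eval (p * q) V = mpoly_eval p V * mpoly_eval q V"
proof (induction p rule: Poly_Mapping.update_induct)
  case const
  then show ?case by (simp add: mpoly_eval_def)
next
  case (update p k v)
  have "Poly_Mapping.update k v p = p + Poly_Mapping.single k v"
    using update
      by (intro poly_mapping_eqI) (auto simp: lookup_update lookup_add lookup_single when_def in_keys_iff)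
  then show ?case using update
    by (simp add: distrib_right mpoly_eval_add mpoly_eval_single_mult)
qed

lemma polyfun_mpoly:
  assumes "f \<in> polyfun" obtains p where "\<And>V. f (\<lambda>i. V $ i) = mpoly_eval p V"
proof -
  have "\<exists>p. \<forall>V. f (\<lambda>i. V $ i) = mpoly_eval p V" using assms
  proof induction
    case (polyfun_const c)
    show ?case by (intro exI[of _ "Poly_Mapping.single 0 c"]) (simp add: mpoly_eval_single)
  next
    case (polyfun_var x)
    have "(\<Prod>i\<in>UNIV. (V $ i) ^ Poly_Mapping.lookup (Poly_Mapping.single x 1) i) = V $ x" for V :: "complex ^ 'a"
    proof -
      have "(\<Prod>i\<in>UNIV. (V $ i) ^ Poly_Mapping.lookup (Poly_Mapping.single x 1) i) = (\<Prod>i\<in>UNIV. if i = x then V $ i else 1)"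
        by (intro prod.cong) (auto simp: lookup_single when_def)
      then show ?thesis by simp
    qed
    then show ?case
      by (intro exI[of _ "Poly_Mapping.single (Poly_Mapping.single x 1) 1"]) (simp add: mpoly_eval_single)
  next
    case (polyfun_add f g)
    then show ?case by (metis mpoly_eval_add)
  next
    case (polyfun_mult f g)
    then show ?case by (metis mpoly_eval_mult)
  qed
  then show thesis using that by blast
qed

lemma holds_generically_polyfun:
  assumes "g \<in> polyfun" "g e0 \<noteq> 0" "\<And>V. g (\<lambda>i. V $ i) \<noteq> 0 \<Longrightarrow> P V"
  shows "holds_generically P"
proof -
  obtain p where p: "\<And>V. g (\<lambda>i. V $ i) = mpoly_eval p V"
    using polyfun_mpoly[OF assms(1)] by blast
  define U where "U = {V. mpoly_eval p V \<noteq> 0}"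
  have "- U = {V. \<forall>p\<in>{p}. mpoly_eval p V = 0}" by (auto simp: U_def)
  then have "zariski_open U" unfolding zariski_open_def zariski_closed_def by blast
  moreover have "(\<chi> i. e0 i) \<in> U" using assms(2) p[of "\<chi> i. e0 i"]
    by (simp add: U_def)
  moreover have "\<forall>V\<in>U. P V" using assms(3) p by (simp add: U_def)
  ultimately show ?thesis unfolding holds_generically_def by blast
qed

subsection \<open>Characteristic polynomials of principal submatrices\<close>

text \<open>Permutations of \<open>T\<close> fix all other indices, so Leibniz terms over
  \<open>T\<close> describe principal submatrices without a change of index type.\<close>

definition perm_term :: "'n set \<Rightarrow> ('n \<Rightarrow> 'n \<Rightarrow> 'a::comm_ring_1) \<Rightarrow> ('n \<Rightarrow> 'n) \<Rightarrow> 'a" where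
  "perm_term T M p = of_int (sign p) * (\<Prod>i\<in>T. M i (p i))"

definition charmat :: "('n \<Rightarrow> 'n \<Rightarrow> 'd::finite laurent) \<Rightarrow> ('n \<Rightarrow> complex) \<Rightarrow> 'n \<Rightarrow> 'n \<Rightarrow> 'd laurent poly" where
  "charmat l V i j = (if i = j then [:- lconst (V i) - l i i, 1:] else [:- l i j:])"

definition charpol :: "('n \<Rightarrow> 'n \<Rightarrow> 'd::finite laurent) \<Rightarrow> 'n set \<Rightarrow> ('n \<Rightarrow> complex) \<Rightarrow> 'd laurent poly" where
  "charpol l T V = (\<Sum>p | p permutes T. perm_term T (charmat l V) p)"

text \<open>The part of the determinant on \<open>insert k T\<close> that avoids the diagonal entry
  of \<open>k\<close> and hence the potential at \<open>k\<close>.\<close>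

definition offdiag :: "('n \<Rightarrow> 'n \<Rightarrow> 'd::finite laurent) \<Rightarrow> 'n \<Rightarrow> 'n set \<Rightarrow> ('n \<Rightarrow> complex) \<Rightarrow> 'd laurent poly" where
  "offdiag l k T V = (\<Sum>p | p permutes insert k T \<and> p k \<noteq> k. perm_term (insert k T) (charmat l V) p)"

lemma permutes_insert_fixed: "k \<notin> T \<Longrightarrow> p permutes insert k T \<and> p k = k \<longleftrightarrow> p permutes T"
  by (auto simp: permutes_not_in intro: permutes_superset permutes_subset)

lemma perm_term_insert:
  "finite T \<Longrightarrow> k \<notin> T \<Longrightarrow> p k = k \<Longrightarrow> perm_term (insert k T) M p = M k k * perm_term T M p"
  by (simp add: perm_term_def mult_ac)

lemma perm_term_cong:
  "(\<And>i. i \<in> T \<Longrightarrow> M i (p i) = M' i (p i)) \<Longrightarrow> perm_term T M p = perm_term T M' p"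
  by (simp add: perm_term_def)

text \<open>Permutations are sorted by whether they fix \<open>k\<close>. The potential at
  \<open>k\<close> occurs only in \<open>charmat l V k k\<close>, so the determinant is affine in
  it.\<close>

lemma charpol_insert:
  assumes "finite T" "k \<notin> T"
  shows "charpol l (insert k T) V = charmat l V k k * charpol l T V + offdiag l k T V"
proof -
  have "{p. p permutes insert k T} = {p. p permutes T} \<union> {p. p permutes insert k T \<and> p k \<noteq> k}"
    using permutes_insert_fixed[OF assms(2)] by blast
  then have "charpol l (insert k T) V = (\<Sum>p | p permutes T. perm_term (insert k T) (charmat l V) p) + offdiag l k T V"
    unfolding charpol_def offdiag_def
    using assms permutes_insert_fixed[OF assms(2)]
    by (simp only:) (intro sum.union_disjoint finite_permutations finite_subset[OF _ finite_permutations[of "insert k T"]], auto)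
  also have "(\<Sum>p | p permutes T. perm_term (insert k T) (charmat l V) p) = charmat l V k k * charpol l T V"
    unfolding charpol_def sum_distrib_left
    using assms by (intro sum.cong) (auto simp: permutes_not_in intro!: perm_term_insert)
  finally show ?thesis .
qed

text \<open>The same sorting for \<open>j\<close> isolates the dependence on the potential at
  \<open>j\<close>.\<close>

lemma offdiag_insert:
  assumes "finite T" "j \<notin> T" "j \<noteq> k"
  shows "offdiag l k (insert j T) V = charmat l V j j * offdiag l k T V +
    (\<Sum>p | p permutes insert k (insert j T) \<and> p k \<noteq> k \<and> p j \<noteq> j. perm_term (insert k (insert j T)) (charmat l V) p)"
    (is "_ = _ + ?R")
proof -
  have ins: "insert k (insert j T) = insert j (insert k T)" by auto
  have j: "j \<notin> insert k T" using assms by auto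
  have "{p. p permutes insert k (insert j T) \<and> p k \<noteq> k}
      = {p. p permutes insert k T \<and> p k \<noteq> k} \<union> {p. p permutes insert k (insert j T) \<and> p k \<noteq> k \<and> p j \<noteq> j}"
    unfolding ins using permutes_insert_fixed[OF j] by blast
  then have "offdiag l k (insert j T) V
      = (\<Sum>p | p permutes insert k T \<and> p k \<noteq> k. perm_term (insert k (insert j T)) (charmat l V) p) + ?R"
    unfolding offdiag_def
    using assms permutes_insert_fixed[OF j]
    by (simp only:) (intro sum.union_disjoint finite_subset[OF _ finite_permutations[of "insert k (insert j T)"]],
        auto intro: permutes_subset)
  also have "(\<Sum>p | p permutes insert k T \<and> p k \<noteq> k. perm_term (insert k (insert j T)) (charmat l V) p)
      = charmat l V j j * offdiag l k T V"
    unfolding offdiag_def sum_distrib_left ins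
    using assms j by (intro sum.cong refl) (auto simp: permutes_not_in intro!: perm_term_insert)
  finally show ?thesis .
qed

lemma charpol_upd: "k \<notin> T \<Longrightarrow> charpol l T (V(k := v)) = charpol l T V"
  unfolding charpol_def by (intro sum.cong refl perm_term_cong) (auto simp: charmat_def)

lemma offdiag_upd: "offdiag l k T (V(k := v)) = offdiag l k T V"
  unfolding offdiag_def by (intro sum.cong refl perm_term_cong) (auto simp: charmat_def)

lemma degree_perm_term:
  fixes l :: "'n \<Rightarrow> 'n \<Rightarrow> 'd::finite laurent"
  assumes "finite T"
  shows "degree (perm_term T (charmat l V) p) \<le> card {i \<in> T. p i = i}"
proof -
  have "degree (of_int (sign p) :: 'd laurent poly) = 0" by (simp add: of_int_poly)
  then have "degree (perm_term T (charmat l V) p) \<le> degree (\<Prod>i\<in>T. charmat l V i (p i))"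
    unfolding perm_term_def
      using degree_mult_le[of "of_int (sign p)" "\<Prod>i\<in>T. charmat l V i (p i)"] by simp
  also have "\<dots> \<le> (\<Sum>i\<in>T. degree (charmat l V i (p i)))"
    using degree_prod_sum_le[OF assms, of "\<lambda>i. charmat l V i (p i)"] by (simp add: o_def)
  also have "\<dots> \<le> (\<Sum>i\<in>T. if p i = i then 1 else 0)"
    by (intro sum_mono) (auto simp: charmat_def)
  also have "\<dots> = card {i \<in> T. p i = i}" using assms by (simp add: sum.If_cases Int_def)
  finally show ?thesis .
qed

text \<open>A permutation that moves \<open>k\<close> also moves \<open>p k\<close>, and only fixed
  indices contribute an entry with the spectral parameter.\<close>

lemma degree_offdiag:
  assumes T: "finite T" "k \<notin> T" "T \<noteq> {}"
  shows "degree (offdiag l k T V) < card T"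
proof -
  have "degree (perm_term (insert k T) (charmat l V) p) \<le> card T - 1"
    if p: "p permutes insert k T" "p k \<noteq> k" for p
  proof -
    have pk: "p k \<in> insert k T" using permutes_in_image[OF p(1), of k] by auto
    have "p (p k) \<noteq> p k" using p by (metis permutes_inj injD)
    then have "{i \<in> insert k T. p i = i} \<subseteq> insert k T - {k, p k}" using p by auto
    then have "card {i \<in> insert k T. p i = i} \<le> card (insert k T - {k, p k})"
      using T by (intro card_mono) auto
    also have "\<dots> = card T - 1" using T pk p(2) by (subst card_Diff_subset) auto
    finally show ?thesis using degree_perm_term[of "insert k T" l V p] T by simp
  qed
  then have "degree (offdiag l k T V) \<le> card T - 1"
    unfolding offdiag_def using T
      by (intro degree_sum_le finite_subset[OF _ finite_permutations[of "insert k T"]]) auto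
  then show ?thesis using T by (metis card_gt_0_iff diff_less le_less_trans less_numeral_extra(1))
qed

lemma offdiag_empty: "offdiag l k {} V = 0"
proof -
  have "{p. p permutes {k} \<and> p k \<noteq> k} = {}" by auto
  then show ?thesis by (simp only: offdiag_def sum.empty)
qed

lemma charpol_monic:
  assumes "finite T"
  shows "degree (charpol l T V) = card T \<and> lead_coeff (charpol l T V) = 1"
  using assms
proof (induction T)
  case empty
  then show ?case by (simp add: charpol_def perm_term_def)
next
  case (insert k T)
  let ?M = "charmat l V k k" and ?C = "charpol l T V"
  have M: "degree ?M = 1" "coeff ?M 1 = 1" by (simp_all add: charmat_def)
  have off: "degree (offdiag l k T V) < Suc (card T)"
    using degree_offdiag[of T k l V] offdiag_empty insert
      by (cases "T = {}") (auto simp: offdiag_empty)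
  have C0: "?C \<noteq> 0" using insert.IH by auto
  have "degree (?M * ?C) = Suc (card T)"
    using laurent_poly_degree_mult[of ?M ?C] C0 M insert.IH by (auto simp: charmat_def)
  then have deg: "degree (charpol l (insert k T) V) = Suc (card T)"
    unfolding charpol_insert[OF insert.hyps] using off by (simp add: degree_add_eq_left)
  moreover have "lead_coeff ?M = 1" by (simp add: charmat_def)
  then have "lead_coeff (?M * ?C) = 1"
    by (simp only: laurent_poly_lead_coeff_mult conjunct2[OF insert.IH] mult_1)
  then have "coeff (charpol l (insert k T) V) (Suc (card T)) = 1"
    unfolding charpol_insert[OF insert.hyps]
      using off \<open>degree (?M * ?C) = Suc (card T)\<close>
    by (simp add: coeff_eq_0)
  ultimately show ?case using insert.hyps by simp
qed

lemma charmat_polyfam: "(\<lambda>V. charmat l V i j) \<in> polyfam"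
proof -
  have "[:- lconst (V i) - l i i, 1:] = [:- l i i, 1:] - [:lconst (V i):]" for V by simp
  then show ?thesis
    unfolding charmat_def
    by (cases "i = j") (auto simp only: if_True if_False simp_thms intro!: polyfam_diff polyfam_const polyfam_lconst polyfun_var)
qed

lemma charpol_polyfam: "(\<lambda>V. charpol l T V) \<in> polyfam"
  unfolding charpol_def perm_term_def
  by (intro polyfam_sum polyfam_mult polyfam_prod polyfam_const charmat_polyfam)

lemma offdiag_polyfam: "(\<lambda>V. offdiag l k T V) \<in> polyfam"
  unfolding offdiag_def perm_term_def
  by (intro polyfam_sum polyfam_mult polyfam_prod polyfam_const charmat_polyfam)

section \<open>Translation of the spectral parameter\<close>

text \<open>The automorphism sending the spectral parameter \<open>x\<close> to
  \<open>x + r\<close>, where \<open>r\<close> may involve z. It respects units, hence also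
  irreducibility and reducibility.\<close>

definition shift_poly :: "'a::comm_ring_1 \<Rightarrow> 'a poly \<Rightarrow> 'a poly" where
  "shift_poly r P = pcompose P [:r, 1:]"

lemma shift_poly_simps [simp]:
  "shift_poly r 0 = 0" "shift_poly r 1 = 1" "shift_poly r (P * Q) = shift_poly r P * shift_poly r Q"
  "shift_poly r [:a:] = [:a:]" "shift_poly r (pCons a 1) = pCons (a + r) 1"
  "shift_poly r (of_int k) = of_int k"
  by (simp_all add: shift_poly_def pcompose_mult pcompose_pCons pcompose_1 add.commute of_int_poly)

lemma shift_poly_sum: "shift_poly r (\<Sum>i\<in>I. f i) = (\<Sum>i\<in>I. shift_poly r (f i))"
  by (simp add: shift_poly_def pcompose_sum)

lemma shift_poly_prod: "shift_poly r (\<Prod>i\<in>I. f i) = (\<Prod>i\<in>I. shift_poly r (f i))"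
  by (simp add: shift_poly_def pcompose_prod)

lemma shift_poly_inverse: "shift_poly (- r) (shift_poly r P) = P"
proof -
  have "shift_poly (- r) (shift_poly r P) = pcompose P (pcompose [:r, 1:] [:- r, 1:])"
    unfolding shift_poly_def by (rule pcompose_assoc[symmetric])
  also have "pcompose [:r, 1:] [:- r, 1:] = [:0, 1:]" by (simp add: pcompose_pCons)
  finally show ?thesis by (simp only: pcompose_idR)
qed

lemma shift_poly_dvd_1: "shift_poly r P dvd 1 \<longleftrightarrow> P dvd 1"
proof -
  have *: "shift_poly r P dvd 1" if P: "P dvd 1" for r :: 'a and P
  proof -
    obtain Q where "1 = P * Q" using P by (elim dvdE)
    then have "1 = shift_poly r P * shift_poly r Q" by (metis shift_poly_simps(2,3))
    then show ?thesis by (rule dvdI)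
  qed
  then show ?thesis using *[of "shift_poly r P" "- r"] by (auto simp: shift_poly_inverse)
qed

lemma shift_poly_eq_0: "shift_poly r P = 0 \<longleftrightarrow> P = 0"
  by (metis shift_poly_inverse shift_poly_simps(1))

lemma shift_poly_eq_mult:
  "shift_poly r P = A * B \<longleftrightarrow> P = shift_poly (- r) A * shift_poly (- r) B"
  by (metis add.inverse_inverse shift_poly_inverse shift_poly_simps(3))

lemma shift_poly_irreducible_iff: "irreducible (shift_poly r P) \<longleftrightarrow> irreducible P"
proof -
  have *: "irreducible (shift_poly r P)" if "irreducible P" for r :: 'a and P
    using that unfolding irreducible_def
      by (metis shift_poly_dvd_1 shift_poly_eq_0 shift_poly_eq_mult)
  then show ?thesis using *[of "shift_poly r P" "- r"] by (auto simp: shift_poly_inverse)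
qed

lemma shift_poly_reducible: "reducible (shift_poly r P) \<Longrightarrow> reducible P"
  unfolding reducible_def by (metis shift_poly_dvd_1 shift_poly_eq_0 shift_poly_eq_mult)

definition sub_diag :: "('n \<Rightarrow> 'n \<Rightarrow> 'a::comm_ring_1) \<Rightarrow> 'a \<Rightarrow> 'n \<Rightarrow> 'n \<Rightarrow> 'a" where
  "sub_diag l r i j = l i j - (if i = j then r else 0)"

lemma shift_charmat: "shift_poly r (charmat l V i j) = charmat (sub_diag l r) V i j"
  by (simp add: charmat_def sub_diag_def algebra_simps)

lemma shift_perm_term: "shift_poly r (perm_term T (charmat l V) p) = perm_term T (charmat (sub_diag l r) V) p"
  by (simp add: perm_term_def shift_poly_prod shift_charmat)

lemma shift_charpol: "shift_poly r (charpol l T V) = charpol (sub_diag l r) T V"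
  by (simp add: charpol_def shift_poly_sum shift_perm_term)

lemma shift_offdiag: "shift_poly r (offdiag l k T V) = offdiag (sub_diag l r) k T V"
  by (simp add: offdiag_def shift_poly_sum shift_perm_term)

section \<open>Adding vertices to an irreducible block\<close>

text \<open>After translation by \<open>l k k\<close> the new diagonal entry is
  \<open>x - v\<close>, so the determinants for varying \<open>v\<close> form the pencil of
  \<open>irreducible_pencil\<close>, whose conclusion is the exceptional case.\<close>

theorem charpol_add_vertex:
  fixes l :: "'n \<Rightarrow> 'n \<Rightarrow> 'd::finite laurent"
  assumes T: "finite T" "k \<notin> T" "T \<noteq> {}"
    and irr: "irreducible (charpol l T V)" and off: "offdiag l k T V \<noteq> 0"
    and red: "\<And>v. \<not> irreducible (charpol l (insert k T) (V(k := v)))"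
  shows "card T = 1 \<and> charpol (sub_diag l (l k k)) T V \<in> range cpoly \<and>
    offdiag (sub_diag l (l k k)) k T V \<in> range cpoly"
proof -
  define l' where "l' = sub_diag l (l k k)"
  let ?D = "charpol l' T V" and ?Q = "- offdiag l' k T V"
  have irr': "irreducible ?D"
    using irr unfolding l'_def shift_charpol[symmetric] shift_poly_irreducible_iff .
  have mon: "degree ?D = card T" "lead_coeff ?D = 1" using charpol_monic[OF T(1)] by auto
  have "offdiag l' k T V \<noteq> 0"
    using off unfolding l'_def shift_offdiag[symmetric] shift_poly_eq_0 .
  then have Q: "?Q \<noteq> 0" by simp
  have degQ: "degree ?Q < degree ?D" using degree_offdiag[OF T] mon by simp
  have red': "\<not> irreducible (pCons 0 ?D - ?Q - smult (lconst v) ?D)" for v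
  proof -
    have "charpol l' (insert k T) (V(k := v)) = pCons 0 ?D - ?Q - smult (lconst v) ?D"
      unfolding charpol_insert[OF T(1,2)] charpol_upd[OF T(2)] offdiag_upd
      by (simp add: charmat_def l'_def sub_diag_def)
    then show ?thesis
      using red[of v] shift_poly_irreducible_iff[of "l k k" "charpol l (insert k T) (V(k := v))"]
      by (simp only: shift_charpol l'_def not_False_eq_True)
  qed
  \<comment> \<open>The natural numbers serve as the sequence of potentials tending to
    infinity.\<close>
  from irreducible_pencil[OF irr' mon(2) Q degQ tendsto_of_nat red']
  have *: "degree ?D = 1" "?D \<in> range cpoly" "?Q \<in> range cpoly" by auto
  then have "offdiag l' k T V \<in> range cpoly" unfolding cpoly_range_iff by simp
  then show ?thesis using * mon by (simp add: l'_def)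
qed

lemma offdiag_pair:
  assumes "i \<noteq> k"
  shows "offdiag l k {i} V = [:- (l k i * l i k):]"
proof -
  have eq: "p = Transposition.transpose k i" if p: "p permutes {k, i}" "p k \<noteq> k" for p
  proof -
    have pk: "p k = i" using p permutes_in_image[OF p(1), of k] by auto
    moreover have "p i = k"
      using permutes_in_image[OF p(1), of i] injD[OF permutes_inj[OF p(1)], of k i] pk assms by auto
    ultimately show ?thesis using p(1)
      by (auto simp: fun_eq_iff Transposition.transpose_def permutes_not_in)
  qed
  have "Transposition.transpose k i permutes {k, i}" by (rule permutes_swap_id) auto
  then have "Transposition.transpose k i \<in> {p. p permutes {k, i} \<and> p k \<noteq> k}"
    using assms by simp
  with eq have "{p. p permutes {k, i} \<and> p k \<noteq> k} = {Transposition.transpose k i}"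
    by (intro subset_antisym subsetI) (auto simp only: mem_Collect_eq insert_iff empty_iff)
  then show ?thesis using assms
    by (simp add: offdiag_def perm_term_def charmat_def sign_swap_id)
qed

text \<open>The off-diagonal part is affine in the potential at a further vertex \<open>j\<close>,
  with slope minus the off-diagonal part without \<open>j\<close>. Starting from the pair of
  \<open>k\<close> and \<open>i\<close>, one of the values 0 and 1 at each new \<open>j\<close>
  keeps it nonzero.\<close>

lemma ex_offdiag_nonzero:
  fixes l :: "'n \<Rightarrow> 'n \<Rightarrow> 'd::finite laurent"
  assumes "finite T" "k \<notin> T" "i \<in> T" "l k i \<noteq> 0" "l i k \<noteq> 0"
  shows "\<exists>V. offdiag l k T V \<noteq> 0"
proof -
  have "\<exists>V. offdiag l k (insert i S) V \<noteq> 0" if "finite S" "k \<notin> insert i S" "i \<notin> S" for S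
    using that
  proof (induction S)
    case empty
    then have "offdiag l k {i} V \<noteq> 0" for V using assms offdiag_pair[of i k l V] by auto
    then show ?case by blast
  next
    case (insert j S)
    then obtain V where V: "offdiag l k (insert i S) V \<noteq> 0" by auto
    have ij: "finite (insert i S)" "j \<notin> insert i S" "j \<noteq> k" using insert by auto
    let ?T = "insert j (insert i S)"
    have off: "offdiag l k ?T (V(j := v)) = [:- lconst v - l j j, 1:] * offdiag l k (insert i S) V +
        (\<Sum>p | p permutes insert k ?T \<and> p k \<noteq> k \<and> p j \<noteq> j. perm_term (insert k ?T) (charmat l V) p)" for v
    proof -
      have 1: "charmat l (V(j := v)) j j = [:- lconst v - l j j, 1:]" by (simp add: charmat_def)
      have 2: "offdiag l k (insert i S) (V(j := v)) = offdiag l k (insert i S) V"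
        unfolding offdiag_def using ij
          by (intro sum.cong refl perm_term_cong) (auto simp: charmat_def)
      have 3: "(\<Sum>p | p permutes insert k ?T \<and> p k \<noteq> k \<and> p j \<noteq> j. perm_term (insert k ?T) (charmat l (V(j := v))) p)
          = (\<Sum>p | p permutes insert k ?T \<and> p k \<noteq> k \<and> p j \<noteq> j. perm_term (insert k ?T) (charmat l V) p)"
        by (intro sum.cong refl perm_term_cong) (auto simp: charmat_def)
      show ?thesis unfolding offdiag_insert[OF ij] 1 2 3 ..
    qed
    have "offdiag l k ?T (V(j := 0)) - offdiag l k ?T (V(j := 1)) = offdiag l k (insert i S) V"
      unfolding off by (simp add: algebra_simps smult_diff_left)
    then have "offdiag l k ?T (V(j := 0)) \<noteq> 0 \<or> offdiag l k ?T (V(j := 1)) \<noteq> 0"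
      using V by auto
    then show ?case unfolding insert_commute[of i j] by blast
  qed
  from this[of "T - {i}"] show ?thesis using assms by (simp add: insert_absorb)
qed

text \<open>Irreducibility on \<open>T\<close> and a nonzero off-diagonal part are each ensured by a
  polynomial function being nonzero, so some \<open>V\<close> has both. A block of two or more
  vertices is never in the exceptional case of \<open>charpol_add_vertex\<close>.\<close>

theorem charpol_irreducible_extend:
  fixes l :: "'n::finite \<Rightarrow> 'n \<Rightarrow> 'd::finite laurent"
  assumes conn: "\<And>S. S \<noteq> {} \<Longrightarrow> S \<noteq> UNIV \<Longrightarrow> \<exists>k i. k \<notin> S \<and> i \<in> S \<and> l k i \<noteq> 0 \<and> l i k \<noteq> 0"
    and "2 \<le> card T" "\<exists>V. irreducible (charpol l T V)"
  shows "\<exists>V. irreducible (charpol l UNIV V)"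
  using assms(2,3)
proof (induction "card (- T)" arbitrary: T rule: less_induct)
  case less
  show ?case
  proof (cases "T = UNIV")
    case False
    have Tne: "T \<noteq> {}" using less.prems(1) by auto
    obtain k i where ki: "k \<notin> T" "i \<in> T" "l k i \<noteq> 0" "l i k \<noteq> 0"
      using conn[OF Tne False] by blast
    obtain V0 where V0: "irreducible (charpol l T V0)" using less.prems(2) by blast
    have "degree (charpol l T V) = card T" "lead_coeff (charpol l T V) = 1" for V
      using charpol_monic[of T l V] by auto
    moreover have "1 \<le> card T" using less.prems(1) by simp
    ultimately obtain g where g: "g \<in> polyfun" "g V0 \<noteq> 0" "\<forall>V. g V \<noteq> 0 \<longrightarrow> irreducible (charpol l T V)"
      by (rule irreducible_open[OF charpol_polyfam _ _ _ V0])
    obtain V1 where "offdiag l k T V1 \<noteq> 0" using ex_offdiag_nonzero[of T k i l] ki by auto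
    then obtain j a where ja: "mcoeff (offdiag l k T V1) j a \<noteq> 0"
      using poly_eqI_mcoeff[of "offdiag l k T V1" 0] by auto
    have "(\<lambda>V. mcoeff (offdiag l k T V) j a) \<in> polyfun"
      by (rule polyfam_mcoeff[OF offdiag_polyfam])
    then obtain V where V: "g V \<noteq> 0" "mcoeff (offdiag l k T V) j a \<noteq> 0"
      by (rule polyfun_common_nonzero[where f = g and g = "\<lambda>V. mcoeff (offdiag l k T V) j a", OF g(1) _ g(2) ja])
    have off: "offdiag l k T V \<noteq> 0"
    proof
      assume "offdiag l k T V = 0"
      with V(2) show False by simp
    qed
    have "\<exists>v. irreducible (charpol l (insert k T) (V(k := v)))"
    proof (rule ccontr)
      assume "\<not> ?thesis"
      then have "card T = 1"
        using charpol_add_vertex[of T k l V] ki(1) Tne g(3) V(1) off by auto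
      then show False using less.prems(1) by simp
    qed
    moreover have "card (- insert k T) < card (- T)" using ki(1) by (intro psubset_card_mono) auto
    moreover have "2 \<le> card (insert k T)" using less.prems(1) ki(1) by simp
    ultimately show ?thesis using less.hyps[of "insert k T"] by blast
  qed (use less.prems in simp)
qed

text \<open>The determinant on the single vertex \<open>i\<close> is linear, hence irreducible, and
  for the pair the exceptional case says that both expressions in the last hypothesis are
  constant.\<close>

theorem charpol_pair_irreducible:
  fixes l :: "'n \<Rightarrow> 'n \<Rightarrow> 'd::finite laurent"
  assumes "i \<noteq> j" "l i j \<noteq> 0" "l j i \<noteq> 0"
    and "l j j - l i i \<notin> range lconst \<or> l j i * l i j \<notin> range lconst"
  shows "\<exists>V. irreducible (charpol l {i, j} V)"
proof (rule ccontr)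
  assume none: "\<not> ?thesis"
  have cp: "charpol l' {i} V = [:- lconst (V i) - l' i i, 1:]" for l' :: "'n \<Rightarrow> 'n \<Rightarrow> 'd laurent" and V
    by (simp add: charpol_def perm_term_def charmat_def)
  have irr: "irreducible (charpol l {i} (\<lambda>_. 0))"
  proof (rule ccontr)
    assume red: "\<not> ?thesis"
    have "lead_coeff (charpol l {i} (\<lambda>_. 0)) = 1" "1 \<le> degree (charpol l {i} (\<lambda>_. 0))"
      using charpol_monic[of "{i}" l "\<lambda>_. 0"] by auto
    then obtain A B where "charpol l {i} (\<lambda>_. 0) = A * B" "lead_coeff A = 1" "lead_coeff B = 1" "1 \<le> degree A" "1 \<le> degree B"
      by (rule not_irreducible_monic_factors[OF _ _ red])
    moreover from this have "A \<noteq> 0" "B \<noteq> 0" by auto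
    ultimately show False
      using laurent_poly_degree_mult[of A B] charpol_monic[of "{i}" l "\<lambda>_. 0"] by simp
  qed
  have "offdiag l j {i} (\<lambda>_. 0) \<noteq> 0" using assms offdiag_pair[of i j l] by simp
  from charpol_add_vertex[OF _ _ _ irr this] none assms(1)
  have "charpol (sub_diag l (l j j)) {i} (\<lambda>_. 0) \<in> range cpoly"
    "offdiag (sub_diag l (l j j)) j {i} (\<lambda>_. 0) \<in> range cpoly"
      by (auto simp: insert_commute)
  then have r: "[:l j j - l i i, 1:] \<in> range cpoly" "[:- (l j i * l i j):] \<in> range cpoly"
    using assms(1) by (simp_all add: cp offdiag_pair sub_diag_def)
  have c: "p \<in> range lconst" if pP: "[:p:] + pCons 0 P \<in> range cpoly" for p P
  proof -
    obtain f where "[:p:] + pCons 0 P = cpoly f" using pP by blast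
    then have "coeff ([:p:] + pCons 0 P) 0 = coeff (cpoly f) 0" by simp
    then show ?thesis by (simp add: coeff_map_poly)
  qed
  have "l j j - l i i \<in> range lconst" using c[of "l j j - l i i" 1] r(1) by simp
  moreover have "- (l j i * l i j) \<in> range lconst" using c[of "- (l j i * l i j)" 0] r(2)
    by simp
  then obtain c where "- (l j i * l i j) = lconst c" by blast
  then have "l j i * l i j = lconst (- c)" unfolding lconst.hom_uminus by (metis minus_minus)
  then have "l j i * l i j \<in> range lconst" by blast
  ultimately show False using assms(4) by blast
qed

subsection \<open>Gauge transformations and cycles\<close>

text \<open>What remains when a gauge transformation has removed the monomials from a matrix with
  zero hopping on the diagonal.\<close>

definition cmat :: "('n \<Rightarrow> 'n \<Rightarrow> complex) \<Rightarrow> ('n \<Rightarrow> complex) \<Rightarrow> 'n \<Rightarrow> 'n \<Rightarrow> complex poly" where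
  "cmat c V i j = (if i = j then [:- V i, 1:] else [:- c i j:])"

lemma prod_single: "(\<Prod>i\<in>I. Poly_Mapping.single (a i) (1 :: complex)) = Poly_Mapping.single (\<Sum>i\<in>I. a i) 1"
  by (induction I rule: infinite_finite_induct) (auto simp: mult_single)

lemma cpoly_of_int: "cpoly (of_int k) = of_int k"
  by (simp add: cpoly.hom_of_int)

text \<open>Conjugation by the diagonal matrix of the monomials \<open>z\<^sup>f\<close> does not change a cycle product.\<close>
lemma perm_term_gauge:
  fixes l :: "'n \<Rightarrow> 'n \<Rightarrow> 'd::finite laurent" and f :: "'n \<Rightarrow> int ^ 'd"
  assumes p: "p permutes T"
    and l: "\<And>i j. i \<in> T \<Longrightarrow> j \<in> T \<Longrightarrow> i \<noteq> j \<Longrightarrow> l i j = Poly_Mapping.single (f j - f i + h i j) (c i j)"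
    and diag: "\<And>i. i \<in> T \<Longrightarrow> l i i = 0" "\<And>i. h i i = 0"
  shows "perm_term T (charmat l V) p
    = smult (Poly_Mapping.single (\<Sum>i\<in>T. h i (p i)) 1) (cpoly (perm_term T (cmat c V) p))"
proof -
  have ent: "charmat l V i (p i) = smult (Poly_Mapping.single (f (p i) - f i + h i (p i)) 1) (cpoly (cmat c V i (p i)))"
    if i: "i \<in> T" for i
  proof (cases "p i = i")
    case True
    have "[:- lconst (V i), 1:] = cpoly [:- V i, 1:]"
      by (intro poly_eqI) (simp add: coeff_map_poly coeff_pCons lconst.hom_uminus split: nat.split)
    then show ?thesis using True diag i by (simp add: charmat_def cmat_def)
  next
    case False
    have "p i \<in> T" using p i by (simp add: permutes_in_image)
    then have "l i (p i) = Poly_Mapping.single (f (p i) - f i + h i (p i)) 1 * lconst (c i (p i))"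
      using l[OF i _ False[symmetric]] by (simp add: lconst_def mult_single)
    then show ?thesis using False
      by (intro poly_eqI) (simp add: charmat_def cmat_def coeff_map_poly coeff_pCons lconst.hom_uminus split: nat.split)
  qed
  have "(\<Sum>i\<in>T. f (p i) - f i + h i (p i)) = (\<Sum>i\<in>T. f (p i)) - (\<Sum>i\<in>T. f i) + (\<Sum>i\<in>T. h i (p i))"
    by (simp add: sum.distrib sum_subtractf)
  also have "(\<Sum>i\<in>T. f (p i)) = (\<Sum>i\<in>T. f i)" using sum.permute[OF p, of f]
    by (simp add: o_def)
  finally have e: "(\<Sum>i\<in>T. f (p i) - f i + h i (p i)) = (\<Sum>i\<in>T. h i (p i))" by simp
  have "(\<Prod>i\<in>T. charmat l V i (p i))
      = (\<Prod>i\<in>T. smult (Poly_Mapping.single (f (p i) - f i + h i (p i)) 1) (cpoly (cmat c V i (p i))))"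
    by (rule prod.cong[OF refl ent])
  also have "\<dots> = smult (Poly_Mapping.single (\<Sum>i\<in>T. h i (p i)) 1) (cpoly (\<Prod>i\<in>T. cmat c V i (p i)))"
    by (simp only: prod_smult prod_single e cpoly.hom_prod)
  finally show ?thesis
    by (simp only: perm_term_def cpoly.hom_mult cpoly_of_int mult_smult_right)
qed

lemma charpol_gauge:
  fixes l :: "'n \<Rightarrow> 'n \<Rightarrow> 'd::finite laurent" and f :: "'n \<Rightarrow> int ^ 'd"
  assumes "\<And>i j. i \<in> T \<Longrightarrow> j \<in> T \<Longrightarrow> i \<noteq> j \<Longrightarrow> l i j = Poly_Mapping.single (f j - f i) (c i j)"
    and "\<And>i. i \<in> T \<Longrightarrow> l i i = 0"
  shows "charpol l T V = cpoly (\<Sum>p | p permutes T. perm_term T (cmat c V) p)"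
  unfolding charpol_def cpoly.hom_sum
  using perm_term_gauge[of _ T l f "\<lambda>_ _. 0" c V] assms by (intro sum.cong) auto

lemma degree_perm_term_cmat:
  assumes "finite T" shows "degree (perm_term T (cmat c V) p) \<le> card T"
proof -
  have "degree (perm_term T (cmat c V) p) \<le> degree (\<Prod>i\<in>T. cmat c V i (p i))"
    unfolding perm_term_def
      using degree_mult_le[of "of_int (sign p)" "\<Prod>i\<in>T. cmat c V i (p i)"]
    by (simp add: of_int_poly)
  also have "\<dots> \<le> (\<Sum>i\<in>T. degree (cmat c V i (p i)))"
    using degree_prod_sum_le[OF assms, of "\<lambda>i. cmat c V i (p i)"] by (simp add: o_def)
  also have "\<dots> \<le> (\<Sum>i\<in>T. 1)" by (intro sum_mono) (auto simp: cmat_def)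
  finally show ?thesis by simp
qed

lemma cycle_of_list_nth:
  assumes "distinct c" "t < length c"
  shows "cycle_of_list c (c ! t) = c ! (Suc t mod length c)"
proof -
  have "map ((cycle_of_list c) ^^ 1) c = rotate 1 c" by (rule cyclic_rotation) (use assms in simp)
  then have "map (cycle_of_list c) c ! t = rotate1 c ! t" by simp
  then show ?thesis using assms by (simp add: nth_rotate1)
qed

text \<open>Following \<open>c\<close> from its head, a vertex cannot stay fixed, being already the
  image of its predecessor, nor move back, since its predecessor is already the image of the vertex
  before. So each vertex moves one step on; the conditions on \<open>last c\<close> and
  \<open>hd c\<close> start the induction.\<close>

lemma perm_eq_rotation:
  assumes c: "distinct c" "3 \<le> length c" and p: "p permutes set c"
    and xy: "p (last c) = hd c" "p (hd c) \<noteq> last c"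
    and adj: "\<And>a b. a < length c \<Longrightarrow> b < length c \<Longrightarrow> p (c ! a) = c ! b \<Longrightarrow>
      a = b \<or> b = Suc a mod length c \<or> a = Suc b mod length c"
  shows "p = cycle_of_list c"
proof -
  let ?m = "length c"
  have ne: "c \<noteq> []" using c by auto
  have last: "last c = c ! (?m - 1)" and hd: "hd c = c ! 0" using ne
    by (simp_all add: last_conv_nth hd_conv_nth)
  have inj: "p u = p v \<Longrightarrow> u = v" for u v using permutes_inj[OF p]
    by (auto dest: injD)
  have nth_inj: "c ! a = c ! b \<Longrightarrow> a < ?m \<Longrightarrow> b < ?m \<Longrightarrow> a = b" for a b using c(1) nth_eq_iff_index_eq by blast
  have step: "p (c ! t) = c ! Suc t" if "Suc t < ?m" for t
    using that
  proof (induction t rule: less_induct)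
    case (less t)
    have "p (c ! t) \<in> set c" using permutes_in_image[OF p, of "c ! t"] less.prems by simp
    then obtain b where b: "b < ?m" "p (c ! t) = c ! b" by (metis in_set_conv_nth)
    have "b \<noteq> t"
    proof
      assume bt: "b = t"
      show False
      proof (cases t)
        case 0
        then have "c ! 0 = c ! (?m - 1)" using b bt xy(1) last hd inj by metis
        then show False using nth_inj[of 0 "?m - 1"] c(2) ne by auto
      next
        case (Suc s)
        then have "p (c ! s) = c ! t" using less.IH[of s] less.prems by simp
        then have "c ! s = c ! t" using b bt inj by metis
        then show False using nth_inj[of s t] Suc less.prems by simp
      qed
    qed
    moreover have "t \<noteq> Suc b mod ?m"
    proof
      assume t: "t = Suc b mod ?m"
      show False
      proof (cases "Suc b = ?m")
        case True
        then have "t = 0" "b = ?m - 1" using t by auto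
        then show False using b xy(2) last hd by simp
      next
        case False
        then have tb: "t = Suc b" using t b by simp
        show False
        proof (cases b)
          case 0
          then have "p (c ! t) = p (last c)" using b xy hd by simp
          then have "c ! t = c ! (?m - 1)" using inj last by metis
          then show False using nth_inj[of t "?m - 1"] less.prems ne by auto
        next
          case (Suc s)
          then have "p (c ! s) = c ! b" using less.IH[of s] tb less.prems by simp
          then have "c ! s = c ! t" using b inj by metis
          then show False using nth_inj[of s t] Suc tb less.prems by simp
        qed
      qed
    qed
    ultimately have "b = Suc t mod ?m" using adj[of t b] b less.prems by auto
    then show ?case using b less.prems by simp
  qed
  have "p (c ! t) = cycle_of_list c (c ! t)" if t: "t < ?m" for t
  proof (cases "Suc t = ?m")
    case True
    then have "t = ?m - 1" by simp
    then show ?thesis using cycle_of_list_nth[OF c(1) t] True xy last hd by simp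
  qed (use cycle_of_list_nth[OF c(1) t] step t in simp)
  moreover have "p u = cycle_of_list c u" if "u \<notin> set c" for u
    using permutes_not_in[OF p that] id_outside_supp[OF that] by simp
  ultimately show ?thesis by (metis ext in_set_conv_nth)
qed

text \<open>Permutations are sorted by whether they use the closing edge forwards only, backwards
  only, or both ways or not at all. In the first class only the rotation of the whole cycle has a
  nonzero term; as it has no fixed points, that term is a constant \<open>W\<close> independent of
  \<open>V\<close>.\<close>

lemma charpol_cycle:
  fixes l :: "'n \<Rightarrow> 'n \<Rightarrow> 'd::finite laurent" and f :: "'n \<Rightarrow> int ^ 'd"
  assumes c: "distinct c" "3 \<le> length c"
    and l: "\<And>i j. i \<in> set c \<Longrightarrow> j \<in> set c \<Longrightarrow> i \<noteq> j \<Longrightarrow> l i j = Poly_Mapping.single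
      (f j - f i + (if i = last c \<and> j = hd c then \<alpha> else if i = hd c \<and> j = last c then - \<alpha> else 0)) (w i j)"
    and diag: "\<And>i. i \<in> set c \<Longrightarrow> l i i = 0"
    and cons: "\<And>t. t < length c \<Longrightarrow> w (c ! t) (c ! (Suc t mod length c)) \<noteq> 0"
    and adj: "\<And>a b. a < length c \<Longrightarrow> b < length c \<Longrightarrow> w (c ! a) (c ! b) \<noteq> 0 \<Longrightarrow>
      a = b \<or> b = Suc a mod length c \<or> a = Suc b mod length c"
  shows "\<exists>W. W \<noteq> 0 \<and> (\<forall>V. \<exists>S0 S1. degree S0 \<le> length c \<and> degree S1 \<le> length c \<and>
    charpol l (set c) V = cpoly S0 + smult (Poly_Mapping.single \<alpha> 1) [:lconst W:] + smult (Poly_Mapping.single (- \<alpha>) 1) (cpoly S1))"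
proof -
  let ?X = "set c" and ?x = "last c" and ?y = "hd c" and ?r = "cycle_of_list c"
  have ne: "c \<noteq> []" using c by auto
  have xy: "?x \<in> ?X" "?y \<in> ?X" using ne by auto
  have last: "last c = c ! (length c - 1)" and hd: "hd c = c ! 0" using ne
    by (simp_all add: last_conv_nth hd_conv_nth)
  have xney: "?x \<noteq> ?y"
    using nth_eq_iff_index_eq[OF c(1), of "length c - 1" 0] c(2) ne unfolding last hd by auto
  have card: "card ?X = length c" using c(1) by (rule distinct_card)
  have rp: "?r permutes ?X" by (rule cycle_permutes)
  have rx: "?r ?x = ?y"
  proof -
    have "Suc (length c - 1) = length c" using c(2) by linarith
    then show ?thesis using cycle_of_list_nth[OF c(1), of "length c - 1"] c(2) unfolding last hd
      by simp
  qed
  have ry: "?r ?y \<noteq> ?x"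
  proof -
    have len: "0 < length c" "Suc 0 mod length c = 1" using c(2) by (linarith, simp)
    have "?r ?y = c ! 1" using cycle_of_list_nth[OF c(1) len(1)] unfolding hd len(2) .
    moreover have "1 < length c" "length c - 1 < length c" "1 \<noteq> length c - 1" using c(2)
      by linarith+
    then have "c ! 1 \<noteq> c ! (length c - 1)"
      by (simp only: nth_eq_iff_index_eq[OF c(1)] not_False_eq_True)
    ultimately show ?thesis unfolding last by metis
  qed
  have rfix: "?r i \<noteq> i" "w i (?r i) \<noteq> 0" if iX: "i \<in> ?X" for i
  proof -
    obtain t where t: "t < length c" "i = c ! t" using iX by (metis in_set_conv_nth)
    have "Suc t mod length c \<noteq> t" using t(1) c(2) by (cases "Suc t = length c") auto
    moreover have "Suc t mod length c < length c" using t(1) by (intro mod_less_divisor) linarith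
    ultimately show "?r i \<noteq> i"
      using t cycle_of_list_nth[OF c(1) t(1)] nth_eq_iff_index_eq[OF c(1)] by metis
    show "w i (?r i) \<noteq> 0" using cons[OF t(1)] t cycle_of_list_nth[OF c(1) t(1)] by simp
  qed
  \<comment> \<open>The exponents left over by the gauge \<open>f\<close>, concentrated on the
    closing edge.\<close>
  define h where "h = (\<lambda>i j. if i = ?x \<and> j = ?y then \<alpha> else if i = ?y \<and> j = ?x then - \<alpha> else 0)"
  have hdiag: "h i i = 0" for i using xney by (auto simp: h_def)
  have hsum: "(\<Sum>i\<in>?X. h i (p i)) = (if p ?x = ?y then \<alpha> else 0) + (if p ?y = ?x then - \<alpha> else 0)" for p
  proof -
    have "(\<Sum>i\<in>?X. h i (p i)) = (\<Sum>i\<in>?X. (if i = ?x then (if p ?x = ?y then \<alpha> else 0) else 0)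
        + (if i = ?y then (if p ?y = ?x then - \<alpha> else 0) else 0))"
      by (intro sum.cong refl) (use xney in \<open>auto simp: h_def\<close>)
    also have "\<dots> = (if p ?x = ?y then \<alpha> else 0) + (if p ?y = ?x then - \<alpha> else 0)"
      unfolding sum.distrib using xy by (simp add: sum.delta)
    finally show ?thesis .
  qed
  define t where "t = (\<lambda>V p. perm_term ?X (cmat w V) p)"
  have pterm: "perm_term ?X (charmat l V) p
      = smult (Poly_Mapping.single ((if p ?x = ?y then \<alpha> else 0) + (if p ?y = ?x then - \<alpha> else 0)) 1) (cpoly (t V p))"
    if "p permutes ?X" for p V
    unfolding t_def hsum[symmetric]
    by (rule perm_term_gauge[OF that, of l f h w]) (use l diag hdiag in \<open>auto simp: h_def\<close>)
  define A where "A = {p. p permutes ?X \<and> p ?x = ?y \<and> p ?y \<noteq> ?x}"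
  define B where "B = {p. p permutes ?X \<and> p ?x \<noteq> ?y \<and> p ?y = ?x}"
  define Z where "Z = {p. p permutes ?X \<and> (p ?x = ?y \<longleftrightarrow> p ?y = ?x)}"
  have fin: "finite A" "finite B" "finite Z"
    by (rule finite_subset[OF _ finite_permutations[of ?X]]; force simp: A_def B_def Z_def)+
  have split: "charpol l ?X V = cpoly (\<Sum>p\<in>Z. t V p) + smult (Poly_Mapping.single \<alpha> 1) (cpoly (\<Sum>p\<in>A. t V p))
      + smult (Poly_Mapping.single (- \<alpha>) 1) (cpoly (\<Sum>p\<in>B. t V p))" for V
  proof -
    have "charpol l ?X V = (\<Sum>p\<in>Z \<union> A \<union> B. perm_term ?X (charmat l V) p)"
      unfolding charpol_def by (rule sum.cong) (auto simp: A_def B_def Z_def)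
    also have "\<dots> = (\<Sum>p\<in>Z. perm_term ?X (charmat l V) p) + (\<Sum>p\<in>A. perm_term ?X (charmat l V) p)
        + (\<Sum>p\<in>B. perm_term ?X (charmat l V) p)"
      using fin by (subst sum.union_disjoint, simp, simp, force simp: A_def B_def Z_def)+ simp
    also have "(\<Sum>p\<in>Z. perm_term ?X (charmat l V) p) = cpoly (\<Sum>p\<in>Z. t V p)"
      unfolding cpoly.hom_sum by (intro sum.cong refl) (auto simp: Z_def pterm)
    also have "(\<Sum>p\<in>A. perm_term ?X (charmat l V) p) = smult (Poly_Mapping.single \<alpha> 1) (cpoly (\<Sum>p\<in>A. t V p))"
      unfolding cpoly.hom_sum smult_sum2 by (intro sum.cong refl) (auto simp: A_def pterm)
    also have "(\<Sum>p\<in>B. perm_term ?X (charmat l V) p) = smult (Poly_Mapping.single (- \<alpha>) 1) (cpoly (\<Sum>p\<in>B. t V p))"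
      unfolding cpoly.hom_sum smult_sum2 by (intro sum.cong refl) (auto simp: B_def pterm)
    finally show ?thesis .
  qed
  define W where "W = of_int (sign ?r) * (\<Prod>i\<in>?X. - w i (?r i))"
  have "W \<noteq> 0" unfolding W_def using rfix(2) by (auto simp: sign_def)
  moreover have "\<exists>S0 S1. degree S0 \<le> length c \<and> degree S1 \<le> length c \<and> charpol l ?X V
      = cpoly S0 + smult (Poly_Mapping.single \<alpha> 1) [:lconst W:] + smult (Poly_Mapping.single (- \<alpha>) 1) (cpoly S1)" for V
  proof -
    \<comment> \<open>Any other permutation in \<open>A\<close> sends some vertex to a different one
      that is not adjacent to it in the cycle, where \<open>w\<close> vanishes.\<close>
    have "t V p = 0" if p: "p \<in> A" "p \<noteq> ?r" for p
    proof -
      have "\<not> (\<forall>a b. a < length c \<longrightarrow> b < length c \<longrightarrow> p (c ! a) = c ! b \<longrightarrow>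
          a = b \<or> b = Suc a mod length c \<or> a = Suc b mod length c)"
        using perm_eq_rotation[OF c, of p] p by (auto simp: A_def)
      then obtain a b where ab: "a < length c" "b < length c" "p (c ! a) = c ! b" "a \<noteq> b"
        "\<not> (a = b \<or> b = Suc a mod length c \<or> a = Suc b mod length c)" by blast
      have "c ! a \<noteq> c ! b" using ab c(1) by (simp add: nth_eq_iff_index_eq)
      moreover have "w (c ! a) (c ! b) = 0" using adj ab by blast
      ultimately have "cmat w V (c ! a) (p (c ! a)) = 0" using ab(3) by (simp add: cmat_def)
      then have "(\<Prod>i\<in>?X. cmat w V i (p i)) = 0" using ab(1)
        by (meson List.finite_set nth_mem prod_zero)
      then show ?thesis by (simp add: t_def perm_term_def)
    qed
    then have "(\<Sum>p\<in>A. t V p) = (\<Sum>p\<in>{?r}. t V p)"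
      using fin rp rx ry by (intro sum.mono_neutral_right) (auto simp: A_def)
    also have "\<dots> = of_int (sign ?r) * (\<Prod>i\<in>?X. [:- w i (?r i):])"
      by (simp add: t_def perm_term_def cmat_def not_sym[OF rfix(1)])
    also have "\<dots> = [:W:]"
    proof -
      have "(\<Prod>i\<in>I. [:- w i (?r i):]) = [:\<Prod>i\<in>I. - w i (?r i):]" for I
        by (induction I rule: infinite_finite_induct) (auto simp: one_pCons[symmetric])
      then show ?thesis by (simp add: W_def of_int_poly)
    qed
    finally have A: "(\<Sum>p\<in>A. t V p) = [:W:]" .
    have "cpoly [:W:] = [:lconst W:]"
      by (intro poly_eqI) (simp add: coeff_map_poly coeff_pCons split: nat.split)
    moreover have "degree (\<Sum>p\<in>Z. t V p) \<le> length c" "degree (\<Sum>p\<in>B. t V p) \<le> length c"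
      using fin degree_perm_term_cmat[of ?X w V] unfolding card t_def
        by (auto intro!: degree_sum_le)
    ultimately show ?thesis using split[of V] unfolding A by metis
  qed
  ultimately show ?thesis by blast
qed

section \<open>Faces of the Newton polytope\<close>

text \<open>The part of \<open>P\<close> on the hyperplane of weight \<open>s\<close>, with all z
  set to 1; if \<open>s\<close> is the largest weight, this part belongs to a face of the Newton
  polytope.\<close>

definition face :: "('g \<Rightarrow> int) \<Rightarrow> int \<Rightarrow> ('g \<Rightarrow>\<^sub>0 complex) poly \<Rightarrow> int \<Rightarrow> complex poly" where
  "face \<mu> g P s = (\<Sum>(a, j)\<in>mons P. if \<mu> a + g * int j = s then monom (mcoeff P j a) j else 0)"

lemma coeff_face:
  assumes "finite K" "\<And>j. Poly_Mapping.keys (coeff P j) \<subseteq> K"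
  shows "coeff (face \<mu> g P s) j = (\<Sum>a\<in>K. if \<mu> a + g * int j = s then mcoeff P j a else 0)"
proof -
  have sub: "mons P \<subseteq> K \<times> {..degree P}"
  proof clarify
    fix a i assume "(a, i) \<in> mons P"
    then have "a \<in> Poly_Mapping.keys (coeff P i)" "coeff P i \<noteq> 0"
      by (auto simp: mons_def in_keys_iff)
    then show "a \<in> K \<and> i \<in> {..degree P}" using assms(2) by (auto intro: le_degree)
  qed
  have "coeff (face \<mu> g P s) j
      = (\<Sum>(a, i)\<in>mons P. if \<mu> a + g * int i = s \<and> i = j then mcoeff P i a else 0)"
    unfolding face_def coeff_sum by (intro sum.cong) auto
  also have "\<dots> = (\<Sum>(a, i)\<in>K \<times> {..max j (degree P)}. if \<mu> a + g * int i = s \<and> i = j then mcoeff P i a else 0)"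
    by (rule sum.mono_neutral_left) (use assms(1) sub in \<open>auto simp: mons_def le_max_iff_disj split: if_splits\<close>)
  also have "\<dots> = (\<Sum>a\<in>K. \<Sum>i\<le>max j (degree P). if i = j then (if \<mu> a + g * int i = s then mcoeff P i a else 0) else 0)"
    unfolding sum.cartesian_product[symmetric] by (intro sum.cong) auto
  also have "\<dots> = (\<Sum>a\<in>K. if \<mu> a + g * int j = s then mcoeff P j a else 0)"
    by (intro sum.cong refl) simp
  finally show ?thesis .
qed

text \<open>Two monomials reach the sum of the weight bounds only if each of them attains its own
  bound.\<close>

lemma face_mult:
  fixes A B :: "('g::ab_group_add \<Rightarrow>\<^sub>0 complex) poly"
  assumes \<mu>: "additive \<mu>"
    and A: "\<And>a i. (a, i) \<in> mons A \<Longrightarrow> \<mu> a + g * int i \<le> s"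
    and B: "\<And>b j. (b, j) \<in> mons B \<Longrightarrow> \<mu> b + g * int j \<le> t"
  shows "face \<mu> g (A * B) (s + t) = face \<mu> g A s * face \<mu> g B t"
proof (rule poly_eqI)
  fix n
  let ?K = "fst ` mons A" and ?L = "fst ` mons B"
  let ?M = "(\<lambda>(a, b). a + b) ` (?K \<times> ?L)"
  have fin: "finite ?K" "finite ?L" "finite ?M" by (simp_all add: finite_mons)
  have K: "\<And>i. Poly_Mapping.keys (coeff A i) \<subseteq> ?K" and L: "\<And>i. Poly_Mapping.keys (coeff B i) \<subseteq> ?L"
    by (force simp: mons_def in_keys_iff)+
  have M: "Poly_Mapping.keys (coeff (A * B) i) \<subseteq> ?M" for i
  proof
    fix c assume "c \<in> Poly_Mapping.keys (coeff (A * B) i)"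
    then have "(\<Sum>k\<le>i. \<Sum>a\<in>?K. mcoeff A k a * mcoeff B (i - k) (c - a)) \<noteq> 0"
      using mcoeff_times[OF fin(1) K, where n = i and B = B and c = c] by (simp add: in_keys_iff)
    then have "\<exists>k\<in>{..i}. \<exists>a\<in>?K. mcoeff A k a * mcoeff B (i - k) (c - a) \<noteq> 0"
      by (rule contrapos_np) (intro sum.neutral ballI, auto)
    then obtain k a where "a \<in> ?K" "mcoeff B (i - k) (c - a) \<noteq> 0" by auto
    then have "a \<in> ?K" "c - a \<in> ?L" by (force simp: mons_def)+
    then show "c \<in> ?M" by (intro image_eqI[of _ _ "(a, c - a)"]) auto
  qed
  have inner: "(\<Sum>c\<in>?M. if \<mu> c + g * int n = s + t then mcoeff A i a * mcoeff B (n - i) (c - a) else 0)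
      = (if \<mu> a + g * int i = s then mcoeff A i a else 0) * coeff (face \<mu> g B t) (n - i)"
    if i: "i \<le> n" and a: "a \<in> ?K" for i a
  proof (cases "mcoeff A i a = 0")
    case False
    then have wa: "\<mu> a + g * int i \<le> s" using A by (simp add: mons_def)
    have LM: "?L \<subseteq> (\<lambda>c. c - a) ` ?M" using a by (force simp: image_iff)
    have "(\<Sum>c\<in>?M. if \<mu> c + g * int n = s + t then mcoeff A i a * mcoeff B (n - i) (c - a) else 0)
        = (\<Sum>c\<in>?M. mcoeff A i a * (if \<mu> a + g * int i + (\<mu> (c - a) + g * int (n - i)) = s + t then mcoeff B (n - i) (c - a) else 0))"
      using i by (intro sum.cong refl) (auto simp: additive.diff[OF \<mu>] of_nat_diff algebra_simps)
    also have "\<dots> = (\<Sum>b\<in>(\<lambda>c. c - a) ` ?M. mcoeff A i a * (if \<mu> a + g * int i + (\<mu> b + g * int (n - i)) = s + t then mcoeff B (n - i) b else 0))"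
      by (subst sum.reindex) (auto simp: inj_on_def)
    also have "\<dots> = (\<Sum>b\<in>?L. mcoeff A i a * (if \<mu> a + g * int i + (\<mu> b + g * int (n - i)) = s + t then mcoeff B (n - i) b else 0))"
      by (rule sum.mono_neutral_right) (use fin LM in \<open>force simp: mons_def\<close>)+
    also have "\<dots> = (\<Sum>b\<in>?L. (if \<mu> a + g * int i = s then mcoeff A i a else 0) * (if \<mu> b + g * int (n - i) = t then mcoeff B (n - i) b else 0))"
    proof (intro sum.cong refl)
      fix b
      have "mcoeff B (n - i) b \<noteq> 0 \<Longrightarrow> \<mu> b + g * int (n - i) \<le> t"
        using B by (simp add: mons_def)
      then show "mcoeff A i a * (if \<mu> a + g * int i + (\<mu> b + g * int (n - i)) = s + t then mcoeff B (n - i) b else 0)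
          = (if \<mu> a + g * int i = s then mcoeff A i a else 0) * (if \<mu> b + g * int (n - i) = t then mcoeff B (n - i) b else 0)"
        using wa by (cases "mcoeff B (n - i) b = 0") auto
    qed
    finally show ?thesis by (simp add: coeff_face[OF fin(2) L] sum_distrib_left)
  qed (auto intro!: sum.neutral)
  have "coeff (face \<mu> g (A * B) (s + t)) n
      = (\<Sum>c\<in>?M. if \<mu> c + g * int n = s + t then \<Sum>i\<le>n. \<Sum>a\<in>?K. mcoeff A i a * mcoeff B (n - i) (c - a) else 0)"
    unfolding coeff_face[OF fin(3) M] mcoeff_times[OF fin(1) K] ..
  also have "\<dots> = (\<Sum>c\<in>?M. \<Sum>i\<le>n. \<Sum>a\<in>?K. if \<mu> c + g * int n = s + t then mcoeff A i a * mcoeff B (n - i) (c - a) else 0)"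
    by (intro sum.cong refl) auto
  also have "\<dots> = (\<Sum>i\<le>n. \<Sum>c\<in>?M. \<Sum>a\<in>?K. if \<mu> c + g * int n = s + t then mcoeff A i a * mcoeff B (n - i) (c - a) else 0)"
    by (rule sum.swap)
  also have "\<dots> = (\<Sum>i\<le>n. \<Sum>a\<in>?K. \<Sum>c\<in>?M. if \<mu> c + g * int n = s + t then mcoeff A i a * mcoeff B (n - i) (c - a) else 0)"
    by (rule sum.cong[OF refl], rule sum.swap)
  also have "\<dots> = (\<Sum>i\<le>n. \<Sum>a\<in>?K. (if \<mu> a + g * int i = s then mcoeff A i a else 0) * coeff (face \<mu> g B t) (n - i))"
    by (intro sum.cong refl inner) auto
  also have "\<dots> = coeff (face \<mu> g A s * face \<mu> g B t) n"
    by (simp add: coeff_mult coeff_face[OF fin(1) K] sum_distrib_right)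
  finally show "coeff (face \<mu> g (A * B) (s + t)) n = coeff (face \<mu> g A s * face \<mu> g B t) n" .
qed

text \<open>Every root of \<open>f\<close> has \<open>- W\<close> as its \<open>m\<close>-th power,
  and \<open>coeff f 0\<close> is the product of the roots up to sign.\<close>

lemma monic_factor_binomial:
  fixes f h :: "complex poly"
  assumes "f * h = monom 1 m + [:W:]" "lead_coeff f = 1"
  shows "norm (coeff f 0) ^ m = norm W ^ degree f"
proof -
  obtain t where t: "f = (\<Prod>i<degree f. [:- t i, 1:])"
    using monic_complex_poly_roots[OF assms(2)] .
  have "t i ^ m = - W" if "i < degree f" for i
  proof -
    have "poly f (t i) = 0" using that by (subst t) (auto simp: poly_prod)
    then have "poly (f * h) (t i) = 0" by simp
    then show ?thesis unfolding assms(1) by (simp add: poly_monom add_eq_0_iff2)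
  qed
  then have tm: "norm (t i) ^ m = norm W" if "i < degree f" for i
    using that by (metis norm_minus_cancel norm_power)
  have "coeff f 0 = poly f 0" by (simp add: poly_0_coeff_0)
  also have "\<dots> = (\<Prod>i<degree f. - t i)" by (subst t) (simp add: poly_prod)
  finally have "norm (coeff f 0) = (\<Prod>i<degree f. norm (t i))"
    by (simp add: prod_norm[symmetric])
  then have "norm (coeff f 0) ^ m = (\<Prod>i<degree f. norm (t i) ^ m)"
    by (simp add: prod_power_distrib)
  also have "\<dots> = norm W ^ degree f" using tm by simp
  finally show ?thesis .
qed

text \<open>With weight \<open>m * \<phi> a + \<phi> \<alpha> * j\<close> the top power of the
  spectral parameter and the monomial of exponent \<alpha> are equally heavy and heaviest, so the
  face of the product is \<open>monom 1 m + [:W:]\<close>. Monicity makes the face of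
  \<open>C\<close> monic of full degree. Its constant coefficient has an absolute value known from
  \<open>monic_factor_binomial\<close> and collects only coefficients of \<open>C\<close> at nonzero
  exponents.\<close>

lemma norm_coeff_monic_factor_cycle:
  fixes B C :: "'d::finite laurent poly" and \<phi> :: "int ^ 'd \<Rightarrow> int"
  assumes \<phi>: "additive \<phi>" "inj_on \<phi> K" "0 < \<phi> \<alpha>" and K: "finite K"
    and B: "lead_coeff B = 1" "supp_in K N B" and C: "lead_coeff C = 1" "supp_in K N C"
    and deg: "degree B + degree C = m" "1 \<le> degree C" and W: "W \<noteq> 0"
    and prod: "B * C = cpoly S0 + smult (Poly_Mapping.single \<alpha> 1) [:lconst W:] + smult (Poly_Mapping.single (- \<alpha>) 1) (cpoly S1)"
    and S: "degree S0 \<le> m" "degree S1 \<le> m"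
  shows "norm W ^ degree C \<le> (\<Sum>a\<in>K - {0}. norm (mcoeff C 0 a)) ^ m"
proof -
  define g where "g = \<phi> \<alpha>"
  define \<mu> where "\<mu> = (\<lambda>a. int m * \<phi> a)"
  have m: "0 < m" using deg by simp
  have \<mu>: "additive \<mu>" unfolding \<mu>_def
    by unfold_locales (simp add: additive.add[OF \<phi>(1)] algebra_simps)
  have \<mu>0: "\<mu> 0 = 0" by (rule additive.zero[OF \<mu>])
  have g: "0 < g" "\<mu> \<alpha> = int m * g" using \<phi>(3) by (simp_all add: g_def \<mu>_def)
  have \<alpha>0: "\<alpha> \<noteq> 0" using \<phi>(1,3) additive.zero by force
  have \<alpha>2: "- \<alpha> \<noteq> \<alpha>"
  proof
    assume "- \<alpha> = \<alpha>"
    then have "- \<phi> \<alpha> = \<phi> \<alpha>" using additive.minus[OF \<phi>(1), of \<alpha>]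
      by metis
    then show False using \<phi>(3) by simp
  qed
  let ?D = "B * C"
  have lookup_single_mult: "Poly_Mapping.lookup (Poly_Mapping.single b 1 * lconst x) a = (if a = b then x else 0)" for a b :: "int ^ 'd" and x
    by (simp add: lconst_def mult_single lookup_single when_def)
  have Dc: "mcoeff ?D j a = (if a = 0 then coeff S0 j else 0) + (if a = \<alpha> \<and> j = 0 then W else 0)
      + (if a = - \<alpha> then coeff S1 j else 0)" for a j
    unfolding prod
    by (cases j) (auto simp: lookup_add coeff_map_poly lookup_lconst lookup_single_mult coeff_pCons)
  have degD: "degree ?D = m"
    using laurent_poly_degree_mult[of B C] B(1) C(1) deg(1) by force
  have lcD: "coeff ?D m = 1"
    using laurent_poly_lead_coeff_mult[of B C] B(1) C(1) degD by simp
  have top0: "mcoeff ?D m a = (if a = 0 then 1 else 0)" for a by (simp add: lcD lookup_one when_def)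
  \<comment> \<open>The degree of the product is \<open>m\<close>, so terms at exponent 0 have at
    most the weight of the leading term, and those at \<open>- \<alpha>\<close> have weight at most
    0.\<close>
  have wtD: "\<mu> a + g * int j \<le> int m * g" if aj: "(a, j) \<in> mons ?D" for a j
  proof -
    have j: "j \<le> m" using aj unfolding degD[symmetric] mons_def by (auto intro!: le_degree)
    consider "a = 0" | "a = \<alpha>" "j = 0" | "a = - \<alpha>"
      using aj Dc[of j a] by (auto simp: mons_def split: if_splits)
    then show ?thesis
    proof cases
      case 1
      then show ?thesis using j g \<mu>0 by (simp add: mult.commute mult_left_mono)
    next
      case 2
      then show ?thesis using g by simp
    next
      case 3
      have "g * int j \<le> g * int m" using j g by (intro mult_left_mono) auto
      moreover have "0 \<le> int m * g" using g by simp
      ultimately show ?thesis using 3 g additive.minus[OF \<mu>, of \<alpha>]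
        by (simp add: mult.commute)
    qed
  qed
  \<comment> \<open>Since \<phi> is injective on \<open>K\<close>, each degree \<open>j\<close> has
    at most one exponent of total weight \<open>s\<close>; setting z to 1 therefore cancels
    nothing.\<close>
  have supp_le: "\<exists>s. face \<mu> g P s \<noteq> 0 \<and> (\<forall>(a, j)\<in>mons P. \<mu> a + g * int j \<le> s)" if P: "P \<noteq> 0" "supp_in K N P" for P
  proof -
    let ?wt = "\<lambda>(a, j). \<mu> a + g * int j"
    have ne: "mons P \<noteq> {}" using P(1) by simp
    define s where "s = Max (?wt ` mons P)"
    have "s \<in> ?wt ` mons P" unfolding s_def using ne finite_mons by (intro Max_in) auto
    then obtain a j where aj: "(a, j) \<in> mons P" "\<mu> a + g * int j = s" by auto
    have aK: "a \<in> K" using P(2) aj(1) by (auto simp: supp_in_def)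
    have "coeff (face \<mu> g P s) j = (\<Sum>b\<in>K. if \<mu> b + g * int j = s then mcoeff P j b else 0)"
      by (rule coeff_face[OF K supp_in_keys[OF P(2)]])
    also have "\<dots> = (\<Sum>b\<in>K. if b = a then mcoeff P j b else 0)"
    proof (intro sum.cong refl)
      fix b assume b: "b \<in> K"
      have "\<mu> b + g * int j = s \<longleftrightarrow> b = a"
        using aj(2) b aK \<phi>(2) m by (auto simp: \<mu>_def dest: inj_onD)
      then show "(if \<mu> b + g * int j = s then mcoeff P j b else 0) = (if b = a then mcoeff P j b else 0)" by simp
    qed
    finally have "coeff (face \<mu> g P s) j = mcoeff P j a" using aK K by simp
    then have "face \<mu> g P s \<noteq> 0" using aj(1) by (auto simp: mons_def)
    moreover have "\<forall>(a, j)\<in>mons P. \<mu> a + g * int j \<le> s"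
      unfolding s_def using finite_mons[of P] by (auto intro!: Max_ge)
    ultimately show ?thesis by blast
  qed
  have ne: "B \<noteq> 0" "C \<noteq> 0" using B(1) C(1) by auto
  obtain s where s: "face \<mu> g B s \<noteq> 0" "\<And>a j. (a, j) \<in> mons B \<Longrightarrow> \<mu> a + g * int j \<le> s"
    using supp_le[OF ne(1) B(2)] by auto
  obtain t where t: "face \<mu> g C t \<noteq> 0" "\<And>a j. (a, j) \<in> mons C \<Longrightarrow> \<mu> a + g * int j \<le> t"
    using supp_le[OF ne(2) C(2)] by auto
  have fm: "face \<mu> g ?D (s + t) = face \<mu> g B s * face \<mu> g C t"
    by (rule face_mult[OF \<mu> s(2) t(2)])
  have "s + t \<le> int m * g"
  proof (rule ccontr)
    assume gt: "\<not> ?thesis"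
    have "face \<mu> g ?D (s + t) = 0"
      unfolding face_def using wtD gt by (intro sum.neutral) fastforce
    then show False using fm s(1) t(1) by simp
  qed
  \<comment> \<open>The leading terms of the monic factors give lower bounds that already sum to the
    upper bound for \<open>s + t\<close>, so both are equalities.\<close>
  moreover have "g * int (degree B) \<le> s" "g * int (degree C) \<le> t"
    using s(2)[of 0 "degree B"] t(2)[of 0 "degree C"] B(1) C(1) \<mu>0 by (simp_all add: mons_def)
  moreover have "int m * g = g * int (degree B) + g * int (degree C)"
    unfolding deg(1)[symmetric] by (simp add: algebra_simps)
  ultimately have st: "s = g * int (degree B)" "t = g * int (degree C)" by linarith+
  then have stm: "s + t = int m * g" by (simp add: deg(1)[symmetric] algebra_simps)
  define F where "F = insert 0 {\<alpha>, - \<alpha>}"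
  have keysD: "Poly_Mapping.keys (coeff ?D j) \<subseteq> F" for j
    using Dc[of j] by (auto simp: F_def in_keys_iff split: if_splits)
  have faceD: "face \<mu> g ?D (int m * g) = monom 1 m + [:W:]"
  proof (rule poly_eqI)
    fix j
    have fF: "finite F" by (simp add: F_def)
    have "coeff (face \<mu> g ?D (int m * g)) j = (\<Sum>a\<in>F. if \<mu> a + g * int j = int m * g then mcoeff ?D j a else 0)"
      by (rule coeff_face[OF fF keysD])
    also have "\<dots> = (if g * int j = int m * g then mcoeff ?D j 0 else 0)
        + ((if int m * g + g * int j = int m * g then mcoeff ?D j \<alpha> else 0)
        + (if g * int j - int m * g = int m * g then mcoeff ?D j (- \<alpha>) else 0))"
      using \<alpha>0 \<alpha>2 \<mu>0 g additive.minus[OF \<mu>, of \<alpha>]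
        by (simp add: F_def algebra_simps)
    also have "g * int j = int m * g \<longleftrightarrow> j = m" using g by auto
    also have "int m * g + g * int j = int m * g \<longleftrightarrow> j = 0" using g by auto
    \<comment> \<open>On the face this exponent would need the degree \<open>2 * m\<close>, beyond
      the degree of the product.\<close>
    also have "(if g * int j - int m * g = int m * g then mcoeff ?D j (- \<alpha>) else 0) = 0"
    proof -
      have "j \<le> m" if "mcoeff ?D j (- \<alpha>) \<noteq> 0" using that unfolding degD[symmetric]
        by (auto intro!: le_degree)
      moreover have "g * int j \<le> int m * g" if "j \<le> m" using that g
        by (simp add: mult.commute mult_left_mono)
      ultimately show ?thesis using g m
        by (cases "mcoeff ?D j (- \<alpha>) = 0") (auto simp: mult_pos_pos)
    qed
    also have "mcoeff ?D j \<alpha> = (if j = 0 then W else 0)"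
      using Dc[of j \<alpha>] \<alpha>0 \<alpha>2 by auto
    finally show "coeff (face \<mu> g ?D (int m * g)) j = coeff (monom 1 m + [:W:]) j"
      using top0[of 0] m by (cases j) (auto simp: coeff_pCons)
  qed
  define f where "f = face \<mu> g C t"
  have fprod: "f * face \<mu> g B s = monom 1 m + [:W:]"
    using fm stm faceD by (simp add: f_def mult.commute)
  have fc: "coeff f j = (\<Sum>a\<in>K. if \<mu> a + g * int j = t then mcoeff C j a else 0)" for j
    unfolding f_def by (rule coeff_face[OF K supp_in_keys[OF C(2)]])
  have zK: "0 \<in> K"
    using C by (auto simp: supp_in_def mons_def dest!: subsetD[of _ _ "(0, degree C)"])
  have fdeg: "coeff f (degree C) = 1"
  proof -
    have "coeff f (degree C) = (\<Sum>a\<in>K. if a = 0 then 1 else 0)"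
      unfolding fc using C(1) st(2) \<mu>0 by (intro sum.cong refl) (auto simp: lookup_one when_def)
    then show ?thesis using zK K by simp
  qed
  have "degree f \<le> degree C"
    by (rule degree_le) (auto simp: fc coeff_eq_0 intro!: sum.neutral)
  moreover have "degree C \<le> degree f" by (rule le_degree) (simp add: fdeg)
  ultimately have fd: "degree f = degree C" "lead_coeff f = 1" using fdeg by auto
  have "norm (coeff f 0) \<le> (\<Sum>a\<in>K. norm (if \<mu> a + g * int 0 = t then mcoeff C 0 a else 0))"
    unfolding fc by (rule norm_sum)
  \<comment> \<open>The exponent 0 has weight 0 here, while \<open>t\<close> is positive because
    \<open>C\<close> has positive degree.\<close>
  also have "\<dots> = (\<Sum>a\<in>K - {0}. norm (if \<mu> a + g * int 0 = t then mcoeff C 0 a else 0))"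
    using K \<mu>0 st(2) g(1) deg(2) by (intro sum.mono_neutral_right) auto
  also have "\<dots> \<le> (\<Sum>a\<in>K - {0}. norm (mcoeff C 0 a))" by (intro sum_mono) auto
  finally have "norm (coeff f 0) ^ m \<le> (\<Sum>a\<in>K - {0}. norm (mcoeff C 0 a)) ^ m"
    by (intro power_mono) auto
  then show ?thesis using monic_factor_binomial[OF fprod fd(2)] fd(1) by simp
qed

text \<open>In the limit \<open>v \<rightarrow> \<infinity>\<close> a monic factor of \<open>D0 - v D'\<close> tends to a factor of \<open>D'\<close>, which does not
  involve \<open>z\<close>. But the top face of its Newton polytope divides \<open>x^m + W z^\<alpha>\<close>, so some coefficient of
  a nontrivial monomial in \<open>z\<close> stays bounded away from 0.\<close>
theorem cycle_pencil_irreducible: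
  fixes D0 D' :: "'d::finite laurent poly"
  assumes D0: "lead_coeff D0 = 1" and D': "lead_coeff D' = 1" "D' \<in> range cpoly"
    and deg: "degree D0 = m" "m = Suc (degree D')" and \<alpha>: "\<alpha> \<noteq> 0" and W: "W \<noteq> 0"
    and form: "\<And>v. \<exists>S0 S1. degree S0 \<le> m \<and> degree S1 \<le> m \<and> D0 - smult (lconst v) D' = cpoly S0
      + smult (Poly_Mapping.single \<alpha> 1) [:lconst W:] + smult (Poly_Mapping.single (- \<alpha>) 1) (cpoly S1)"
  shows "\<exists>v. irreducible (D0 - smult (lconst v) D')"
proof (rule ccontr)
  assume "\<not> ?thesis"
  then have red: "\<And>n. \<not> irreducible (D0 - smult (lconst (of_nat n)) D')" by blast
  have degD0: "degree D0 = Suc (degree D')" using deg by simp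
  obtain K s q C B C0 G where K: "finite K" and s: "strict_mono (s :: nat \<Rightarrow> nat)" and q: "1 \<le> q" "q \<le> degree D'"
    and CB: "\<And>i. C i * B i = D0 - smult (lconst (of_nat (s i))) D'"
    and C: "\<And>i. lead_coeff (C i) = 1" "\<And>i. degree (C i) = q" "\<And>i. supp_in K q (C i)"
    and B: "\<And>i. lead_coeff (B i) = 1" "\<And>i. degree (B i) = Suc (degree D') - q" "\<And>i. supp_in K (Suc (degree D')) (B i)"
    and lim: "poly_tendsto C C0" "lead_coeff C0 = 1" "degree C0 = q" "lead_coeff G = 1" "C0 * G = D'"
    using monic_pencil_limit[OF D0 D'(1) degD0 tendsto_of_nat red] by blast
  have C0: "C0 \<in> range cpoly" using monic_factor_cpoly[OF lim(2,4)] lim(5) D'(2) by simp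
  obtain \<phi>0 :: "int ^ 'd \<Rightarrow> int" where \<phi>0: "additive \<phi>0" "inj_on \<phi>0 (K \<union> {0, \<alpha>})"
    using ex_separating_functional[of "K \<union> {0, \<alpha>}"] K by auto
  have ne0: "\<phi>0 \<alpha> \<noteq> 0" using \<phi>0 \<alpha> additive.zero[OF \<phi>0(1)]
    by (auto simp: inj_on_def)
  \<comment> \<open>The sign is chosen to make \<phi> positive at \<alpha>.\<close>
  define \<phi> where "\<phi> = (\<lambda>a. sgn (\<phi>0 \<alpha>) * \<phi>0 a)"
  have \<phi>: "additive \<phi>" "inj_on \<phi> K" "0 < \<phi> \<alpha>"
  proof -
    show "additive \<phi>" unfolding \<phi>_def
      by unfold_locales (simp add: additive.add[OF \<phi>0(1)] algebra_simps)
    show "inj_on \<phi> K" using \<phi>0(2) ne0 by (auto simp: inj_on_def \<phi>_def sgn_if)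
    show "0 < \<phi> \<alpha>" using ne0 by (simp add: \<phi>_def sgn_if)
  qed
  have bound: "norm W ^ q \<le> (\<Sum>a\<in>K - {0}. norm (mcoeff (C n) 0 a)) ^ m" for n
  proof -
    obtain S0 S1 where S: "degree S0 \<le> m" "degree S1 \<le> m"
      "D0 - smult (lconst (of_nat (s n))) D' = cpoly S0 + smult (Poly_Mapping.single \<alpha> 1) [:lconst W:]
        + smult (Poly_Mapping.single (- \<alpha>) 1) (cpoly S1)" using form by blast
    have supp: "supp_in K m (C n)" "supp_in K m (B n)"
      using C(3)[of n] B(3)[of n] q deg by (auto simp: supp_in_def)
    have "B n * C n = cpoly S0 + smult (Poly_Mapping.single \<alpha> 1) [:lconst W:]
        + smult (Poly_Mapping.single (- \<alpha>) 1) (cpoly S1)" using CB[of n] S(3) by (simp add: mult.commute)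
    from norm_coeff_monic_factor_cycle[OF \<phi> K B(1) supp(2) C(1) supp(1) _ _ W this S(1,2)]
    show ?thesis using B(2)[of n] C(2)[of n] q deg by simp
  qed
  have "(\<lambda>n. (\<Sum>a\<in>K - {0}. norm (mcoeff (C n) 0 a)) ^ m) \<longlonglongrightarrow> (\<Sum>a\<in>K - {0}. norm (mcoeff C0 0 a)) ^ m"
    using lim(1) unfolding poly_tendsto_def by (intro tendsto_power tendsto_sum tendsto_norm) auto
  also have "(\<Sum>a\<in>K - {0}. norm (mcoeff C0 0 a)) = 0"
    using C0 unfolding cpoly_range_iff by (intro sum.neutral) auto
  finally have "norm W ^ q \<le> 0 ^ m" using bound by (intro LIMSEQ_le_const) auto
  moreover have "0 < norm W ^ q" using W by simp
  ultimately show False using deg(2) by simp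
qed

subsection \<open>Connected graphs\<close>

text \<open>The heaviest monomials of \<open>p\<close> and \<open>q\<close> multiply to a monomial
  of the constant product, so their exponents are opposite; likewise for the lightest ones. Then the
  largest weight on \<open>p\<close> cannot exceed the smallest.\<close>

lemma const_product_keys:
  fixes p q :: "'d::finite laurent"
  assumes "p * q \<in> range lconst" "p \<noteq> 0" "q \<noteq> 0"
  shows "\<exists>a. Poly_Mapping.keys p = {a}"
proof -
  obtain \<phi> :: "int ^ 'd \<Rightarrow> int" where \<phi>: "additive \<phi>" "inj_on \<phi> (Poly_Mapping.keys p \<union> Poly_Mapping.keys q)"
    using ex_separating_functional[of "Poly_Mapping.keys p \<union> Poly_Mapping.keys q"] by auto
  have mons: "(a, j) \<in> mons [:r:] \<longleftrightarrow> j = 0 \<and> a \<in> Poly_Mapping.keys r" for a j and r :: "'d laurent"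
    by (cases j) (auto simp: mons_def in_keys_iff)
  have inj: "inj_on (\<lambda>(a, j). k * \<phi> a + 0 * int j) (mons [:r:])"
    if "k \<noteq> 0" "r = p \<or> r = q" for k and r :: "'d laurent"
    using \<phi>(2) that by (auto simp: inj_on_def mons)
  \<comment> \<open>\<open>k\<close> is 1 for the heaviest and -1 for the lightest
    monomials.\<close>
  have extreme: "\<exists>a\<in>Poly_Mapping.keys p. \<exists>b\<in>Poly_Mapping.keys q. a + b = 0 \<and>
      (\<forall>a'\<in>Poly_Mapping.keys p. k * \<phi> a' \<le> k * \<phi> a) \<and> (\<forall>b'\<in>Poly_Mapping.keys q. k * \<phi> b' \<le> k * \<phi> b)"
    if k: "k \<noteq> 0" for k
  proof -
    have add: "additive (\<lambda>a. k * \<phi> a)"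
      by unfold_locales (simp add: additive.add[OF \<phi>(1)] algebra_simps)
    have ne: "[:p:] \<noteq> 0" "[:q:] \<noteq> 0" using assms by auto
    have injp: "inj_on (\<lambda>(a, j). k * \<phi> a + 0 * int j) (mons [:p:])"
      and injq: "inj_on (\<lambda>(a, j). k * \<phi> a + 0 * int j) (mons [:q:])" using inj[OF k]
        by blast+
    obtain a i b j where t: "(a, i) \<in> mons [:p:]" "(b, j) \<in> mons [:q:]"
      "\<And>a' i'. (a', i') \<in> mons [:p:] \<Longrightarrow> k * \<phi> a' + 0 * int i' \<le> k * \<phi> a + 0 * int i"
      "\<And>b' j'. (b', j') \<in> mons [:q:] \<Longrightarrow> k * \<phi> b' + 0 * int j' \<le> k * \<phi> b + 0 * int j"
      "mcoeff ([:p:] * [:q:]) (i + j) (a + b) = mcoeff [:p:] i a * mcoeff [:q:] j b"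
      using mcoeff_times_top[OF add injp injq ne] by metis
    have ij: "i = 0" "j = 0" using t(1,2) by (auto simp: mons)
    have "Poly_Mapping.lookup (p * q) (a + b) \<noteq> 0" using t(1,2,5) unfolding ij
      by (simp add: mons_def mult.commute)
    then have "a + b = 0" using assms(1) by (auto simp: lookup_lconst split: if_splits)
    moreover have "\<forall>a'\<in>Poly_Mapping.keys p. k * \<phi> a' \<le> k * \<phi> a" "\<forall>b'\<in>Poly_Mapping.keys q. k * \<phi> b' \<le> k * \<phi> b"
      using t(3)[of _ 0] t(4)[of _ 0] by (auto simp: mons)
    ultimately show ?thesis using t(1,2) by (auto simp: mons)
  qed
  obtain a b where ab: "a \<in> Poly_Mapping.keys p" "b \<in> Poly_Mapping.keys q" "a + b = 0"
    "\<forall>a'\<in>Poly_Mapping.keys p. \<phi> a' \<le> \<phi> a" "\<forall>b'\<in>Poly_Mapping.keys q. \<phi> b' \<le> \<phi> b"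
    using extreme[of 1] by auto
  obtain a1 b1 where ab1: "a1 \<in> Poly_Mapping.keys p" "b1 \<in> Poly_Mapping.keys q" "a1 + b1 = 0"
    "\<forall>a'\<in>Poly_Mapping.keys p. \<phi> a1 \<le> \<phi> a'" "\<forall>b'\<in>Poly_Mapping.keys q. \<phi> b1 \<le> \<phi> b'"
    using extreme[of "-1"] by auto
  have "\<phi> a + \<phi> b = 0" "\<phi> a1 + \<phi> b1 = 0"
    using additive.add[OF \<phi>(1)] additive.zero[OF \<phi>(1)] ab(3) ab1(3) by metis+
  then have "\<phi> a1 = \<phi> a" using ab ab1 by (smt (verit))
  then have "\<phi> a' = \<phi> a" if "a' \<in> Poly_Mapping.keys p" for a' using ab(4) ab1(4) that
    by (metis order_antisym)
  then have "Poly_Mapping.keys p = {a}" using \<phi>(2) ab(1) by (auto simp: inj_on_def)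
  then show ?thesis by blast
qed

section \<open>Walks, cycles and potentials\<close>

text \<open>Walks are vertex lists; the closed walk along a cyclic list \<open>c\<close> is written
  \<open>c @ [hd c]\<close>, so that the step back to the start is counted.\<close>

fun wsum :: "('n \<Rightarrow> 'n \<Rightarrow> 'g::ab_group_add) \<Rightarrow> 'n list \<Rightarrow> 'g" where
  "wsum \<alpha> (x # y # xs) = \<alpha> x y + wsum \<alpha> (y # xs)"
| "wsum \<alpha> _ = 0"

abbreviation is_walk :: "('n \<times> 'n) set \<Rightarrow> 'n list \<Rightarrow> bool" where
  "is_walk G \<equiv> successively (\<lambda>x y. (x, y) \<in> G)"

lemma wsum_append: "wsum \<alpha> (xs @ a # ys) = wsum \<alpha> (xs @ [a]) + wsum \<alpha> (a # ys)"
proof (induction xs)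
  case (Cons x xs)
  then show ?case by (cases xs) (auto simp: add.assoc)
qed simp

lemma wsum_rev:
  assumes "\<And>x y. \<alpha> y x = - \<alpha> x y" shows "wsum \<alpha> (rev xs) = - wsum \<alpha> xs"
proof (induction xs)
  case (Cons x xs)
  show ?case
  proof (cases xs)
    case (Cons y ys)
    have "wsum \<alpha> (rev (x # xs)) = wsum \<alpha> (rev xs) + \<alpha> y x"
      using wsum_append[of \<alpha> "rev ys" y "[x]"] by (simp add: Cons)
    then show ?thesis using Cons.IH assms[of y x] by (simp add: Cons)
  qed simp
qed simp

lemma wsum_eq_sum: "wsum \<alpha> xs = (\<Sum>k<length xs - 1. \<alpha> (xs ! k) (xs ! Suc k))"
proof (induction \<alpha> xs rule: wsum.induct)
  case (1 \<alpha> x y xs)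
  then show ?case by (simp del: sum.lessThan_Suc add: sum.lessThan_Suc_shift)
qed auto

lemma closed_nth:
  assumes "k < length c" shows "(c @ [hd c]) ! k = c ! k" "(c @ [hd c]) ! Suc k = c ! (Suc k mod length c)"
proof -
  show "(c @ [hd c]) ! k = c ! k" using assms by (simp add: nth_append)
  show "(c @ [hd c]) ! Suc k = c ! (Suc k mod length c)"
  proof (cases "Suc k = length c")
    case True
    then have "c \<noteq> []" by auto
    then show ?thesis using True by (simp add: nth_append hd_conv_nth)
  qed (use assms in \<open>simp add: nth_append\<close>)
qed

lemma wsum_closed: "(\<Sum>k<length c. \<alpha> (c ! k) (c ! (Suc k mod length c))) = wsum \<alpha> (c @ [hd c])"
  unfolding wsum_eq_sum by (intro sum.cong) (auto simp: closed_nth simp del: nth_append)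

lemma graph_cycle_iff: "graph_cycle G c \<longleftrightarrow> 3 \<le> length c \<and> distinct c \<and> is_walk G (c @ [hd c])"
  unfolding graph_cycle_def successively_conv_nth by (auto simp: closed_nth simp del: nth_append)

lemma successively_glue:
  "successively P (xs @ a # ys) \<longleftrightarrow> successively P (xs @ [a]) \<and> successively P (a # ys)"
  by (cases ys) (auto simp: successively_append_iff successively_Cons)

text \<open>A repeated vertex splits the closed walk into two shorter ones. Without repetition it is
  a cycle or goes back and forth along one edge, where antisymmetry cancels the sum.\<close>

lemma closed_walk_sum_zero:
  assumes G: "\<And>x. (x, x) \<notin> G" and anti: "\<And>x y. \<alpha> y x = - \<alpha> x y"
    and cyc: "\<And>c. graph_cycle G c \<Longrightarrow> wsum \<alpha> (c @ [hd c]) = 0"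
    and "c \<noteq> []" "is_walk G (c @ [hd c])"
  shows "wsum \<alpha> (c @ [hd c]) = (0 :: 'g::ab_group_add)"
  using assms(4,5)
proof (induction c rule: length_induct)
  case (1 c)
  show ?case
  proof (cases "distinct c")
    case True
    consider x where "c = [x]" | x y where "c = [x, y]" | "3 \<le> length c"
    proof (cases c)
      case (Cons x d)
      then show ?thesis using that by (cases d; cases "tl d") auto
    qed (use 1 in simp)
    then show ?thesis
    proof cases
      case 1
      then show ?thesis using "1.prems" G by simp
    next
      case 2
      then show ?thesis using anti[of x] by simp
    next
      case 3
      then show ?thesis using cyc True "1.prems" by (simp add: graph_cycle_iff)
    qed
  next
    case False
    then obtain p a r t where c: "c = p @ [a] @ r @ [a] @ t" using not_distinct_decomp by blast
    define h where "h = hd c"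
    have h: "h = hd (p @ [a] @ t)" by (cases p) (auto simp: h_def c)
    have w: "is_walk G (p @ [a])" "is_walk G (a # r @ [a])" "is_walk G (a # t @ [h])"
      using "1.prems"(2) unfolding h_def[symmetric] unfolding c
      using successively_glue[of _ p a "r @ a # t @ [h]"] successively_glue[of _ "a # r" a "t @ [h]"] by auto
    have w1: "wsum \<alpha> ((a # r) @ [hd (a # r)]) = 0"
    proof -
      have "length (a # r) < length c" by (simp add: c)
      moreover have "is_walk G ((a # r) @ [hd (a # r)])" using w(2) by simp
      ultimately show ?thesis using "1.IH" by blast
    qed
    have w2: "wsum \<alpha> ((p @ [a] @ t) @ [hd (p @ [a] @ t)]) = 0"
    proof -
      have "is_walk G ((p @ [a] @ t) @ [h])" using w successively_glue[of _ p a "t @ [h]"] by simp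
      moreover have "length (p @ [a] @ t) < length c" "p @ [a] @ t \<noteq> []" by (auto simp: c)
      ultimately show ?thesis using "1.IH" unfolding h by blast
    qed
    have "wsum \<alpha> (c @ [h]) = wsum \<alpha> (p @ [a]) + (wsum \<alpha> (a # r @ [a]) + wsum \<alpha> (a # t @ [h]))"
      using wsum_append[of \<alpha> p a "r @ a # t @ [h]"] wsum_append[of \<alpha> "a # r" a "t @ [h]"] by (simp add: c)
    also have "\<dots> = wsum \<alpha> ((a # r) @ [hd (a # r)]) + wsum \<alpha> ((p @ [a] @ t) @ [h])"
      using wsum_append[of \<alpha> p a "t @ [h]"] by (simp add: algebra_simps)
    finally show ?thesis using w1 w2 by (simp only: h_def[symmetric] h[symmetric]) simp
  qed
qed

lemma ex_walk:
  assumes "(i, j) \<in> G\<^sup>*" shows "\<exists>xs. xs \<noteq> [] \<and> hd xs = i \<and> last xs = j \<and> is_walk G xs"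
  using assms
proof induction
  case base
  then show ?case by (intro exI[of _ "[i]"]) simp
next
  case (step j k)
  then obtain xs where "xs \<noteq> []" "hd xs = i" "last xs = j" "is_walk G xs" by blast
  then show ?case using step by (intro exI[of _ "xs @ [k]"]) (auto simp: successively_append_iff)
qed

text \<open>The potential at \<open>j\<close> is the sum along a chosen walk from a base vertex. The
  walk to \<open>i\<close>, the edge to \<open>j\<close> and the reversed walk to \<open>j\<close>
  form a closed walk.\<close>

lemma ex_potential:
  fixes \<alpha> :: "'n \<Rightarrow> 'n \<Rightarrow> 'g::ab_group_add"
  assumes G: "\<And>x. (x, x) \<notin> G" "sym G" and conn: "graph_connected G" and anti: "\<And>x y. \<alpha> y x = - \<alpha> x y"
    and cyc: "\<And>c. graph_cycle G c \<Longrightarrow> wsum \<alpha> (c @ [hd c]) = 0"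
  shows "\<exists>f. \<forall>(i, j)\<in>G. \<alpha> i j = f j - f i"
proof -
  fix i0 :: 'n
  have "\<forall>j. \<exists>xs. xs \<noteq> [] \<and> hd xs = i0 \<and> last xs = j \<and> is_walk G xs"
  proof
    fix j
    have "(i0, j) \<in> G\<^sup>*" using conn by (simp add: graph_connected_def)
    then show "\<exists>xs. xs \<noteq> [] \<and> hd xs = i0 \<and> last xs = j \<and> is_walk G xs"
      by (rule ex_walk)
  qed
  then obtain P where P: "\<And>j. P j \<noteq> []" "\<And>j. hd (P j) = i0" "\<And>j. last (P j) = j" "\<And>j. is_walk G (P j)" by metis
  have "\<alpha> i j = wsum \<alpha> (P j) - wsum \<alpha> (P i)" if ij: "(i, j) \<in> G" for i j
  proof -
    have "successively (\<lambda>x y. (y, x) \<in> G) (P j)"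
      by (rule successively_mono[OF P(4)]) (use G(2) in \<open>auto dest: symD\<close>)
    then have rev: "is_walk G (rev (P j))" by simp
    obtain xs where xs: "P i = xs @ [i]" using P(1,3)[of i] by (metis append_butlast_last_id)
    obtain ys where ys: "rev (P j) = j # ys" using P(1,3)[of j]
      by (metis hd_rev list.collapse rev_is_Nil_conv)
    \<comment> \<open>The final base vertex is dropped, as \<open>c @ [hd c]\<close> restores
      it.\<close>
    define c where "c = butlast (P i @ rev (P j))"
    have lst: "last (P i @ rev (P j)) = i0" using P(1,2)[of j] by (simp add: last_rev)
    have hdc: "hd c = i0"
    proof -
      have "hd (P i @ rev (P j)) = i0" using P(1,2)[of i] by simp
      moreover have "c \<noteq> []" unfolding c_def xs ys by (simp add: butlast_append)
      ultimately show ?thesis unfolding c_def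
        by (metis append_butlast_last_id butlast.simps(1) hd_append2)
    qed
    have "c @ [last (P i @ rev (P j))] = P i @ rev (P j)"
      unfolding c_def by (rule append_butlast_last_id) (simp add: P(1))
    then have ceq: "c @ [hd c] = P i @ rev (P j)" by (simp only: lst hdc)
    have "is_walk G (P i @ rev (P j))"
      using P rev ij by (auto simp: successively_append_iff hd_rev)
    moreover have "c \<noteq> []" unfolding c_def xs ys by (simp add: butlast_append)
    ultimately have "wsum \<alpha> (P i @ rev (P j)) = 0"
      using closed_walk_sum_zero[OF G(1) anti cyc, of c] unfolding ceq by blast
    moreover have "wsum \<alpha> (P i @ rev (P j)) = wsum \<alpha> (P i) + (\<alpha> i j + wsum \<alpha> (rev (P j)))"
      using wsum_append[of \<alpha> xs i "j # ys"] by (simp add: xs ys)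
    ultimately show ?thesis using wsum_rev[OF anti, where xs = "P j"] by (simp add: algebra_simps)
  qed
  then show ?thesis by (intro exI[of _ "\<lambda>j. wsum \<alpha> (P j)"]) auto
qed

text \<open>A chord splits a cycle into two shorter ones whose sums add up to that of the cycle.\<close>
lemma ex_chordless_cycle:
  fixes \<alpha> :: "'n \<Rightarrow> 'n \<Rightarrow> 'g::ab_group_add"
  assumes "sym G" and anti: "\<And>x y. \<alpha> y x = - \<alpha> x y"
    and "\<exists>c. graph_cycle G c \<and> wsum \<alpha> (c @ [hd c]) \<noteq> 0"
  obtains c where "graph_cycle G c" "wsum \<alpha> (c @ [hd c]) \<noteq> 0"
    "\<forall>a b. a < b \<longrightarrow> b < length c \<longrightarrow> (c ! a, c ! b) \<in> G \<longrightarrow> b = Suc a \<or> a = 0 \<and> Suc b = length c"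
proof -
  obtain c where c: "graph_cycle G c" "wsum \<alpha> (c @ [hd c]) \<noteq> 0"
    and min: "\<And>d. graph_cycle G d \<Longrightarrow> wsum \<alpha> (d @ [hd d]) \<noteq> 0 \<Longrightarrow> length c \<le> length d"
    using ex_has_least_nat[of "\<lambda>c. graph_cycle G c \<and> wsum \<alpha> (c @ [hd c]) \<noteq> 0" _ length] assms(3) by metis
  have "b = Suc a \<or> a = 0 \<and> Suc b = length c" if ab: "a < b" "b < length c" "(c ! a, c ! b) \<in> G" for a b
  proof (rule ccontr)
    assume nc: "\<not> ?thesis"
    define x y p t where "x = c ! a" and "y = c ! b" and "p = take a c" and "t = drop (Suc b) c"
    define r where "r = take (b - Suc a) (drop (Suc a) c)"
    define h where "h = hd c"
    have c1: "c = p @ x # drop (Suc a) c" unfolding p_def x_def using ab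
      by (simp add: id_take_nth_drop[symmetric])
    have "drop (Suc a) c = r @ y # t"
      using id_take_nth_drop[of "b - Suc a" "drop (Suc a) c"] ab by (simp add: r_def y_def t_def)
    then have ceq: "c = p @ x # r @ y # t" using c1 by simp
    \<comment> \<open>The chord joins neither consecutive vertices nor the two ends of
      \<open>c\<close>, so both pieces are shorter than \<open>c\<close> and still have at least
      three vertices.\<close>
    have len: "r \<noteq> []" "p \<noteq> [] \<or> t \<noteq> []"
      using nc ab by (auto simp: r_def p_def t_def)
    have h: "h = hd (p @ x # y # t)" unfolding h_def by (subst ceq, cases p) auto
    have dist: "distinct (p @ x # r @ y # t)" using c(1) ceq by (simp add: graph_cycle_iff)
    have "is_walk G (p @ x # r @ y # t @ [h])" using c(1) ceq by (simp add: graph_cycle_iff h_def)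
    then have w: "is_walk G (p @ [x])" "is_walk G (x # r @ [y])" "is_walk G (y # t @ [h])"
      using successively_glue[of _ p x "r @ y # t @ [h]"] successively_glue[of _ "x # r" y "t @ [h]"] by auto
    have xy: "(x, y) \<in> G" "(y, x) \<in> G" using ab(3) assms(1)
      by (auto simp: x_def y_def dest: symD)
    have g1: "graph_cycle G (x # r @ [y])"
      unfolding graph_cycle_iff using len(1) dist w(2) xy successively_glue[of _ "x # r" y "[x]"]
        by (cases r) auto
    have g2: "graph_cycle G (p @ x # y # t)"
      unfolding graph_cycle_iff h[symmetric]
      using len(2) dist w(1,3) xy successively_glue[of _ p x "y # t @ [h]"]
      by (cases p; cases t) auto
    have l1: "length (x # r @ [y]) < length c" using len(2) by (subst ceq, cases p; cases t) auto
    have l2: "length (p @ x # y # t) < length c" using len(1) by (subst ceq, cases r) auto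
    have "wsum \<alpha> (x # r @ [y] @ [x]) = 0"
      using min[OF g1] l1 by fastforce
    moreover have "wsum \<alpha> ((p @ x # y # t) @ [h]) = 0"
      using min[OF g2] l2 unfolding h[symmetric] by fastforce
    moreover have "wsum \<alpha> (c @ [h]) = wsum \<alpha> (x # r @ [y] @ [x]) + wsum \<alpha> ((p @ x # y # t) @ [h])"
    proof -
      have 1: "wsum \<alpha> (c @ [h]) = wsum \<alpha> (p @ [x]) + (wsum \<alpha> (x # r @ [y]) + wsum \<alpha> (y # t @ [h]))"
        using wsum_append[of \<alpha> p x "r @ y # t @ [h]"] wsum_append[of \<alpha> "x # r" y "t @ [h]"]
        by (subst ceq) simp
      have 2: "wsum \<alpha> (x # r @ [y] @ [x]) = wsum \<alpha> (x # r @ [y]) + \<alpha> y x"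
        using wsum_append[of \<alpha> "x # r" y "[x]"] by simp
      have 3: "wsum \<alpha> ((p @ x # y # t) @ [h]) = wsum \<alpha> (p @ [x]) + (\<alpha> x y + wsum \<alpha> (y # t @ [h]))"
        using wsum_append[of \<alpha> p x "y # t @ [h]"] by simp
      show ?thesis unfolding 1 2 3 anti[of y x] by (simp add: algebra_simps)
    qed
    ultimately show False using c(2) by (simp add: h_def)
  qed
  then show thesis using that[OF c] by blast
qed

lemma rtrancl_crossing_edge:
  assumes "(i, j) \<in> G\<^sup>*" "i \<in> S" "j \<notin> S" shows "\<exists>x y. (x, y) \<in> G \<and> x \<in> S \<and> y \<notin> S"
  using assms by induction auto

lemma connected_const:
  assumes "graph_connected G" "\<And>i j. (i, j) \<in> G \<Longrightarrow> f i = f j" shows "f i = f j"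
proof -
  have "(i, j) \<in> G\<^sup>*" using assms(1) by (simp add: graph_connected_def)
  then show ?thesis by induction (use assms(2) in auto)
qed

section \<open>Hopping matrices on a connected graph\<close>

context
  fixes l :: "'n::finite \<Rightarrow> 'n \<Rightarrow> 'd::finite laurent" and G :: "('n \<times> 'n) set" and \<alpha> :: "'n \<Rightarrow> 'n \<Rightarrow> int ^ 'd"
    and w :: "'n \<Rightarrow> 'n \<Rightarrow> complex"
  assumes G_iff: "\<And>i j. (i, j) \<in> G \<longleftrightarrow> i \<noteq> j \<and> l i j \<noteq> 0" and G_sym: "sym G" and G_conn: "graph_connected G"
begin

text \<open>Connectedness supplies the adjacent vertex for each extension step.\<close>

lemma charpol_UNIV_irreducible:
  assumes "2 \<le> card T" "irreducible (charpol l T V)" shows "\<exists>V. irreducible (charpol l UNIV V)"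
proof (rule charpol_irreducible_extend[OF _ assms(1)])
  fix S :: "'n set" assume "S \<noteq> {}" "S \<noteq> UNIV"
  then obtain i j where "i \<in> S" "j \<notin> S" by auto
  moreover have "(i, j) \<in> G\<^sup>*" using G_conn by (simp add: graph_connected_def)
  ultimately obtain x y where "(x, y) \<in> G" "x \<in> S" "y \<notin> S"
    using rtrancl_crossing_edge by metis
  moreover from this have "(y, x) \<in> G" using G_sym by (auto dest: symD)
  ultimately show "\<exists>k i. k \<notin> S \<and> i \<in> S \<and> l k i \<noteq> 0 \<and> l i k \<noteq> 0" using G_iff by blast
qed (use assms in blast)

lemma edge_violation_irreducible:
  assumes "(i, j) \<in> G" "l j j - l i i \<notin> range lconst \<or> l j i * l i j \<notin> range lconst"
  shows "\<exists>V. irreducible (charpol l UNIV V)"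
proof -
  have "(j, i) \<in> G" using assms(1) G_sym by (auto dest: symD)
  then have ij: "i \<noteq> j" "l i j \<noteq> 0" "l j i \<noteq> 0" using assms(1) G_iff by auto
  obtain V where "irreducible (charpol l {i, j} V)" using charpol_pair_irreducible[OF ij assms(2)]
    by blast
  then show ?thesis by (rule charpol_UNIV_irreducible[rotated]) (use ij in simp)
qed

section \<open>Constant diagonal and monomial off-diagonal entries\<close>

context
  fixes d :: "'d laurent"
  assumes diag: "\<And>i. l i i = d"
    and anti: "\<And>x y. \<alpha> y x = - \<alpha> x y"
    and edge: "\<And>i j. (i, j) \<in> G \<Longrightarrow> l i j = Poly_Mapping.single (\<alpha> i j) (w i j) \<and> w i j \<noteq> 0"
    and nonedge: "\<And>i j. (i, j) \<notin> G \<Longrightarrow> w i j = 0"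
begin

text \<open>Off the graph the coefficient is 0 and the exponent arbitrary, so one monomial formula
  covers all pairs.\<close>

lemma offdiag_entry: "i \<noteq> j \<Longrightarrow> (i, j) \<in> G \<Longrightarrow> \<alpha> i j = \<beta> \<Longrightarrow> l i j = Poly_Mapping.single \<beta> (w i j)"
  "i \<noteq> j \<Longrightarrow> (i, j) \<notin> G \<Longrightarrow> l i j = Poly_Mapping.single \<beta> (w i j)"
  using edge nonedge G_iff by auto

lemma balanced_reducible:
  assumes cyc: "\<And>c. graph_cycle G c \<Longrightarrow> wsum \<alpha> (c @ [hd c]) = 0" and card: "2 \<le> CARD('n)"
  shows "reducible (charpol l UNIV V)"
proof -
  have irr: "(x, x) \<notin> G" for x by (simp add: G_iff)
  obtain f where f: "\<And>i j. (i, j) \<in> G \<Longrightarrow> \<alpha> i j = f j - f i"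
    using ex_potential[OF irr G_sym G_conn anti cyc] by blast
  have "charpol (sub_diag l d) UNIV V = cpoly (\<Sum>p | p permutes UNIV. perm_term UNIV (cmat w V) p)" (is "_ = cpoly ?S")
  proof (rule charpol_gauge)
    show "sub_diag l d i j = Poly_Mapping.single (f j - f i) (w i j)" if "i \<noteq> j" for i j
      using that f offdiag_entry[OF that] by (cases "(i, j) \<in> G") (auto simp: sub_diag_def)
  qed (simp add: sub_diag_def diag)
  moreover from this have "degree ?S = CARD('n)"
    using charpol_monic[of UNIV "sub_diag l d" V] by simp
  \<comment> \<open>A polynomial constant in z splits over the complex numbers, and here its degree
    is at least 2.\<close>
  ultimately have "reducible (charpol (sub_diag l d) UNIV V)"
    using cpoly_not_irreducible(2)[of ?S] card by simp
  then show ?thesis unfolding shift_charpol[symmetric] by (rule shift_poly_reducible)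
qed

text \<open>Once the common diagonal is subtracted, a gauge removes the exponents along the path
  from \<open>hd c\<close> to \<open>last c\<close> and moves the whole sum of the cycle to the
  closing edge. Deleting \<open>hd c\<close> deletes that edge, so the remaining block is constant
  in z, as \<open>cycle_pencil_irreducible\<close> demands of \<open>D'\<close>.\<close>

lemma unbalanced_irreducible:
  assumes "\<exists>c. graph_cycle G c \<and> wsum \<alpha> (c @ [hd c]) \<noteq> 0"
  shows "\<exists>V. irreducible (charpol l UNIV V)"
proof -
  obtain c where c: "graph_cycle G c" "wsum \<alpha> (c @ [hd c]) \<noteq> 0"
    and chord: "\<forall>a b. a < b \<longrightarrow> b < length c \<longrightarrow> (c ! a, c ! b) \<in> G \<longrightarrow> b = Suc a \<or> a = 0 \<and> Suc b = length c"
    by (rule ex_chordless_cycle[OF G_sym anti assms])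
  have len: "3 \<le> length c" "distinct c" using c(1) by (simp_all add: graph_cycle_iff)
  have ne: "c \<noteq> []" using len by auto
  have last: "last c = c ! (length c - 1)" and hd: "hd c = c ! 0" using ne
    by (simp_all add: last_conv_nth hd_conv_nth)
  have nth_inj: "c ! a = c ! b \<longleftrightarrow> a = b" if "a < length c" "b < length c" for a b
    using that len(2) by (simp add: nth_eq_iff_index_eq)
  define \<delta> where "\<delta> = wsum \<alpha> (c @ [hd c])"
  define pos where "pos = inv_into {..<length c} (nth c)"
  have pos: "pos (c ! a) = a" if "a < length c" for a
    unfolding pos_def using that len(2)
      by (intro inv_into_f_f) (auto simp: inj_on_def nth_eq_iff_index_eq)
  \<comment> \<open>Partial sums of the exponents along the path, which give the gauge at position
    \<open>k\<close>.\<close>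
  define F where "F = (\<lambda>k. \<Sum>t<k. \<alpha> (c ! t) (c ! Suc t))"
  define f where "f = (\<lambda>i. F (pos i))"
  define h where "h = (\<lambda>i j. if i = last c \<and> j = hd c then \<delta> else if i = hd c \<and> j = last c then - \<delta> else 0)"
  have close: "\<alpha> (last c) (hd c) = F 0 - F (length c - 1) + \<delta>"
  proof -
    obtain m where m: "length c = Suc m" using ne by (cases c) auto
    have "\<delta> = (\<Sum>k<length c. \<alpha> (c ! k) (c ! (Suc k mod length c)))"
      unfolding \<delta>_def wsum_closed ..
    also have "\<dots> = (\<Sum>k<m. \<alpha> (c ! k) (c ! (Suc k mod length c))) + \<alpha> (last c) (hd c)"
      by (simp add: m last hd)
    also have "(\<Sum>k<m. \<alpha> (c ! k) (c ! (Suc k mod length c))) = F m"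
      unfolding F_def by (intro sum.cong) (auto simp: m)
    finally show ?thesis by (simp add: m F_def)
  qed
  have lh: "last c \<noteq> hd c" using nth_inj[of "length c - 1" 0] len(1) ne
    by (simp add: last hd)
  have h_anti: "h j i = - h i j" for i j using lh by (auto simp: h_def)
  have up: "\<alpha> (c ! a) (c ! b) = f (c ! b) - f (c ! a) + h (c ! a) (c ! b)"
    if ab: "a < b" "b < length c" "(c ! a, c ! b) \<in> G" for a b
  proof -
    have fa: "f (c ! a) = F a" "f (c ! b) = F b" using pos ab by (simp_all add: f_def)
    have nl: "c ! a \<noteq> last c" using nth_inj[of a "length c - 1"] ab by (simp add: last)
    consider "b = Suc a" | "a = 0" "Suc b = length c" using chord ab by blast
    then show ?thesis
    proof cases
      case 1
      \<comment> \<open>With at least three vertices, two consecutive ones in the list cannot be its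
        two ends.\<close>
      have "\<not> (c ! a = hd c \<and> c ! b = last c)"
      proof
        assume eq: "c ! a = hd c \<and> c ! b = last c"
        have "a < length c" "0 < length c" "length c - 1 < length c" using ab by linarith+
        then have "a = 0" "b = length c - 1"
          using eq ab(2) nth_inj unfolding last hd by blast+
        then show False using 1 len(1) by simp
      qed
      then have h0: "h (c ! a) (c ! b) = 0" using nl by (auto simp: h_def)
      have "\<alpha> (c ! a) (c ! b) = F b - F a" by (simp add: F_def 1)
      then show ?thesis by (simp only: fa h0 add_0_right)
    next
      case 2
      then have "length c - 1 = b" by simp
      then have ends: "c ! a = hd c" "c ! b = last c" "b = length c - 1" using 2
        by (simp_all add: last hd)
      then have h1: "h (c ! a) (c ! b) = - \<delta>" using lh by (simp add: h_def)
      have "\<alpha> (c ! a) (c ! b) = - (F a - F b + \<delta>)"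
        unfolding close[symmetric, folded 2(1) ends(3)] ends(1,2) by (rule anti)
      then show ?thesis unfolding fa h1 by simp
    qed
  qed
  have gauge: "sub_diag l d i j = Poly_Mapping.single (f j - f i + h i j) (w i j)"
    if ij: "i \<in> set c" "j \<in> set c" "i \<noteq> j" for i j
  proof -
    obtain a b where ab: "a < length c" "b < length c" "i = c ! a" "j = c ! b"
      using ij by (metis in_set_conv_nth)
    have "\<alpha> i j = f j - f i + h i j" if "(i, j) \<in> G"
    proof (cases a b rule: linorder_cases)
      case less
      then show ?thesis using up[of a b] ab that by simp
    next
      case equal
      then show ?thesis using ab ij by simp
    next
      case greater
      have "(j, i) \<in> G" using that G_sym by (auto dest: symD)
      then have "\<alpha> j i = f i - f j + h j i" using up[of b a] ab greater by simp
      then show ?thesis using anti[of i j] h_anti[of i j] by (simp add: algebra_simps)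
    qed
    then show ?thesis using offdiag_entry[OF ij(3)] ij(3)
      by (cases "(i, j) \<in> G") (auto simp: sub_diag_def)
  qed
  have diag0: "sub_diag l d i i = 0" for i by (simp add: sub_diag_def diag)
  have cons: "w (c ! t) (c ! (Suc t mod length c)) \<noteq> 0" if "t < length c" for t
    using c(1) edge that by (simp add: graph_cycle_def)
  have adj: "a = b \<or> b = Suc a mod length c \<or> a = Suc b mod length c"
    if "a < length c" "b < length c" "w (c ! a) (c ! b) \<noteq> 0" for a b
  proof (cases a b rule: linorder_cases)
    case less
    then have "b = Suc a \<or> a = 0 \<and> Suc b = length c" using chord nonedge that by blast
    then show ?thesis using that by auto
  next
    case greater
    have "(c ! b, c ! a) \<in> G" using nonedge that(3) G_sym by (blast dest: symD)
    then have "a = Suc b \<or> b = 0 \<and> Suc a = length c" using chord greater that by blast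
    then show ?thesis using that by auto
  qed simp
  have "\<exists>W. W \<noteq> 0 \<and> (\<forall>V. \<exists>S0 S1. degree S0 \<le> length c \<and> degree S1 \<le> length c \<and>
    charpol (sub_diag l d) (set c) V = cpoly S0 + smult (Poly_Mapping.single \<delta> 1) [:lconst W:]
      + smult (Poly_Mapping.single (- \<delta>) 1) (cpoly S1))"
    by (rule charpol_cycle[OF len(2,1), where f = f and w = w])
      (rule gauge[unfolded h_def] diag0 cons adj; assumption)+
  then obtain W where W: "W \<noteq> 0" and form: "\<forall>V. \<exists>S0 S1. degree S0 \<le> length c \<and> degree S1 \<le> length c \<and>
    charpol (sub_diag l d) (set c) V = cpoly S0 + smult (Poly_Mapping.single \<delta> 1) [:lconst W:]
      + smult (Poly_Mapping.single (- \<delta>) 1) (cpoly S1)"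
    by (elim exE conjE)
  let ?l = "sub_diag l d" and ?k = "hd c"
  define T where "T = set c - {?k}"
  have T: "finite T" "?k \<notin> T" "insert ?k T = set c" using ne by (auto simp: T_def)
  have cardT: "card (set c) = Suc (card T)" "card (set c) = length c"
    using T len(2) by (metis card_insert_disjoint, simp add: distinct_card)
  let ?V = "\<lambda>_. 0 :: complex"
  have split: "charpol ?l (set c) (?V(?k := v)) = charpol ?l (set c) (?V(?k := 0)) - smult (lconst v) (charpol ?l T ?V)" for v
    unfolding T(3)[symmetric] charpol_insert[OF T(1,2)] charpol_upd[OF T(2)] offdiag_upd
    by (simp add: charmat_def diag0)
  have "h i j = 0" if "i \<in> T" "j \<in> T" for i j using that by (auto simp: h_def T_def)
  then have "charpol ?l T ?V \<in> range cpoly"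
    using charpol_gauge[of T ?l f w ?V] gauge diag0 by (simp add: T_def)
  then have "\<exists>v. irreducible (charpol ?l (set c) (?V(?k := 0)) - smult (lconst v) (charpol ?l T ?V))"
    using charpol_monic[OF T(1), of ?l ?V] charpol_monic[of "set c" ?l "?V(?k := 0)"] cardT W c(2) form
    by (intro cycle_pencil_irreducible[where m = "length c" and \<alpha> = \<delta> and W = W])
      (auto simp: \<delta>_def split[symmetric])
  then obtain v where "irreducible (charpol ?l (set c) (?V(?k := v)))" unfolding split[symmetric] ..
  then have "irreducible (charpol l (set c) (?V(?k := v)))"
    unfolding shift_charpol[symmetric] shift_poly_irreducible_iff .
  then show ?thesis by (rule charpol_UNIV_irreducible[rotated]) (use cardT len in simp)
qed

end

end

section \<open>The dispersion polynomial of a periodic graph\<close>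

lemma dispersion_poly_charpol:
  "dispersion_poly edges act w u V = charpol (hop edges act w u) UNIV (\<lambda>i. V $ i)"
proof -
  have "(mat [:0, 1:] - map_matrix (\<lambda>r. [:r:]) (floquet_matrix edges act w u V)) $ i $ j
      = charmat (hop edges act w u) (\<lambda>i. V $ i) i j" for i j
    by (simp add: Finite_Cartesian_Product.mat_def map_matrix_def floquet_matrix_def charmat_def lconst_def algebra_simps)
  then show ?thesis
    unfolding dispersion_poly_def Determinants.det_def charpol_def perm_term_def by simp
qed

lemma lookup_hop:
  assumes "finite (shifts edges act u i j)"
  shows "Poly_Mapping.lookup (hop edges act w u i j) a
    = (if a \<in> shifts edges act u i j then w (u i, act (u j) a) else 0)"
proof -
  have "Poly_Mapping.lookup (hop edges act w u i j) a
      = (\<Sum>b\<in>shifts edges act u i j. if b = a then w (u i, act (u j) b) else 0)"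
    unfolding hop_def lookup_sum by (intro sum.cong) (auto simp: lookup_single when_def)
  then show ?thesis using assms by simp
qed

theorem theorem1p1:
  fixes verts :: "'v set"
    and edges :: "('v \<times> 'v) set"
    and act :: "'v \<Rightarrow> int ^ 'd::finite \<Rightarrow> 'v"
    and w :: "'v \<times> 'v \<Rightarrow> complex"
    and u :: "'n::finite \<Rightarrow> 'v"
  assumes "periodic_graph verts edges act"
    and "periodic_edge_weight edges act w"
    and "irrefl edges"
    and "inj u" and "fundamental_domain verts act (range u)"
    and "CARD('n) \<ge> 2"
    and "graph_connected (quotient_edges edges act u)"
  shows "((\<forall>V. reducible (dispersion_poly edges act w u V)) \<longleftrightarrow>
            cond_I edges act w u \<and> cond_II edges act u \<and> cond_III edges act u)
       \<and> (\<not> (cond_I edges act w u \<and> cond_II edges act u \<and> cond_III edges act u) \<longrightarrow>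
            holds_generically (\<lambda>V. irreducible (dispersion_poly edges act w u V)))"
proof -
  interpret periodic_graph verts edges act by fact
  define l where "l = hop edges act w u"
  define S where "S = shifts edges act u"
  define G where "G = quotient_edges edges act u"
  have uv: "u i \<in> verts" for i using assms(5) by (auto simp: fundamental_domain_def)
  have finS: "finite (S i j)" for i j unfolding S_def by (rule finite_shifts) (rule uv)+
  have wne: "w (u i, act (u j) a) \<noteq> 0" if "a \<in> S i j" for i j a
    using assms(2) that unfolding periodic_edge_weight_def S_def shifts_def by force
  have lookup_l: "Poly_Mapping.lookup (l i j) a = (if a \<in> S i j then w (u i, act (u j) a) else 0)" for i j a
    unfolding l_def S_def by (rule lookup_hop[OF finS[unfolded S_def]])
  have keys_l: "Poly_Mapping.keys (l i j) = S i j" for i j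
    using wne by (auto simp: in_keys_iff lookup_l split: if_splits)
  have l0: "l i j \<noteq> 0 \<longleftrightarrow> S i j \<noteq> {}" for i j
    using keys_l[of i j] by (metis keys_eq_empty)
  have S_neg: "- a \<in> S j i" if a: "a \<in> S i j" for i j a
  proof -
    have "(act (u j) a, u i) \<in> edges" using a undirected
      by (auto simp: S_def shifts_def dest: symD)
    from edges_periodic[OF this, of "- a"] show ?thesis
      using uv by (simp add: S_def shifts_def act_add act_zero)
  qed
  have G_iff: "(i, j) \<in> G \<longleftrightarrow> i \<noteq> j \<and> l i j \<noteq> 0" for i j
    by (simp add: G_def quotient_edges_def l0 S_def[symmetric])
  have G_sym: "sym G"
    using S_neg unfolding sym_def G_def quotient_edges_def S_def[symmetric] by fast
  have G_conn: "graph_connected G" using assms(7) by (simp add: G_def)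
  have diag_0: "Poly_Mapping.lookup (l i i) 0 = 0" for i
    using assms(3) uv by (auto simp: lookup_l S_def shifts_def irrefl_def act_zero)
  \<comment> \<open>As edge weights vanish nowhere, a diagonal entry determines both the set of
    shifts and the weights along it.\<close>
  have condI: "cond_I edges act w u \<longleftrightarrow> (\<forall>i j. l i i = l j j)"
  proof
    assume "cond_I edges act w u"
    then obtain C where C: "\<forall>i. S i i = C" "\<forall>a\<in>C. \<forall>i j. w (u i, act (u i) a) = w (u j, act (u j) a)"
      unfolding cond_I_def S_def by blast
    show "\<forall>i j. l i i = l j j"
    proof (intro allI poly_mapping_eqI)
      fix i j a
      have "a \<in> C \<Longrightarrow> w (u i, act (u i) a) = w (u j, act (u j) a)" using C(2)
        by blast
      then show "Poly_Mapping.lookup (l i i) a = Poly_Mapping.lookup (l j j) a" using C(1)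
        by (simp add: lookup_l)
    qed
  next
    assume eq: "\<forall>i j. l i i = l j j"
    fix i0 :: 'n
    have S: "S i i = S i0 i0" for i using eq keys_l by metis
    have "w (u i, act (u i) a) = w (u j, act (u j) a)" if "a \<in> S i0 i0" for i j a
      using lookup_l[of i i a] lookup_l[of j j a] that S eq by metis
    then show "cond_I edges act w u"
      unfolding cond_I_def S_def[symmetric] using S finS by (intro exI[of _ "S i0 i0"]) blast
  qed
  \<comment> \<open>The value 0 off the graph keeps \<alpha> antisymmetric for all pairs of
    vertices.\<close>
  define \<alpha> where "\<alpha> = (\<lambda>i j. if (i, j) \<in> G then the_elem (S i j) else 0)"
  define c where "c = (\<lambda>i j. if (i, j) \<in> G then w (u i, act (u j) (\<alpha> i j)) else 0)"
  have S_edge: "S i j = {\<alpha> i j}" if "cond_II edges act u" "(i, j) \<in> G" for i j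
  proof -
    have "S i j \<noteq> {}" "card (S i j) \<le> 1"
      using that G_iff[of i j] l0 by (auto simp: cond_II_def S_def)
    then obtain a where "S i j = {a}" using finS
      by (metis card_1_singletonE card_0_eq le_antisym less_one linorder_not_le)
    then show ?thesis using that(2) by (simp add: \<alpha>_def)
  qed
  have anti: "\<alpha> j i = - \<alpha> i j" if "cond_II edges act u" for i j
  proof (cases "(i, j) \<in> G")
    case True
    then have "(j, i) \<in> G" using G_sym by (auto dest: symD)
    then show ?thesis
      using S_edge[OF that True] S_edge[OF that, of j i] S_neg[of "\<alpha> i j" i j] by simp
  next
    case False
    then have "(j, i) \<notin> G" using G_sym by (auto dest: symD)
    then show ?thesis using False by (simp add: \<alpha>_def)
  qed
  have edge: "l i j = Poly_Mapping.single (\<alpha> i j) (c i j) \<and> c i j \<noteq> 0"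
    if "cond_II edges act u" "(i, j) \<in> G" for i j
  proof
    show "l i j = Poly_Mapping.single (\<alpha> i j) (c i j)"
      using that S_edge[OF that]
        by (intro poly_mapping_eqI) (auto simp: lookup_l lookup_single when_def c_def)
    show "c i j \<noteq> 0" using that S_edge[OF that] wne[of "\<alpha> i j" i j]
      by (simp add: c_def)
  qed
  have condIII: "cond_III edges act u \<longleftrightarrow> (\<forall>p. graph_cycle G p \<longrightarrow> wsum \<alpha> (p @ [hd p]) = 0)"
  proof -
    have "(\<Sum>k<length p. the_elem (S (p ! k) (p ! (Suc k mod length p)))) = wsum \<alpha> (p @ [hd p])"
      if "graph_cycle G p" for p
      unfolding wsum_closed[symmetric] using that
        by (intro sum.cong) (auto simp: graph_cycle_def \<alpha>_def)
    then show ?thesis unfolding cond_III_def G_def[symmetric] S_def[symmetric] by auto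
  qed
  have "reducible (dispersion_poly edges act w u V)"
    if "cond_I edges act w u" "cond_II edges act u" "cond_III edges act u" for V
  proof -
    fix i0 :: 'n
    have "l i i = l i0 i0" for i using that(1) condI by blast
    from balanced_reducible[OF G_iff G_sym G_conn this anti[OF that(2)] edge[OF that(2)]]
    have "reducible (charpol l UNIV (\<lambda>i. V $ i))"
      using that(3) condIII assms(6) by (auto simp: c_def)
    then show ?thesis by (simp add: dispersion_poly_charpol l_def)
  qed
  moreover have ex: "\<exists>V. irreducible (charpol l UNIV V)"
    if not: "\<not> (cond_I edges act w u \<and> cond_II edges act u \<and> cond_III edges act u)"
  proof (cases "cond_I edges act w u \<and> cond_II edges act u")
    case True
    fix i0 :: 'n
    have "l i i = l i0 i0" for i using True condI by blast
    from unbalanced_irreducible[OF G_iff G_sym G_conn this anti edge] True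
    show ?thesis using not condIII by (auto simp: c_def)
  next
    case False
    \<comment> \<open>The failure is visible on a single edge: connectedness carries a difference
      between diagonal entries to adjacent vertices, and two shifts along an edge make the product
      of its two opposite entries nonconstant.\<close>
    have "\<exists>i j. (i, j) \<in> G \<and> (l j j - l i i \<notin> range lconst \<or> l j i * l i j \<notin> range lconst)"
    proof (cases "cond_I edges act w u")
      case True
      then obtain i j where ij: "i \<noteq> j" "\<not> card (S i j) \<le> 1"
        using False by (auto simp: cond_II_def S_def)
      then have "S i j \<noteq> {}" by auto
      then have Gij: "(i, j) \<in> G" using ij by (simp add: G_iff l0)
      moreover from this have "(j, i) \<in> G" using G_sym by (auto dest: symD)
      ultimately have "l i j \<noteq> 0" "l j i \<noteq> 0" by (simp_all add: G_iff)
      moreover have "\<nexists>a. Poly_Mapping.keys (l i j) = {a}" using ij(2)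
        by (auto simp: keys_l)
      ultimately have "l i j * l j i \<notin> range lconst"
        using const_product_keys[of "l i j" "l j i"] by blast
      then show ?thesis using Gij by (auto simp: mult.commute)
    next
      case False
      then obtain i j where "(i, j) \<in> G" "l i i \<noteq> l j j"
        using connected_const[OF G_conn, of "\<lambda>i. l i i"] condI by blast
      \<comment> \<open>Without self-loops diagonal entries have no constant term, so a constant
        difference is 0.\<close>
      moreover have "l j j - l i i \<notin> range lconst"
      proof
        assume "l j j - l i i \<in> range lconst"
        then obtain x where x: "l j j - l i i = lconst x" by blast
        have "Poly_Mapping.lookup (l j j - l i i) 0 = 0" by (simp add: lookup_minus diag_0)
        then have "x = 0" by (simp add: x lookup_lconst)
        then show False using x \<open>l i i \<noteq> l j j\<close> by simp
      qed
      ultimately show ?thesis by blast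
    qed
    then obtain i j where "(i, j) \<in> G" "l j j - l i i \<notin> range lconst \<or> l j i * l i j \<notin> range lconst"
      by (elim exE conjE)
    then show ?thesis by (rule edge_violation_irreducible[OF G_iff G_sym G_conn])
  qed
  moreover have "holds_generically (\<lambda>V. irreducible (dispersion_poly edges act w u V))"
    if not: "\<not> (cond_I edges act w u \<and> cond_II edges act u \<and> cond_III edges act u)"
  proof -
    obtain V0 where V0: "irreducible (charpol l UNIV V0)" using ex[OF not] by blast
    have "degree (charpol l UNIV V) = CARD('n)" "lead_coeff (charpol l UNIV V) = 1" for V
      using charpol_monic[of UNIV l V] by auto
    moreover have "1 \<le> CARD('n)" using assms(6) by simp
    ultimately obtain g where "g \<in> polyfun" "g V0 \<noteq> 0" "\<forall>V. g V \<noteq> 0 \<longrightarrow> irreducible (charpol l UNIV V)"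
      by (rule irreducible_open[OF charpol_polyfam _ _ _ V0])
    then show ?thesis
      by (intro holds_generically_polyfun[of g V0]) (auto simp: dispersion_poly_charpol l_def)
  qed
  moreover have "\<not> (\<forall>V. reducible (dispersion_poly edges act w u V))"
    if not: "\<not> (cond_I edges act w u \<and> cond_II edges act u \<and> cond_III edges act u)"
  proof -
    obtain V0 where V0: "irreducible (charpol l UNIV V0)" using ex[OF not] by blast
    have "dispersion_poly edges act w u (\<chi> i. V0 i) = charpol l UNIV V0"
      by (simp add: dispersion_poly_charpol l_def)
    then have "\<not> reducible (dispersion_poly edges act w u (\<chi> i. V0 i))"
      using V0 by (auto simp: reducible_def irreducible_def)
    then show ?thesis by blast
  qed
  ultimately show ?thesis by blast
qed

end
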